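(* Assume that $\varphi$ is non-contractive, let $(S,\iota)$ be a free analytic 1-submanifold of $M$ with $S\notin\mathcal F(S)$, assume that $S$ is positive, and let $\Sigma\in\mathcal M(S)$ be compact with $\Sigma\subset\mathrm{int}[S]$, with a fixed $\Sigma$-decomposition of $S$ with segments $\Sigma_k$ and classes $[g_k]$ (so $\Sigma_0=\Sigma$). Write $\partial_{\Sigma_0}=\{z_0,z_1\}$ with $z_1\in\partial_{\Sigma_1}$ (hence $g_1\cdot\iota(z_0)=\iota(z_1)$), and let $K\in\mathrm{Seg}(S)$ be compact with $K\subseteq\Sigma_1$ and $\partial_K=\{z_1,z_1'\}$. Then there exists a compact (necessarily positive) $\Sigma'\in\mathcal M(S)$ with $\Sigma'\subseteq\Sigma_0\cup\Sigma_1$, $K\subseteq\Sigma'$ and $\partial_{\Sigma'}=\{z_0',z_1'\}$ for some $z_0'\in\Sigma_0$. Additionally: a) If $z_1'\in\mathrm{int}[\Sigma_1]$, then $z_0'\in\mathrm{int}[\Sigma_0]$, $z_1\in\mathrm{int}[\Sigma']$ and $\Sigma'\subset\mathrm{int}[\Sigma_0\cup\Sigma_1]$. b) If $S\cong D$ (an interval) with $\mathfrak n_+=1$, and if $K=\Sigma_1$ and $\Sigma_+\subset\Sigma_0$ (where $\Sigma_+$ is the boundary segment of $\Sigma_0$ with $g_1\cdot\iota(\Sigma_+)=\iota(\Sigma_1)$), then $z_0'\in\mathrm{int}[\Sigma_0]$, $z_1\in\mathrm{int}[\Sigma']$ and $\Sigma'\subseteq\Sigma_0\cup\Sigma_1$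.
   Context: Basic setting. Manifolds and Lie groups are finite-dimensional, Hausdorff, real analytic, without boundary unless stated otherwise, and not assumed second countable. $\varphi\colon G\times M\to M$, $(g,x)\mapsto g\cdot x$, is a left action of a Lie group $G$ on an analytic manifold $M$ such that $g\mapsto g\cdot x$ is continuous for each $x\in M$. $\varphi$ is analytic in $M$ if $x\mapsto g\cdot x$ is analytic for each $g\in G$; it is non-contractive if it is analytic in $M$ and for each $C\subseteq M$ with $|C|\ge 2$ and each $x\in M\setminus C$ there is a neighbourhood $U$ of $x$ with $g\cdot C\not\subseteq U$ for all $g\in G$. An analytic 1-submanifold $(S,\iota)$ of $M$ consists of a connected, Hausdorff, second countable 1-dimensional analytic manifold $S$ with (possibly empty) boundary and an injective analytic immersion $\iota\colon S\to M$. There is a homeomorphism $\upsilon\colon B\to S$ where either $B=U(1)$ (written $S\cong U(1)$) or $B=D\subseteq\mathbb R$ is a nondegenerate interval (written $S\cong D$). A segment is a connected subset of $S$ with more than one point; $\mathrm{Seg}(S)$ is the set of segments. For $\Sigma\in\mathrm{Seg}(S)$: $\mathrm{int}[\Sigma]:=\upsilon(\text{topological interior of }\upsilon^{-1}(\Sigma)\text{ in }U(1)\text{ resp. }\mathbb R)$ and $\partial_\Sigma:=\Sigma\setminus\mathrm{int}[\Sigma]$. A boundary segment of $\Sigma$ is a segment $\Sigma'\subseteq\Sigma$ with $\Sigma\setminus\Sigma'$ connected (possibly empty). The symbol $\subset$ means proper inclusion. $g\cdot\iota$ denotes $z\mapsto g\cdot\iota(z)$; $G_x$ is the stabilizer of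 $x\in M$, $G_z:=G_{\iota(z)}$ for $z\in S$, $G_S:=\bigcap_{z\in S}G_{\iota(z)}$, $\mathcal H(S):=G/G_S$ (left cosets), and $[g]\in\mathcal H(S)$ is the class of $g$. For $\Sigma,\Sigma'\in\mathrm{Seg}(S)$ and $g\in G$, write $g\cdot\iota|_\Sigma\sim_\circ\iota|_{\Sigma'}$ if $g\cdot\iota(O)=\iota(O')$ for open (in $S$) segments $O\subseteq\Sigma$, $O'\subseteq\Sigma'$ on which $\iota$ is an embedding. $\Sigma\in\mathrm{Seg}(S)$ is a free segment, $\Sigma\in\mathcal F(S)$, if for $g\in G$: $g\cdot\iota|_\Sigma\sim_\circ\iota|_\Sigma\Leftrightarrow g\in G_S$. $\mathcal M(S)$ is the set of inclusion-maximal elements of $\mathcal F(S)$. $(S,\iota)$ is free if $\mathcal F(S)\neq\emptyset$. Positive. Let $\Sigma\in\mathcal M(S)$ be compact with $\Sigma\subset S$. For $z\in\partial_\Sigma\cap\mathrm{int}[S]$ (this set is non-empty) let $[g_z]\neq[e]$ be the unique class in $\mathcal H(S)$ for which there exist a compact segment $\Sigma_b\subseteq\Sigma$ with $b\in\partial_\Sigma\cap\partial_{\Sigma_b}$ and a compact $\Sigma_z\in\mathcal F(S)$ with $\Sigma\cap\Sigma_z=\partial_\Sigma\cap\partial_{\Sigma_z}=\{z\}$ such that $g_z\cdot\iota(\Sigma_b)=\iota(\Sigma_z)$ and $g_z\cdot\iota(b)=\iota(z)$. $\Sigma$ is positive if $g_z\notin G_z$ for every $z\in\partial_\Sigma\cap\mathrm{int}[S]$.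 $S$ is called positive if $S$ admits no $z$-decomposition and each compact $\Sigma\in\mathcal M(S)$ is positive. Here (only for $S\cong D$, $z\in\mathrm{int}[S]$) a $z$-decomposition is a class $[e]\neq[g]\in\mathcal H(S)$ with $g\in G_z$ such that there are compact segments $K_\pm\subseteq S$ with $g\cdot\iota(K_-)=\iota(K_+)$, $K_-\cap K_+=\{z\}$, and $\Sigma_\pm\in\mathcal F(S)$ for the unique boundary segments $\Sigma_\pm$ of $S$ with $S=\Sigma_-\cup\Sigma_+$, $\Sigma_-\cap\Sigma_+=\{z\}$, $K_\pm\subseteq\Sigma_\pm$. $\Sigma$-decomposition, $S\cong U(1)$. For $\Sigma\in\mathcal M(S)$, $\Sigma\subset S$: a $\Sigma$-decomposition consists of (compact) $\Sigma_0,\dots,\Sigma_n\in\mathcal M(S)$, $n\ge1$, and classes $[g_0],\dots,[g_n]\in\mathcal H(S)$ with $\Sigma_0=\Sigma$, $S=\bigcup_{k=0}^n\Sigma_k$, $g_k\cdot\iota(\Sigma_0)=\iota(\Sigma_k)$ for $0\le k\le n$; if $n=1$, $\Sigma_0\cap\Sigma_1=\partial_{\Sigma_0}\cap\partial_{\Sigma_1}$ consists of the two boundary points of $\Sigma_0$ and $\Sigma_1$; if $n\ge2$, $\Sigma_p\cap\Sigma_q=\partial_{\Sigma_p}\cap\partial_{\Sigma_q}$ is a singleton for $|p-q|\in\{1,n\}$ and empty for $2\le|p-q|\le n-1$. $\Sigma$-decomposition, $S\cong D$. For compact $\Sigma\in\mathcal M(S)$, $\Sigma\subset\mathrm{int}[S]$: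 a $\Sigma$-decomposition is a pair $(\{\Sigma_n\}_{n\in\mathfrak n},\{[g_n]\}_{n\in\mathfrak n})$ with $\mathfrak n=\{n\in\mathbb Z\mid\mathfrak n_-\le n\le\mathfrak n_+\}$, $\mathfrak n_\pm\in\mathbb Z_{\ne0}\cup\{-\infty,\infty\}$, $\mathfrak n_-<0<\mathfrak n_+$, $[g_n]\in\mathcal H(S)$, and segments $\Sigma_n$ on which $\iota$ is an embedding, such that: $\Sigma_0=\Sigma$, and $\Sigma_{\mathfrak n_\pm}$ is a boundary segment of $S$ if $\mathfrak n_\pm\ne\pm\infty$; $\Sigma_p\cap\Sigma_q=\partial_{\Sigma_p}\cap\partial_{\Sigma_q}$ is a singleton for $|p-q|=1$ and empty for $|p-q|\ge2$; $g_n\cdot\iota(\Sigma_0)=\iota(\Sigma_n)$ for $\mathfrak n_-<n<\mathfrak n_+$, and $g_{\mathfrak n_\pm}\cdot\iota(\Sigma_\pm)=\iota(\Sigma_{\mathfrak n_\pm})$ if $\mathfrak n_\pm\neq\pm\infty$, for certain boundary segments $\Sigma_\pm$ of $\Sigma_0$. *)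

theory Defs
  imports
    "HOL-Analysis.Analysis"
    "HOL-Algebra.Group_Action"
    "HOL-Algebra.Left_Coset"
    "HOL-Library.Extended"
begin

section \<open>Real analytic manifolds\<close>

text \<open>
  Coordinates live in \<^const>\<open>Euclidean_space\<close>, whose points are the sequences vanishing from
  index \<open>n\<close> on, so that the dimension is a number (possibly \<open>0\<close>, as for discrete groups).

  A function is analytic on \<open>A\<close> if around each point of \<open>A\<close> it is given on \<open>A\<close> by a convergent power
  series, summed over the multi-indices \<open>\<alpha>\<close> supported in \<open>{..<n}\<close>. At a boundary point of
  a half-space this means that the function extends analytically to a neighbourhood of the point.
\<close>

definition real_analytic_on :: "nat \<Rightarrow> (nat \<Rightarrow> real) set \<Rightarrow> ((nat \<Rightarrow> real) \<Rightarrow> real) \<Rightarrow> bool" where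
  "real_analytic_on n A f \<longleftrightarrow>
     (\<forall>x\<in>A. \<exists>r>0. \<exists>c :: (nat \<Rightarrow> nat) \<Rightarrow> real. \<forall>y\<in>A. (\<forall>i<n. \<bar>y i - x i\<bar> < r) \<longrightarrow>
        ((\<lambda>\<alpha>. c \<alpha> * (\<Prod>i<n. (y i - x i) ^ \<alpha> i)) has_sum f y) {\<alpha>. \<forall>i\<ge>n. \<alpha> i = 0})"

record 'a amfd =
  mtop :: "'a topology"
  mdim :: nat
  matlas :: "('a set \<times> ('a \<Rightarrow> nat \<Rightarrow> real)) set"

abbreviation points :: "'a amfd \<Rightarrow> 'a set" where
  "points X \<equiv> topspace (mtop X)"

definition chart_rep ::
  "'a set \<times> ('a \<Rightarrow> nat \<Rightarrow> real) \<Rightarrow> 'b set \<times> ('b \<Rightarrow> nat \<Rightarrow> real) \<Rightarrow> ('a \<Rightarrow> 'b) \<Rightarrow> (nat \<Rightarrow> real) \<Rightarrow> nat \<Rightarrow> real" where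
  "chart_rep c d f x = snd d (f (inv_into (fst c) (snd c) x))"

definition chart_dom ::
  "'a set \<times> ('a \<Rightarrow> nat \<Rightarrow> real) \<Rightarrow> 'b set \<times> ('b \<Rightarrow> nat \<Rightarrow> real) \<Rightarrow> ('a \<Rightarrow> 'b) \<Rightarrow> (nat \<Rightarrow> real) set" where
  "chart_dom c d f = snd c ` {p \<in> fst c. f p \<in> fst d}"

text \<open>Charts are homeomorphisms onto open subsets of the model \<open>H \<subseteq> \<real>\<^sup>n\<close>: everything, or a half-space.\<close>

definition modelled_on :: "(nat \<Rightarrow> real) set \<Rightarrow> 'a amfd \<Rightarrow> bool" where
  "modelled_on H X \<longleftrightarrow>
     Hausdorff_space (mtop X) \<and>
     \<Union> (fst ` matlas X) = points X \<and>
     (\<forall>(U, \<kappa>) \<in> matlas X.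
        openin (mtop X) U \<and>
        openin (subtopology (Euclidean_space (mdim X)) H) (\<kappa> ` U) \<and>
        homeomorphic_map (subtopology (mtop X) U) (subtopology (Euclidean_space (mdim X)) (\<kappa> ` U)) \<kappa>) \<and>
     (\<forall>c \<in> matlas X. \<forall>d \<in> matlas X. \<forall>j < mdim X.
        real_analytic_on (mdim X) (chart_dom c d id) (\<lambda>x. chart_rep c d id x j))"

definition analytic_manifold :: "'a amfd \<Rightarrow> bool" where
  "analytic_manifold X \<longleftrightarrow> modelled_on UNIV X"

definition analytic_manifold_with_boundary :: "'a amfd \<Rightarrow> bool" where
  "analytic_manifold_with_boundary X \<longleftrightarrow> modelled_on {x. 0 \<le> x 0} X"

definition analytic_map :: "'a amfd \<Rightarrow> 'b amfd \<Rightarrow> ('a \<Rightarrow> 'b) \<Rightarrow> bool" where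
  "analytic_map X Y f \<longleftrightarrow>
     continuous_map (mtop X) (mtop Y) f \<and>
     (\<forall>c \<in> matlas X. \<forall>d \<in> matlas Y. \<forall>j < mdim Y.
        real_analytic_on (mdim X) (chart_dom c d f) (\<lambda>x. chart_rep c d f x j))"

text \<open>
  Injectivity of the differential, expressed by the Jacobian matrix \<open>J\<close> in charts. The partial
  derivatives are taken within the chart domain, hence are one-sided at boundary points.
\<close>

definition analytic_immersion :: "'a amfd \<Rightarrow> 'b amfd \<Rightarrow> ('a \<Rightarrow> 'b) \<Rightarrow> bool" where
  "analytic_immersion X Y f \<longleftrightarrow>
     analytic_map X Y f \<and>
     (\<forall>c \<in> matlas X. \<forall>d \<in> matlas Y. \<forall>x \<in> chart_dom c d f. \<exists>J :: nat \<Rightarrow> nat \<Rightarrow> real.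
        (\<forall>i < mdim X. \<forall>j < mdim Y.
           ((\<lambda>t. chart_rep c d f (x(i := t)) j) has_real_derivative J j i)
             (at (x i) within {t. x(i := t) \<in> chart_dom c d f})) \<and>
        (\<forall>v :: nat \<Rightarrow> real. (\<forall>j < mdim Y. (\<Sum>i < mdim X. J j i * v i) = 0) \<longrightarrow> (\<forall>i < mdim X. v i = 0)))"

definition prod_amfd :: "'a amfd \<Rightarrow> 'b amfd \<Rightarrow> ('a \<times> 'b) amfd" where
  "prod_amfd X Y =
     \<lparr>mtop = prod_topology (mtop X) (mtop Y),
      mdim = mdim X + mdim Y,
      matlas = {(U \<times> V, \<lambda>(a, b) i. if i < mdim X then \<kappa> a i else \<psi> b (i - mdim X)) | U \<kappa> V \<psi>.
                  (U, \<kappa>) \<in> matlas X \<and> (V, \<psi>) \<in> matlas Y}\<rparr>"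

definition lie_group :: "'g monoid \<Rightarrow> 'g amfd \<Rightarrow> bool" where
  "lie_group G L \<longleftrightarrow>
     group G \<and> analytic_manifold L \<and> points L = carrier G \<and>
     analytic_map (prod_amfd L L) L (\<lambda>(a, b). a \<otimes>\<^bsub>G\<^esub> b) \<and>
     analytic_map L L (\<lambda>a. inv\<^bsub>G\<^esub> a)"

section \<open>Actions and 1-submanifolds\<close>

definition pointwise_continuous_action :: "'g monoid \<Rightarrow> 'g amfd \<Rightarrow> 'm amfd \<Rightarrow> ('g \<Rightarrow> 'm \<Rightarrow> 'm) \<Rightarrow> bool" where
  "pointwise_continuous_action G L M \<phi> \<longleftrightarrow>
     group_action G (points M) \<phi> \<and>
     (\<forall>x \<in> points M. continuous_map (mtop L) (mtop M) (\<lambda>g. \<phi> g x))"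

definition analytic_in :: "'g monoid \<Rightarrow> 'm amfd \<Rightarrow> ('g \<Rightarrow> 'm \<Rightarrow> 'm) \<Rightarrow> bool" where
  "analytic_in G M \<phi> \<longleftrightarrow> (\<forall>g \<in> carrier G. analytic_map M M (\<phi> g))"

definition non_contractive :: "'g monoid \<Rightarrow> 'm amfd \<Rightarrow> ('g \<Rightarrow> 'm \<Rightarrow> 'm) \<Rightarrow> bool" where
  "non_contractive G M \<phi> \<longleftrightarrow>
     analytic_in G M \<phi> \<and>
     (\<forall>C. C \<subseteq> points M \<and> (\<exists>a\<in>C. \<exists>b\<in>C. a \<noteq> b) \<longrightarrow>
        (\<forall>x \<in> points M - C. \<exists>U. openin (mtop M) U \<and> x \<in> U \<and>
           (\<forall>g \<in> carrier G. \<not> \<phi> g ` C \<subseteq> U)))"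

definition analytic_1_submanifold :: "'m amfd \<Rightarrow> 's amfd \<Rightarrow> ('s \<Rightarrow> 'm) \<Rightarrow> bool" where
  "analytic_1_submanifold M S \<iota> \<longleftrightarrow>
     analytic_manifold_with_boundary S \<and> mdim S = 1 \<and>
     connected_space (mtop S) \<and> second_countable (mtop S) \<and>
     analytic_immersion S M \<iota> \<and> inj_on \<iota> (points S)"

section \<open>Segments\<close>

abbreviation unit_circle :: "complex set" where
  "unit_circle \<equiv> sphere 0 1"

definition nondegenerate_interval :: "real set \<Rightarrow> bool" where
  "nondegenerate_interval D \<longleftrightarrow> is_interval D \<and> (\<exists>a\<in>D. \<exists>b\<in>D. a < b)"

definition circle_like :: "'s amfd \<Rightarrow> bool" where
  "circle_like S \<longleftrightarrow> top_of_set unit_circle homeomorphic_space mtop S"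

definition interval_like :: "'s amfd \<Rightarrow> bool" where
  "interval_like S \<longleftrightarrow> (\<exists>D. nondegenerate_interval D \<and> top_of_set D homeomorphic_space mtop S)"

definition segments :: "'s amfd \<Rightarrow> 's set set" where
  "segments S = {A. connectedin (mtop S) A \<and> (\<exists>a\<in>A. \<exists>b\<in>A. a \<noteq> b)}"

text \<open>
  The interior is transported along a homeomorphism \<open>\<upsilon>\<close> from the unit circle or from an interval
  \<open>D\<close> onto \<open>S\<close>; the result does not depend on the choice of \<open>\<upsilon>\<close> and \<open>D\<close>, so all choices are
  collected. In the second case it is the interior in \<open>\<real>\<close>, not in \<open>D\<close>: endpoints of \<open>S\<close>
  are never interior.
\<close>

definition seg_int :: "'s amfd \<Rightarrow> 's set \<Rightarrow> 's set" where
  "seg_int S A =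
     {z. \<exists>\<upsilon>. homeomorphic_map (top_of_set unit_circle) (mtop S) \<upsilon> \<and>
          z \<in> \<upsilon> ` (top_of_set unit_circle interior_of {w \<in> unit_circle. \<upsilon> w \<in> A})} \<union>
     {z. \<exists>D \<upsilon>. nondegenerate_interval D \<and> homeomorphic_map (top_of_set D) (mtop S) \<upsilon> \<and>
          z \<in> \<upsilon> ` interior {t \<in> D. \<upsilon> t \<in> A}}"

definition seg_bd :: "'s amfd \<Rightarrow> 's set \<Rightarrow> 's set" where
  "seg_bd S A = A - seg_int S A"

definition boundary_segment :: "'s amfd \<Rightarrow> 's set \<Rightarrow> 's set \<Rightarrow> bool" where
  "boundary_segment S A B \<longleftrightarrow> B \<in> segments S \<and> B \<subseteq> A \<and> connectedin (mtop S) (A - B)"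

section \<open>Free segments, positivity and decompositions\<close>

context
  fixes G :: "'g monoid" and M :: "'m amfd" and \<phi> :: "'g \<Rightarrow> 'm \<Rightarrow> 'm"
    and S :: "'s amfd" and \<iota> :: "'s \<Rightarrow> 'm"
begin

definition stab_submfd :: "'g set" where
  "stab_submfd = (\<Inter>z \<in> points S. stabilizer G \<phi> (\<iota> z))"

definition cls :: "'g \<Rightarrow> 'g set" where
  "cls g = g <#\<^bsub>G\<^esub> stab_submfd"

definition embedded :: "'s set \<Rightarrow> bool" where
  "embedded A \<longleftrightarrow> embedding_map (subtopology (mtop S) A) (mtop M) \<iota>"

text \<open>\<open>overlap g A A'\<close> is \<open>g \<cdot> \<iota>|\<^bsub>A\<^esub> \<sim>\<^sub>\<circ> \<iota>|\<^bsub>A'\<^esub>\<close>. As \<open>\<iota>\<close> is an immersion, embeddedness is purely topological.\<close>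

definition overlap :: "'g \<Rightarrow> 's set \<Rightarrow> 's set \<Rightarrow> bool" where
  "overlap g A A' \<longleftrightarrow>
     (\<exists>O1 O2. O1 \<in> segments S \<and> O2 \<in> segments S \<and>
        openin (mtop S) O1 \<and> openin (mtop S) O2 \<and> O1 \<subseteq> A \<and> O2 \<subseteq> A' \<and>
        embedded O1 \<and> embedded O2 \<and> \<phi> g ` \<iota> ` O1 = \<iota> ` O2)"

definition free_segments :: "'s set set" where
  "free_segments = {A \<in> segments S. \<forall>g \<in> carrier G. overlap g A A \<longleftrightarrow> g \<in> stab_submfd}"

definition max_free_segments :: "'s set set" where
  "max_free_segments = {A \<in> free_segments. \<forall>B \<in> free_segments. A \<subseteq> B \<longrightarrow> B = A}"

definition free_submanifold :: bool where
  "free_submanifold \<longleftrightarrow> free_segments \<noteq> {}"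

text \<open>
  The class of \<open>g\<^sub>z\<close>. For compact \<open>A \<subset> points S\<close> in \<^const>\<open>max_free_segments\<close> and \<open>z\<close> as in
  \<open>positive_segment\<close> below there is exactly one such class; elsewhere the value is not used.
\<close>

definition bd_class :: "'s set \<Rightarrow> 's \<Rightarrow> 'g set" where
  "bd_class A z =
     (THE c. c \<in> lcosets\<^bsub>G\<^esub> stab_submfd \<and> c \<noteq> cls \<one>\<^bsub>G\<^esub> \<and>
        (\<exists>g\<in>c. \<exists>A\<^sub>b \<in> segments S. \<exists>b. \<exists>A\<^sub>z \<in> free_segments.
           compactin (mtop S) A\<^sub>b \<and> A\<^sub>b \<subseteq> A \<and> b \<in> seg_bd S A \<inter> seg_bd S A\<^sub>b \<and>
           compactin (mtop S) A\<^sub>z \<and> A \<inter> A\<^sub>z = {z} \<and> seg_bd S A \<inter> seg_bd S A\<^sub>z = {z} \<and>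
           \<phi> g ` \<iota> ` A\<^sub>b = \<iota> ` A\<^sub>z \<and> \<phi> g (\<iota> b) = \<iota> z))"

definition positive_segment :: "'s set \<Rightarrow> bool" where
  "positive_segment A \<longleftrightarrow>
     (\<forall>z \<in> seg_bd S A \<inter> seg_int S (points S). \<forall>g \<in> bd_class A z. g \<notin> stabilizer G \<phi> (\<iota> z))"

definition z_decomposition :: "'s \<Rightarrow> 'g set \<Rightarrow> bool" where
  "z_decomposition z c \<longleftrightarrow>
     interval_like S \<and> z \<in> seg_int S (points S) \<and>
     c \<in> lcosets\<^bsub>G\<^esub> stab_submfd \<and> c \<noteq> cls \<one>\<^bsub>G\<^esub> \<and>
     (\<exists>g\<in>c. g \<in> stabilizer G \<phi> (\<iota> z) \<and>
       (\<exists>K\<^sub>1 \<in> segments S. \<exists>K\<^sub>2 \<in> segments S. \<exists>A\<^sub>1 \<in> free_segments. \<exists>A\<^sub>2 \<in> free_segments.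
          compactin (mtop S) K\<^sub>1 \<and> compactin (mtop S) K\<^sub>2 \<and>
          \<phi> g ` \<iota> ` K\<^sub>1 = \<iota> ` K\<^sub>2 \<and> K\<^sub>1 \<inter> K\<^sub>2 = {z} \<and>
          boundary_segment S (points S) A\<^sub>1 \<and> boundary_segment S (points S) A\<^sub>2 \<and>
          points S = A\<^sub>1 \<union> A\<^sub>2 \<and> A\<^sub>1 \<inter> A\<^sub>2 = {z} \<and> K\<^sub>1 \<subseteq> A\<^sub>1 \<and> K\<^sub>2 \<subseteq> A\<^sub>2))"

definition positive_submanifold :: bool where
  "positive_submanifold \<longleftrightarrow>
     (\<nexists>z c. z_decomposition z c) \<and>
     (\<forall>A \<in> max_free_segments. compactin (mtop S) A \<longrightarrow> positive_segment A)"

text \<open>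
  In the following two definitions the classes are given by representatives \<open>g k\<close>. All conditions
  depend only on \<open>cls (g k)\<close>, since \<^const>\<open>stab_submfd\<close> fixes \<open>\<iota> ` points S\<close> pointwise.
\<close>

definition circle_decomposition :: "'s set \<Rightarrow> int \<Rightarrow> (int \<Rightarrow> 's set) \<Rightarrow> (int \<Rightarrow> 'g) \<Rightarrow> bool" where
  "circle_decomposition A n sg g \<longleftrightarrow>
     circle_like S \<and> A \<in> max_free_segments \<and> A \<subset> points S \<and>
     n \<ge> 1 \<and> sg 0 = A \<and> points S = (\<Union>k\<in>{0..n}. sg k) \<and>
     (\<forall>k\<in>{0..n}. sg k \<in> max_free_segments \<and> compactin (mtop S) (sg k) \<and>
        g k \<in> carrier G \<and> \<phi> (g k) ` \<iota> ` sg 0 = \<iota> ` sg k) \<and>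
     (n = 1 \<longrightarrow>
        sg 0 \<inter> sg 1 = seg_bd S (sg 0) \<inter> seg_bd S (sg 1) \<and>
        sg 0 \<inter> sg 1 = seg_bd S (sg 0) \<and> sg 0 \<inter> sg 1 = seg_bd S (sg 1) \<and>
        card (sg 0 \<inter> sg 1) = 2) \<and>
     (n \<ge> 2 \<longrightarrow> (\<forall>p\<in>{0..n}. \<forall>q\<in>{0..n}.
        (\<bar>p - q\<bar> \<in> {1, n} \<longrightarrow>
           sg p \<inter> sg q = seg_bd S (sg p) \<inter> seg_bd S (sg q) \<and> is_singleton (sg p \<inter> sg q)) \<and>
        (2 \<le> \<bar>p - q\<bar> \<and> \<bar>p - q\<bar> \<le> n - 1 \<longrightarrow> sg p \<inter> sg q = {})))"

definition interval_decomposition ::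
  "'s set \<Rightarrow> int extended \<Rightarrow> int extended \<Rightarrow> (int \<Rightarrow> 's set) \<Rightarrow> (int \<Rightarrow> 'g) \<Rightarrow> bool" where
  "interval_decomposition A n\<^sub>m n\<^sub>p sg g \<longleftrightarrow>
     interval_like S \<and> A \<in> max_free_segments \<and> compactin (mtop S) A \<and> A \<subset> seg_int S (points S) \<and>
     n\<^sub>m < Fin 0 \<and> Fin 0 < n\<^sub>p \<and> sg 0 = A \<and>
     (\<forall>n. n\<^sub>m \<le> Fin n \<and> Fin n \<le> n\<^sub>p \<longrightarrow> g n \<in> carrier G \<and> sg n \<in> segments S \<and> embedded (sg n)) \<and>
     (\<forall>p q. n\<^sub>m \<le> Fin p \<and> Fin p \<le> n\<^sub>p \<and> n\<^sub>m \<le> Fin q \<and> Fin q \<le> n\<^sub>p \<longrightarrow>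
        (\<bar>p - q\<bar> = 1 \<longrightarrow>
           sg p \<inter> sg q = seg_bd S (sg p) \<inter> seg_bd S (sg q) \<and> is_singleton (sg p \<inter> sg q)) \<and>
        (2 \<le> \<bar>p - q\<bar> \<longrightarrow> sg p \<inter> sg q = {})) \<and>
     (\<forall>n. n\<^sub>m < Fin n \<and> Fin n < n\<^sub>p \<longrightarrow> \<phi> (g n) ` \<iota> ` sg 0 = \<iota> ` sg n) \<and>
     (\<forall>n. Fin n = n\<^sub>m \<or> Fin n = n\<^sub>p \<longrightarrow>
        boundary_segment S (points S) (sg n) \<and>
        (\<exists>B. boundary_segment S (sg 0) B \<and> \<phi> (g n) ` \<iota> ` B = \<iota> ` sg n))"

end

end

(*
  Parametrize Sigma_0 by a : [0,1] -> S from z_0 to z_1 and let b be the arc in Sigma_1 given by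
  iota o b = g_1 . iota o a. The point z_1 is b(e) for an endpoint e of the domain of b. If 0 < e < 1, the
  analytic curves g_1 . iota o a and iota agree on one side of z_1, hence on both, so that g_1 maps a part
  of Sigma_0 onto a part of Sigma_0 near z_1; then g_1 fixes iota(S) by freeness, a contradiction. If
  e = 1, g_1 represents the boundary class of Sigma_0 at z_1 and fixes iota(z_1), against positivity. So
  e = 0, which is the first claim, and g_1 acts on the concatenation rho of a and b as the shift by 1.

  Write K = b[0,s]. The segment Sigma' = rho[s,1+s] is free: where an overlap h relates the a-part to the
  b-part, g_1^-1 h is an overlap of Sigma_0 with itself, hence fixes iota(S), and this forces parameters
  in [s,1] to coincide with parameters in [0,s]. It is maximal: any larger segment contains a germ of rho
  beyond one of the ends s, 1+s, and g_1 shifts the germ at s to the germ at 1+s. At the far end of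
  Sigma_1 one uses instead that Sigma_1 is maximal, that g_1 g_2^-1 maps Sigma_2 into Sigma_1, or that
  S stops there.

  The identity principle and the two-sided extension are obtained in charts, by extending the
  coordinate functions of the curves to holomorphic functions of one variable.
*)

theory Submission
  imports Defs "HOL-Complex_Analysis.Complex_Analysis"
begin

section \<open>Arcs\<close>

text \<open>The decomposition gives only equalities of point sets such as g_1 . iota(Sigma_0) =
  iota(Sigma_1). Which end goes to which must be found out, and there positivity does its work. An
  inner parameter e is conceivable because with n_+ = 1 only a boundary segment of Sigma_0 is
  carried onto Sigma_1. The domain J of b is then a subinterval of [0,1] that may even be half-open,
  since S need not contain its ends. The inclusion of Sigma in int[S] puts a(e) and z_1 where an
  extension to the other side makes sense. A second obstacle: iota is merely an injective immersion,
  so a curve in iota(S) need not lift continuously to S. Sets are therefore probed by arcs,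
  injective paths on compact intervals. On the image of an arc iota is an embedding, the open part
  of an arc is open in S, and interior, boundary and overlap of segments can be tested on arcs. For
  circle and interval alike this turns the topology of S into statements about continuous injective
  real functions.\<close>

definition arcin :: "'a topology \<Rightarrow> 'a set \<Rightarrow> real \<Rightarrow> real \<Rightarrow> (real \<Rightarrow> 'a) \<Rightarrow> bool" where
  "arcin X C a b p \<longleftrightarrow>
     a < b \<and> continuous_map (top_of_set {a..b}) X p \<and> inj_on p {a..b} \<and> p ` {a..b} \<subseteq> C"

lemma arcin_mono: "arcin X C a b p \<Longrightarrow> C \<subseteq> D \<Longrightarrow> arcin X D a b p"
  by (auto simp: arcin_def)

lemma arcin_image: "arcin X C a b p \<Longrightarrow> arcin X (p ` {a..b}) a b p"
  by (auto simp: arcin_def)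

lemma arcin_topspace: "arcin X C a b p \<Longrightarrow> p ` {a..b} \<subseteq> topspace X"
  using continuous_map_image_subset_topspace[of "top_of_set {a..b}" X p] by (auto simp: arcin_def)

lemma arcin_inj: "arcin X C a b p \<Longrightarrow> t \<in> {a..b} \<Longrightarrow> u \<in> {a..b} \<Longrightarrow> p t = p u \<longleftrightarrow> t = u"
  unfolding arcin_def by (meson inj_on_eq_iff)

lemma arcin_comp:
  assumes "arcin X C a b p" and "continuous_on {c..d} f" and "inj_on f {c..d}"
    and "f ` {c..d} \<subseteq> {a..b}" and "c < d"
  shows "arcin X (p ` f ` {c..d}) c d (p \<circ> f)"
proof -
  have "continuous_map (top_of_set {c..d}) (top_of_set {a..b}) f"
    using assms by auto
  then have "continuous_map (top_of_set {c..d}) X (p \<circ> f)"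
    using continuous_map_compose assms(1) unfolding arcin_def by blast
  moreover have "inj_on (p \<circ> f) {c..d}"
    using assms by (meson arcin_def comp_inj_on inj_on_subset)
  ultimately show ?thesis
    using assms by (auto simp: arcin_def)
qed

lemma arcin_sub:
  assumes "arcin X C a b p" and "a \<le> c" "c < d" "d \<le> b"
  shows "arcin X (p ` {c..d}) c d p"
  using arcin_comp[OF assms(1), of c d id] assms by auto

text \<open>The slope may be negative, so this also reverses arcs. Since the change of parameter is
  affine, only the two end parameters have to be checked.\<close>

lemma arcin_affine:
  assumes "arcin X C a b p" and "m \<noteq> 0" and "c < d"
    and "a \<le> m * c + e" "m * c + e \<le> b" "a \<le> m * d + e" "m * d + e \<le> b"
  shows "arcin X (p ` {a..b}) c d (\<lambda>t. p (m * t + e))"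
proof -
  have "m * t + e \<in> {a..b}" if "t \<in> {c..d}" for t
  proof (cases "m > 0")
    case True
    then have "m * c \<le> m * t" "m * t \<le> m * d" using that by auto
    then show ?thesis using assms by auto
  next
    case False
    then have "m * t \<le> m * c" "m * d \<le> m * t"
      using that by (auto intro: mult_left_mono_neg)
    then show ?thesis using assms by auto
  qed
  then have *: "(\<lambda>t. m * t + e) ` {c..d} \<subseteq> {a..b}" by blast
  have "arcin X (p ` (\<lambda>t. m * t + e) ` {c..d}) c d (p \<circ> (\<lambda>t. m * t + e))"
    using assms * by (intro arcin_comp[OF assms(1)]) (auto intro!: continuous_intros simp: inj_on_def)
  then show ?thesis
    using arcin_mono[OF _ image_mono[OF *]] by (simp add: comp_def)
qed

lemma arcin_join:
  assumes p: "arcin X C a b p" and q: "arcin X D b c q" and eq: "p b = q b"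
    and disj: "\<And>t u. t \<in> {a..b} \<Longrightarrow> u \<in> {b..c} \<Longrightarrow> p t = q u \<Longrightarrow> t = b \<and> u = b"
  shows "arcin X (C \<union> D) a c (\<lambda>t. if t \<le> b then p t else q t)"
proof -
  have ab: "a < b" "b < c" using p q by (auto simp: arcin_def)
  have eq1: "{x \<in> topspace (top_of_set {a..c}). x \<le> b} = {a..b}"
    and eq2: "{x \<in> topspace (top_of_set {a..c}). b \<le> x} = {b..c}"
    using ab by auto
  have "continuous_map (top_of_set {a..c}) X (\<lambda>t. if t \<le> b then p t else q t)"
  proof (rule continuous_map_cases_le)
    show "continuous_map (subtopology (top_of_set {a..c}) {x \<in> topspace (top_of_set {a..c}). x \<le> b}) X p"
      unfolding eq1 subtopology_subtopology using p ab
      by (auto simp: arcin_def Int_absorb1)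
    show "continuous_map (subtopology (top_of_set {a..c}) {x \<in> topspace (top_of_set {a..c}). b \<le> x}) X q"
      unfolding eq2 subtopology_subtopology using q ab
      by (auto simp: arcin_def Int_absorb1)
  qed (use eq in \<open>auto intro: continuous_map_from_subtopology\<close>)
  moreover have "inj_on (\<lambda>t. if t \<le> b then p t else q t) {a..c}"
  proof (intro inj_onI)
    fix x y assume h: "x \<in> {a..c}" "y \<in> {a..c}"
      "(if x \<le> b then p x else q x) = (if y \<le> b then p y else q y)"
    show "x = y"
    proof (cases "x \<le> b"; cases "y \<le> b")
      assume "x \<le> b" "y \<le> b"
      then show ?thesis using h arcin_inj[OF p, of x y] by simp
    next
      assume "\<not> x \<le> b" "\<not> y \<le> b"
      then show ?thesis using h arcin_inj[OF q, of x y] by simp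
    next
      assume "x \<le> b" "\<not> y \<le> b"
      then show ?thesis using h disj[of x y] by simp
    next
      assume "\<not> x \<le> b" "y \<le> b"
      then show ?thesis using h disj[of y x] by simp
    qed
  qed
  moreover have "p t \<in> C \<union> D" if "t \<in> {a..b}" for t using p that unfolding arcin_def by blast
  moreover have "q t \<in> C \<union> D" if "t \<in> {b..c}" for t using q that unfolding arcin_def by blast
  ultimately show ?thesis
    using ab unfolding arcin_def by (auto simp: image_subset_iff)
qed

lemma arcin_homeomorphic:
  assumes "Hausdorff_space X" and "arcin X C a b p"
  shows "homeomorphic_map (top_of_set {a..b}) (subtopology X (p ` {a..b})) p"
proof (rule continuous_imp_homeomorphic_map)
  show "continuous_map (top_of_set {a..b}) (subtopology X (p ` {a..b})) p"
    using assms by (auto simp: arcin_def continuous_map_in_subtopology)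
  show "p ` topspace (top_of_set {a..b}) = topspace (subtopology X (p ` {a..b}))"
    using arcin_topspace[OF assms(2)] by auto
  show "compact_space (top_of_set {a..b})"
    by (simp add: compact_space_subtopology)
  show "Hausdorff_space (subtopology X (p ` {a..b}))"
    using assms(1) by (rule Hausdorff_space_subtopology)
  show "inj_on p (topspace (top_of_set {a..b}))"
    using assms(2) by (simp add: arcin_def)
qed

lemma arcin_compactin: "arcin X C a b p \<Longrightarrow> compactin X (p ` {a..b})"
  unfolding arcin_def
  by (metis compact_Icc compactin_euclidean_iff compactin_subtopology image_compactin order_refl)

lemma arcin_connectedin: "arcin X C a b p \<Longrightarrow> connectedin X (p ` {a..b})"
  unfolding arcin_def
  by (metis connected_Icc connectedin_iff_connected connectedin_subtopology connectedin_continuous_map_image order_refl)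

text \<open>By compactness an arc is a homeomorphism onto its image, so its inverse turns paths
  inside the image into real functions. Questions about S thereby become questions about functions
  on intervals.\<close>

lemma arcin_pull:
  assumes "Hausdorff_space X" and "arcin X C a b p"
    and q: "continuous_map (top_of_set I) X q" "q ` I \<subseteq> p ` {a..b}"
  obtains f where "continuous_on I f" "f ` I \<subseteq> {a..b}" "\<And>t. t \<in> I \<Longrightarrow> p (f t) = q t"
proof -
  obtain g where g: "homeomorphic_maps (top_of_set {a..b}) (subtopology X (p ` {a..b})) p g"
    using arcin_homeomorphic[OF assms(1,2)] homeomorphic_map_maps by metis
  have qc: "continuous_map (top_of_set I) (subtopology X (p ` {a..b})) q"
    using q by (auto simp: continuous_map_in_subtopology)
  have "continuous_map (subtopology X (p ` {a..b})) (top_of_set {a..b}) g"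
    using g by (simp add: homeomorphic_maps_def)
  then have "continuous_map (top_of_set I) (top_of_set {a..b}) (g \<circ> q)"
    using continuous_map_compose qc by blast
  then have "continuous_on I (g \<circ> q)" "(g \<circ> q) ` I \<subseteq> {a..b}"
    by auto
  moreover have "p ((g \<circ> q) t) = q t" if "t \<in> I" for t
  proof -
    have "q t \<in> topspace (subtopology X (p ` {a..b}))"
      using qc that continuous_map_image_subset_topspace[OF qc] by auto
    then show ?thesis using g by (auto simp: homeomorphic_maps_def)
  qed
  ultimately show thesis using that by blast
qed

section \<open>One-dimensional spaces\<close>

text \<open>
  The circle needs two coordinate intervals, an interval only one. Letting each coordinate domain omit
  at most one prescribed point covers both cases.
\<close>

locale curve =
  fixes X :: "'a topology"
  assumes haus: "Hausdorff_space X"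
    and infin: "infinite (topspace X)"
    and chart: "\<And>w. w \<in> topspace X \<Longrightarrow> \<exists>T D (f :: 'a \<Rightarrow> real) v. openin X T \<and> topspace X - {w} \<subseteq> T \<and>
       is_interval D \<and> homeomorphic_maps (subtopology X T) (top_of_set D) f v"
begin

text \<open>Compares two arcs on the same set: the change of parameter is injective because
  \<open>r\<close> is, hence monotone.\<close>

lemma arc_factor:
  assumes P: "arcin X C a b P" and r: "arcin X (P ` {a..b}) c d r"
  obtains f where "continuous_on {c..d} f" "inj_on f {c..d}" "\<And>t. t \<in> {c..d} \<Longrightarrow> f t \<in> {a..b}"
    "\<And>t. t \<in> {c..d} \<Longrightarrow> P (f t) = r t"
proof -
  obtain f where f: "continuous_on {c..d} f" "f ` {c..d} \<subseteq> {a..b}" "\<And>t. t \<in> {c..d} \<Longrightarrow> P (f t) = r t"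
    using arcin_pull[OF haus P, of "{c..d}" r] r unfolding arcin_def by blast
  have "inj_on f {c..d}"
  proof (rule inj_onI)
    fix t u assume "t \<in> {c..d}" "u \<in> {c..d}" "f t = f u"
    then show "t = u" using f(3)[of t] f(3)[of u] arcin_inj[OF r, of t u] by simp
  qed
  then show thesis using that f by blast
qed

lemma chartE:
  assumes "w \<in> topspace X"
  obtains T D and f :: "'a \<Rightarrow> real" and v where
    "openin X T" "topspace X - {w} \<subseteq> T" "T \<subseteq> topspace X" "is_interval D"
    "continuous_map (subtopology X T) euclideanreal f" "f ` T = D"
    "continuous_map (top_of_set D) X v" "v ` D = T"
    "\<And>x. x \<in> T \<Longrightarrow> v (f x) = x" "\<And>t. t \<in> D \<Longrightarrow> f (v t) = t"
proof -
  obtain T D f v where h: "openin X T" "topspace X - {w} \<subseteq> T" "is_interval D"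
    "homeomorphic_maps (subtopology X T) (top_of_set D) (f :: 'a \<Rightarrow> real) v"
    using chart[OF assms] by blast
  have T: "T \<subseteq> topspace X" using h(1) openin_subset by blast
  then have ts: "topspace (subtopology X T) = T" by auto
  have cf: "continuous_map (subtopology X T) (top_of_set D) f"
    and cv: "continuous_map (top_of_set D) (subtopology X T) v"
    and 3: "\<And>x. x \<in> T \<Longrightarrow> v (f x) = x" "\<And>t. t \<in> D \<Longrightarrow> f (v t) = t"
    using h(4) ts unfolding homeomorphic_maps_def by simp_all
  have 1: "continuous_map (subtopology X T) euclideanreal f" "f ` T \<subseteq> D"
    using cf ts continuous_map_image_subset_topspace[OF cf]
    by (auto simp del: continuous_map_subtopology_eu simp: continuous_map_in_subtopology)
  have 2: "continuous_map (top_of_set D) X v" "v ` D \<subseteq> T"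
    using cv ts continuous_map_image_subset_topspace[OF cv]
    by (auto simp: continuous_map_in_subtopology)
  have "f ` T = D" "v ` D = T"
    using 1(2) 2(2) 3 by (force simp: image_iff image_subset_iff)+
  then show thesis using that[of T D f v] h(1-3) T 1(1) 2(1) 3 by simp
qed

lemma cont_comp:
  assumes "continuous_map (subtopology X T) euclideanreal f" "continuous_map (top_of_set I) X p" "p ` I \<subseteq> T"
  shows "continuous_on I (f \<circ> p)"
proof -
  have "continuous_map (top_of_set I) (subtopology X T) p"
    using assms by (auto simp: continuous_map_in_subtopology)
  then have "continuous_map (top_of_set I) euclideanreal (f \<circ> p)"
    using assms(1) continuous_map_compose by blast
  then show ?thesis by simp
qed

text \<open>Invariance of domain in dimension one: in a coordinate the arc is an injective
  continuous real function, hence open.\<close>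

lemma arc_open:
  assumes "arcin X C a b p"
  shows "openin X (p ` {a<..<b})"
proof -
  have ab: "a < b" and pa: "p a \<in> topspace X"
    using assms arcin_topspace[OF assms] by (auto simp: arcin_def)
  \<comment> \<open>A chart may miss one point. If it misses \<open>p a\<close>, it contains the
    image of [c, b] for every c > a, and these pieces exhaust the open arc.\<close>
  have *: "openin X (p ` {c<..<b})" if c: "a < c" "c < b" for c
  proof -
    obtain T D and f :: "'a \<Rightarrow> real" and v where h: "openin X T" "topspace X - {p a} \<subseteq> T" "T \<subseteq> topspace X" "is_interval D"
    "continuous_map (subtopology X T) euclideanreal f" "f ` T = D"
    "continuous_map (top_of_set D) X v" "v ` D = T"
    "\<And>x. x \<in> T \<Longrightarrow> v (f x) = x" "\<And>t. t \<in> D \<Longrightarrow> f (v t) = t"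
      using chartE[OF pa] by blast
    have pT: "p ` {c..b} \<subseteq> T"
    proof
      fix x assume "x \<in> p ` {c..b}"
      then obtain t where t: "t \<in> {c..b}" "x = p t" by blast
      have "x \<in> topspace X" using arcin_topspace[OF assms] t c by auto
      moreover have "x \<noteq> p a" using arcin_inj[OF assms, of t a] t c by auto
      ultimately show "x \<in> T" using h(2) by auto
    qed
    have "arcin X (p ` {c..b}) c b p" using arcin_sub[OF assms] c by auto
    then have "continuous_map (top_of_set {c..b}) X p" by (auto simp: arcin_def)
    then have co: "continuous_on {c..b} (f \<circ> p)" using cont_comp h(5) pT by blast
    have inj: "inj_on (f \<circ> p) {c..b}"
    proof (rule inj_onI)
      fix t u assume tu: "t \<in> {c..b}" "u \<in> {c..b}" "(f \<circ> p) t = (f \<circ> p) u"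
      have "p t \<in> T" "p u \<in> T" using pT tu by auto
      then have "p t = p u" using h(9)[of "p t"] h(9)[of "p u"] tu(3) unfolding comp_def by metis
      then show "t = u" using arcin_inj[OF assms, of t u] tu(1,2) c by auto
    qed
    have op: "open ((f \<circ> p) ` {c<..<b})"
      using injective_eq_1d_open_map_UNIV[OF co is_interval_cc] inj open_greaterThanLessThan[of c b]
        greaterThanLessThan_subseteq_atLeastAtMost_iff[of c b c b] by simp
    have "openin (subtopology X T) {x \<in> topspace (subtopology X T). f x \<in> (f \<circ> p) ` {c<..<b}}"
      using openin_continuous_map_preimage[OF h(5)] op by simp
    moreover have "{x \<in> topspace (subtopology X T). f x \<in> (f \<circ> p) ` {c<..<b}} = p ` {c<..<b}"
    proof -
      have "p t \<in> T" if "t \<in> {c<..<b}" for t using pT that by auto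
      moreover have "x \<in> p ` {c<..<b}" if x: "x \<in> T" "f x \<in> (f \<circ> p) ` {c<..<b}" for x
      proof -
        obtain t where t: "t \<in> {c<..<b}" "f x = f (p t)" using x(2) by auto
        have "x = v (f x)" using h(9) x(1) by simp
        also have "\<dots> = p t" unfolding t(2) using h(9)[of "p t"] pT t(1) by (auto simp: image_subset_iff)
        finally show ?thesis using t(1) by auto
      qed
      ultimately show ?thesis using h(3) by auto
    qed
    ultimately show ?thesis using h(1) by (metis openin_trans_full)
  qed
  have "p ` {a<..<b} = (\<Union>c\<in>{a<..<b}. p ` {c<..<b})"
  proof -
    have "{a<..<b} = (\<Union>c\<in>{a<..<b}. {c<..<b})"
    proof
      show "{a<..<b} \<subseteq> (\<Union>c\<in>{a<..<b}. {c<..<b})"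
      proof
        fix t assume t: "t \<in> {a<..<b}"
        then obtain c where "a < c" "c < t" using dense[of a t] by auto
        with t show "t \<in> (\<Union>c\<in>{a<..<b}. {c<..<b})" by auto
      qed
    qed auto
    then show ?thesis by (metis image_UN)
  qed
  then show ?thesis using * by auto
qed

text \<open>A curve offers only two directions. Pulled back to the parameter of \<open>p\<close>,
  the beginning of \<open>q\<close> is an interval containing \<open>t\<close> and a further point,
  so it covers a one-sided neighbourhood of \<open>t\<close>. In both cases \<delta> fits into
  [a, b] on both sides of \<open>t\<close>.\<close>

lemma germ:
  assumes p: "arcin X C a b p" and t: "a < t" "t < b" and q: "arcin X C' 0 1 q" and eq: "q 0 = p t"
  obtains \<delta> where "\<delta> > 0" "a \<le> t - \<delta>" "t + \<delta> \<le> b" "p ` {t..t+\<delta>} \<subseteq> q ` {0..1}"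
  | \<delta> where "\<delta> > 0" "a \<le> t - \<delta>" "t + \<delta> \<le> b" "p ` {t-\<delta>..t} \<subseteq> q ` {0..1}"
proof -
  have qc: "continuous_map (top_of_set {0..1}) X q" using q by (simp add: arcin_def)
  have "openin (top_of_set {0..1}) {u \<in> topspace (top_of_set {0..1}). q u \<in> p ` {a<..<b}}"
    using openin_continuous_map_preimage[OF qc arc_open[OF p]] .
  moreover have "0 \<in> {u \<in> topspace (top_of_set {0..1::real}). q u \<in> p ` {a<..<b}}"
    using t eq by auto
  ultimately obtain e where e: "e > 0" "\<And>u. u \<in> {0..1} \<Longrightarrow> dist u 0 < e \<Longrightarrow> q u \<in> p ` {a<..<b}"
    unfolding openin_euclidean_subtopology_iff by blast
  define d where "d = min (1/2) (e/2)"
  have d: "0 < d" "d < 1" using e by (auto simp: d_def)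
  have sub: "q ` {0..d} \<subseteq> p ` {a<..<b}"
    using e(2) d e(1) by (auto simp: d_def)
  have qd: "arcin X (q ` {0..d}) 0 d q" using arcin_sub[OF q] d by auto
  then have "continuous_map (top_of_set {0..d}) X q" by (auto simp: arcin_def)
  then obtain f where f: "continuous_on {0..d} f" "f ` {0..d} \<subseteq> {a..b}" "\<And>u. u \<in> {0..d} \<Longrightarrow> p (f u) = q u"
    using arcin_pull[OF haus p, of "{0..d}" q] sub image_mono[OF greaterThanLessThan_subseteq_atLeastAtMost_iff[THEN iffD2], of a b a b p]
    by blast
  have f2: "f u \<in> {a..b}" if "u \<in> {0..d}" for u using f(2) that by blast
  have f0: "f 0 = t" using f2[of 0] f(3)[of 0] eq d t arcin_inj[OF p, of "f 0" t] by auto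
  have fd: "f d \<noteq> t"
    using f(3)[of d] d eq arcin_inj[OF q, of d 0] by auto
  have cI: "is_interval (f ` {0..d})"
    using connected_continuous_image[OF f(1)] is_interval_connected_1 by auto
  have mem: "t \<in> f ` {0..d}" "f d \<in> f ` {0..d}" using f0 d by auto
  have fab: "a < f d" "f d < b"
  proof -
    obtain s where "q d = p s" "a < s" "s < b" using sub d by (force simp: image_subset_iff)
    moreover have "f d \<in> {a..b}" using f2[of d] d by auto
    ultimately show "a < f d" "f d < b"
      using f(3)[of d] arcin_inj[OF p, of "f d" s] d by auto
  qed
  have img: "p ` f ` {0..d} \<subseteq> q ` {0..1}" using f(3) d by (auto simp: image_subset_iff)
  show thesis
  proof (cases "f d > t")
    case True
    have "{t..f d} \<subseteq> f ` {0..d}"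
      using cI mem unfolding is_interval_1 by auto
    \<comment> \<open>The second argument of the minimum only provides the room on the opposite side
      of \<open>t\<close>.\<close>
    moreover have "{t..t + min (f d - t) (t - a)} \<subseteq> {t..f d}" by auto
    ultimately have s: "{t..t + min (f d - t) (t - a)} \<subseteq> f ` {0..d}" by (rule order_trans[rotated])
    show thesis
    proof (rule that(1)[of "min (f d - t) (t - a)"])
      show "p ` {t..t + min (f d - t) (t - a)} \<subseteq> q ` {0..1}" using s img by blast
    qed (use True fab t in \<open>auto simp: min_def\<close>)
  next
    case False
    have "{f d..t} \<subseteq> f ` {0..d}"
      using cI mem unfolding is_interval_1 by auto
    moreover have "{t - min (t - f d) (b - t)..t} \<subseteq> {f d..t}" by auto
    ultimately have s: "{t - min (t - f d) (b - t)..t} \<subseteq> f ` {0..d}" by (rule order_trans[rotated])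
    show thesis
    proof (rule that(2)[of "min (t - f d) (b - t)"])
      show "p ` {t - min (t - f d) (b - t)..t} \<subseteq> q ` {0..1}" using s img by blast
    qed (use False fd fab t in \<open>auto simp: min_def\<close>)
  qed
qed

text \<open>In a chart the arc is the straight line between the coordinates of \<open>x\<close> and
  \<open>y\<close>. It stays in \<open>B\<close> because the image of \<open>B\<close> is an
  interval, or because \<open>B\<close> is the whole space.\<close>

lemma arc_between:
  assumes B: "connectedin X B" and xy: "x \<in> B" "y \<in> B" "x \<noteq> y"
  obtains p where "arcin X B 0 1 p" "p 0 = x" "p 1 = y"
proof -
  have BX: "B \<subseteq> topspace X" using B connectedin_subset_topspace by blast
  \<comment> \<open>The point omitted by the chart must differ from \<open>x\<close> and
    \<open>y\<close>. A point outside \<open>B\<close> serves; if \<open>B\<close> is everything,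
    any third point does.\<close>
  have "\<exists>w\<in>topspace X. w \<noteq> x \<and> w \<noteq> y \<and> (B = topspace X \<or> w \<notin> B)"
  proof (cases "B = topspace X")
    case True
    have "\<not> topspace X \<subseteq> {x, y}" using infin finite_subset by blast
    then show ?thesis using True by blast
  next
    case False
    then obtain w where "w \<in> topspace X" "w \<notin> B" using BX by blast
    then show ?thesis using xy by metis
  qed
  then obtain w where w: "w \<in> topspace X" "w \<noteq> x" "w \<noteq> y" "B = topspace X \<or> w \<notin> B" by blast
  obtain T D and f :: "'a \<Rightarrow> real" and v where h: "openin X T" "topspace X - {w} \<subseteq> T" "T \<subseteq> topspace X" "is_interval D"
    "continuous_map (subtopology X T) euclideanreal f" "f ` T = D"
    "continuous_map (top_of_set D) X v" "v ` D = T"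
    "\<And>x. x \<in> T \<Longrightarrow> v (f x) = x" "\<And>t. t \<in> D \<Longrightarrow> f (v t) = t"
    using chartE[OF w(1)] by blast
  have xyT: "x \<in> T" "y \<in> T" using w h(2) BX xy by blast+
  obtain E where E: "is_interval E" "f x \<in> E" "f y \<in> E" "E \<subseteq> D" "v ` E \<subseteq> B"
  proof (cases "B = topspace X")
    case True
    then show thesis using that[of D] h xyT by blast
  next
    case False
    then have BT: "B \<subseteq> T" using w(4) h(2) BX by blast
    then have "connectedin (subtopology X T) B" using B by (simp add: connectedin_subtopology)
    then have "connectedin euclideanreal (f ` B)" using connectedin_continuous_map_image h(5) by blast
    then have "is_interval (f ` B)" by (simp add: is_interval_connected_1)
    moreover have "v ` f ` B \<subseteq> B" using BT h(9) by (auto simp: subset_iff)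
    ultimately show thesis using that[of "f ` B"] xy BT h(6) by blast
  qed
  define l where "l = (\<lambda>u. (1 - u) *\<^sub>R f x + u *\<^sub>R f y)"
  have lE: "l u \<in> E" if "u \<in> {0..1}" for u
    using E(1-3) that unfolding l_def is_interval_convex_1
    by (intro convexD) auto
  have fxy: "f x \<noteq> f y" using h(9)[OF xyT(1)] h(9)[OF xyT(2)] xy(3) by metis
  have "continuous_map (top_of_set {0..1}) (top_of_set D) l"
    using lE E(4) unfolding l_def by (auto intro!: continuous_intros)
  then have "continuous_map (top_of_set {0..1}) X (v \<circ> l)"
    using h(7) continuous_map_compose by blast
  moreover have "inj_on (v \<circ> l) {0..1}"
  proof (rule inj_onI)
    fix s u assume su: "s \<in> {0..1::real}" "u \<in> {0..1::real}" "(v \<circ> l) s = (v \<circ> l) u"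
    have "l s = f (v (l s))" "l u = f (v (l u))" using lE su E(4) h(10) by (metis subset_iff)+
    then have "l s = l u" using su(3) by simp
    then have "(s - u) * (f y - f x) = 0" unfolding l_def by (simp add: algebra_simps)
    then show "s = u" using fxy by simp
  qed
  moreover have "(v \<circ> l) ` {0..1} \<subseteq> B" using lE E(5) by (auto simp: image_subset_iff)
  ultimately have "arcin X B 0 1 (v \<circ> l)" by (simp add: arcin_def)
  moreover have "(v \<circ> l) 0 = x" "(v \<circ> l) 1 = y" using h(9) xyT by (auto simp: l_def)
  ultimately show thesis using that by blast
qed

text \<open>A chart that omits a point outside \<open>B\<close> turns \<open>B\<close> into a
  compact interval. Properness excludes the full circle, which is not an arc.\<close>

lemma compact_arc:
  assumes B: "connectedin X B" "compactin X B" "B \<noteq> topspace X" and xy: "x \<in> B" "y \<in> B" "x \<noteq> y"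
  obtains p a b where "arcin X B a b p" "p ` {a..b} = B"
proof -
  have BX: "B \<subseteq> topspace X" using B connectedin_subset_topspace by blast
  then obtain w where w: "w \<in> topspace X" "w \<notin> B" using B(3) by blast
  obtain T D and f :: "'a \<Rightarrow> real" and v where h: "openin X T" "topspace X - {w} \<subseteq> T" "T \<subseteq> topspace X" "is_interval D"
    "continuous_map (subtopology X T) euclideanreal f" "f ` T = D"
    "continuous_map (top_of_set D) X v" "v ` D = T"
    "\<And>x. x \<in> T \<Longrightarrow> v (f x) = x" "\<And>t. t \<in> D \<Longrightarrow> f (v t) = t"
    using chartE[OF w(1)] by blast
  have BT: "B \<subseteq> T" using w h(2) BX by blast
  have "connectedin (subtopology X T) B" "compactin (subtopology X T) B"
    using B BT by (simp_all add: connectedin_subtopology compactin_subtopology)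
  then have "connectedin euclideanreal (f ` B)" "compactin euclideanreal (f ` B)"
    using connectedin_continuous_map_image image_compactin h(5) by blast+
  then have "connected (f ` B)" "compact (f ` B)" by simp_all
  then obtain a b where ab: "f ` B = {a..b}" using connected_compact_interval_1 by metis
  have vfB: "v ` f ` B = B" using BT h(9) by (force simp: subset_iff image_iff)
  have "f x \<noteq> f y" using h(9) BT xy by (metis subset_iff)
  moreover have "f x \<in> {a..b}" "f y \<in> {a..b}" using ab xy by blast+
  ultimately have "a < b" by auto
  have abD: "{a..b} \<subseteq> D" using ab BT h(6) by blast
  have "continuous_map (top_of_set {a..b}) X v"
    using continuous_map_from_subtopology_mono[OF h(7) abD] .
  moreover have "inj_on v {a..b}" using abD h(10) by (meson inj_on_inverseI subset_iff)
  ultimately have "arcin X B a b v"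
    using \<open>a < b\<close> vfB ab by (simp add: arcin_def)
  then show thesis using that vfB ab by simp
qed

text \<open>Run inside \<open>B\<close> from a point off the arc towards \<open>p a\<close> and stop
  when the arc is first met. The meeting point is an end, because the open part of the arc is open
  in the space. The path reversed is \<open>q\<close>.\<close>

lemma outward:
  assumes p: "arcin X C a b p" and B: "connectedin X B" and sub: "p ` {a..b} \<subset> B"
  obtains q where "arcin X B 0 1 q" "q 0 \<in> {p a, p b}" "\<And>u. 0 < u \<Longrightarrow> u \<le> 1 \<Longrightarrow> q u \<notin> p ` {a..b}"
proof -
  have ab: "a < b" using p by (simp add: arcin_def)
  obtain x where x: "x \<in> B" "x \<notin> p ` {a..b}" using sub by blast
  have "p a \<in> p ` {a..b}" using ab by simp
  then have "p a \<in> B" "p a \<noteq> x" using sub x by blast+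
  then obtain r where r: "arcin X B 0 1 r" "r 0 = x" "r 1 = p a" using arc_between[OF B x(1)] by blast
  have rc: "continuous_map (top_of_set {0..1}) X r" using r by (simp add: arcin_def)
  have "closedin X (p ` {a..b})"
    using compactin_imp_closedin[OF haus arcin_compactin[OF p]] .
  then have cl: "closedin (top_of_set {0..1}) {t \<in> topspace (top_of_set {0..1}). r t \<in> p ` {a..b}}"
    using closedin_continuous_map_preimage[OF rc] by blast
  define Z where "Z = {t \<in> {0..1}. r t \<in> p ` {a..b}}"
  have Zeq: "{t \<in> topspace (top_of_set {0..1}). r t \<in> p ` {a..b}} = Z" by (auto simp: Z_def)
  have "closedin (top_of_set {0..1}) Z" using cl unfolding Zeq .
  then have cZ: "compact Z" using closedin_compact compact_Icc by blast
  have "1 \<in> Z" using r(3) ab by (auto simp: Z_def)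
  then obtain s where s: "s \<in> Z" "\<And>t. t \<in> Z \<Longrightarrow> s \<le> t" using compact_attains_inf[OF cZ] by blast
  have s01: "0 < s" "s \<le> 1" using s(1) x(2) r(2) by (auto simp: Z_def less_le)
  obtain u where u: "u \<in> {a..b}" "r s = p u" using s(1) by (auto simp: Z_def)
  have "u = a \<or> u = b"
  proof (rule ccontr)
    assume "\<not> (u = a \<or> u = b)"
    then have "s \<in> {t \<in> topspace (top_of_set {0..1}). r t \<in> p ` {a<..<b}}" using u s01 by auto
    moreover have "openin (top_of_set {0..1}) {t \<in> topspace (top_of_set {0..1}). r t \<in> p ` {a<..<b}}"
      using openin_continuous_map_preimage[OF rc arc_open[OF p]] .
    ultimately obtain e where e: "e > 0" "\<And>t. t \<in> {0..1} \<Longrightarrow> dist t s < e \<Longrightarrow> r t \<in> p ` {a<..<b}"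
      unfolding openin_euclidean_subtopology_iff by blast
    \<comment> \<open>An earlier time within the neighbourhood, kept nonnegative by s / 2.\<close>
    define t where "t = max (s / 2) (s - e / 2)"
    have t: "0 \<le> t" "t < s" "t \<le> 1" "dist t s < e" using s01 e(1) by (auto simp: t_def dist_real_def)
    have "r t \<in> p ` {a<..<b}" using e(2)[of t] t by auto
    then have "t \<in> Z" using t unfolding Z_def by auto
    then show False using s(2) t by force
  qed
  then have "r s \<in> {p a, p b}" using u by auto
  moreover have "arcin X B 0 1 (\<lambda>t. r ((- s) * t + s))"
    using arcin_mono[OF arcin_affine[OF r(1), of "- s" 0 1 s]] s01 r(1) by (auto simp: arcin_def)
  moreover have "r ((- s) * t + s) \<notin> p ` {a..b}" if t: "0 < t" "t \<le> 1" for t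
  proof -
    have *: "0 \<le> (- s) * t + s" "(- s) * t + s < s" using s01 t by (auto simp: mult_left_le)
    then have "(- s) * t + s \<notin> Z" using s(2) by force
    then show ?thesis using * s01 by (auto simp: Z_def)
  qed
  ultimately show thesis using that[of "\<lambda>t. r ((- s) * t + s)"] by simp
qed

end

section \<open>Intervals and circles as one-dimensional spaces\<close>

lemma curve_interval:
  fixes X :: "'a topology"
  assumes D: "nondegenerate_interval D" and hom: "homeomorphic_map (top_of_set D) X \<upsilon>"
  shows "curve X"
proof
  have hs: "top_of_set D homeomorphic_space X"
    using hom homeomorphic_map_imp_homeomorphic_space by blast
  show "Hausdorff_space X"
    using homeomorphic_Hausdorff_space[OF hs] by (simp add: Hausdorff_space_subtopology)
  obtain a b where "a \<in> D" "b \<in> D" "a < b" using D by (auto simp: nondegenerate_interval_def)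
  then have "{a..b} \<subseteq> D"
    using D unfolding nondegenerate_interval_def is_interval_1 by (meson atLeastAtMost_iff subsetI)
  then have "infinite D" using \<open>a < b\<close> infinite_Icc infinite_super by blast
  moreover have "bij_betw \<upsilon> D (topspace X)"
    using homeomorphic_imp_injective_map[OF hom] homeomorphic_imp_surjective_map[OF hom]
    by (simp add: bij_betw_def)
  ultimately show "infinite (topspace X)" using bij_betw_finite by blast
  obtain f where f: "homeomorphic_maps (top_of_set D) X \<upsilon> f" using hom homeomorphic_map_maps by blast
  fix w assume "w \<in> topspace X"
  have "openin X (topspace X) \<and> topspace X - {w} \<subseteq> topspace X \<and> is_interval D \<and>
      homeomorphic_maps (subtopology X (topspace X)) (top_of_set D) f \<upsilon>"
    using f D homeomorphic_maps_sym by (auto simp: nondegenerate_interval_def)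
  then show "\<exists>T D (f :: 'a \<Rightarrow> real) v. openin X T \<and> topspace X - {w} \<subseteq> T \<and> is_interval D \<and>
      homeomorphic_maps (subtopology X T) (top_of_set D) f v"
    by (intro exI[of _ "topspace X"] exI[of _ D] exI[of _ f] exI[of _ \<upsilon>])
qed

text \<open>The factor - 1 / c moves \<open>c\<close> to -1, onto the branch cut of
  \<open>Arg\<close>; the rest of the circle is parametrized by angles strictly between - pi and
  pi.\<close>

lemma homeomorphic_maps_circle_minus:
  fixes c :: complex
  assumes c: "cmod c = 1"
  shows "homeomorphic_maps (top_of_set (unit_circle - {c})) (top_of_set {-pi<..<pi})
           (\<lambda>z. Arg (- z / c)) (\<lambda>t. - c * cis t)"
  unfolding homeomorphic_maps_def
proof (intro conjI ballI)
  have c0: "c \<noteq> 0" using c by auto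
  have nn: "- z / c \<notin> \<real>\<^sub>\<le>\<^sub>0" if "z \<in> unit_circle - {c}" for z
  proof
    assume h: "- z / c \<in> \<real>\<^sub>\<le>\<^sub>0"
    have "cmod (- z / c) = 1" using that c by (simp add: norm_divide)
    moreover obtain r where r: "- z / c = of_real r" "r \<le> 0" using h by (metis nonpos_Reals_cases)
    ultimately have "\<bar>r\<bar> = 1" by (metis norm_of_real)
    with r(2) have "r = -1" by linarith
    then have "- z / c = - 1" using r by simp
    then have "z = c" using c0 by (simp add: field_simps)
    then show False using that by simp
  qed
  have "continuous_on (unit_circle - {c}) (\<lambda>z. Arg (- z / c))"
    using nn c0 by (intro continuous_on_Arg' continuous_intros) auto
  moreover have "Arg (- z / c) \<in> {-pi<..<pi}" if "z \<in> unit_circle - {c}" for z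
  proof -
    have "Arg (- z / c) \<noteq> pi"
      using nn[OF that] Arg_eq_pi by (metis complex_is_Real_iff less_eq_real_def nonpos_Reals_of_real_iff of_real_Re)
    then show ?thesis using mpi_less_Arg[of "- z / c"] Arg_le_pi[of "- z / c"] by auto
  qed
  ultimately show "continuous_map (top_of_set (unit_circle - {c})) (top_of_set {-pi<..<pi}) (\<lambda>z. Arg (- z / c))"
    by auto
  have "- c * cis t \<noteq> c" if "t \<in> {-pi<..<pi}" for t
  proof
    assume "- c * cis t = c"
    then have "c * (cis t + 1) = 0" by (simp add: distrib_left eq_neg_iff_add_eq_0 [symmetric] minus_equation_iff)
    then have "cis t + 1 = 0" using c0 by simp
    then have "cis t = - 1" using eq_neg_iff_add_eq_0 by blast
    then have "cis t = cis pi" by simp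
    then show False using Arg_cis[of t] Arg_cis[of pi] that pi_gt_zero by simp
  qed
  then show "continuous_map (top_of_set {-pi<..<pi}) (top_of_set (unit_circle - {c})) (\<lambda>t. - c * cis t)"
    using c by (auto intro!: continuous_intros simp: norm_mult)
  fix z assume "z \<in> topspace (top_of_set (unit_circle - {c}))"
  then have z: "cmod z = 1" by simp
  then have "cmod (- z / c) = 1" using c by (simp add: norm_divide)
  then have "cis (Arg (- z / c)) = - z / c"
    using cis_Arg[of "- z / c"] c0 by (cases "z = 0") (auto simp: sgn_div_norm)
  then show "- c * cis (Arg (- z / c)) = z" using c0 by simp
next
  have c0: "c \<noteq> 0" using c by auto
  fix t assume "t \<in> topspace (top_of_set {-pi<..<pi})"
  then show "Arg (- (- c * cis t) / c) = t" using c0 Arg_cis[of t] by simp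
qed

lemma curve_circle:
  fixes X :: "'a topology"
  assumes hom: "homeomorphic_map (top_of_set unit_circle) X \<upsilon>"
  shows "curve X"
proof
  have hs: "top_of_set unit_circle homeomorphic_space X"
    using hom homeomorphic_map_imp_homeomorphic_space by blast
  show "Hausdorff_space X"
    using homeomorphic_Hausdorff_space[OF hs] by (simp add: Hausdorff_space_subtopology)
  have inj: "inj_on \<upsilon> unit_circle" and sur: "\<upsilon> ` unit_circle = topspace X"
    using homeomorphic_imp_injective_map[OF hom] homeomorphic_imp_surjective_map[OF hom] by auto
  have "cis ` {0..1} \<subseteq> unit_circle" by auto
  moreover have "inj_on cis {0..1}"
    by (rule inj_on_inverseI[where g = Arg]) (use pi_gt3 in \<open>auto intro!: Arg_cis\<close>)
  ultimately have "infinite unit_circle"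
    using infinite_Icc[of 0 "1::real"] by (metis finite_imageD finite_subset zero_less_one)
  then show "infinite (topspace X)" using inj sur finite_imageD by metis
  obtain f where f: "homeomorphic_maps (top_of_set unit_circle) X \<upsilon> f" using hom homeomorphic_map_maps by blast
  fix w assume "w \<in> topspace X"
  then obtain c where c: "cmod c = 1" "\<upsilon> c = w" using sur by (metis dist_0_norm imageE mem_sphere)
  have T: "openin X (topspace X - {w})"
    using \<open>Hausdorff_space X\<close> \<open>w \<in> topspace X\<close> by (simp add: openin_diff closedin_Hausdorff_singleton)
  have "\<upsilon> ` (unit_circle - {c}) = topspace X - {w}"
    using inj sur c inj_on_image_set_diff[OF inj, of unit_circle "{c}"] by auto
  then have "homeomorphic_maps (top_of_set (unit_circle - {c})) (subtopology X (topspace X - {w})) \<upsilon> f"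
    using homeomorphic_maps_subtopologies[OF f, of "unit_circle - {c}" "topspace X - {w}"]
    by (simp add: subtopology_subtopology Int_absorb1)
  then have "homeomorphic_maps (subtopology X (topspace X - {w})) (top_of_set {-pi<..<pi})
      ((\<lambda>z. Arg (- z / c)) \<circ> f) (\<upsilon> \<circ> (\<lambda>t. - c * cis t))"
    using homeomorphic_maps_circle_minus[OF c(1)] homeomorphic_maps_compose homeomorphic_maps_sym by blast
  then show "\<exists>T D (f :: 'a \<Rightarrow> real) v. openin X T \<and> topspace X - {w} \<subseteq> T \<and> is_interval D \<and>
      homeomorphic_maps (subtopology X T) (top_of_set D) f v"
    using T is_interval_oo[of "- pi" pi]
    by (intro exI[of _ "topspace X - {w}"] exI[of _ "{-pi<..<pi}"] exI conjI subset_refl)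
qed

section \<open>Segment interiors\<close>

definition line_like :: "'s amfd \<Rightarrow> bool" where
  "line_like S \<longleftrightarrow> circle_like S \<or> interval_like S"

lemma line_like_curve: "line_like S \<Longrightarrow> curve (mtop S)"
  unfolding line_like_def circle_like_def interval_like_def homeomorphic_space
  using curve_circle curve_interval by blast

text \<open>Together with the converse \<open>two_sided_seg_int\<close> this replaces the collection
  of all homeomorphisms in \<open>seg_int\<close>: interior points are those through which an arc of
  the segment passes.\<close>

lemma seg_int_two_sided:
  assumes "z \<in> seg_int S A"
  obtains r where "arcin (mtop S) A (-1) 1 r" "r 0 = z"
proof -
  consider \<upsilon> where "homeomorphic_map (top_of_set unit_circle) (mtop S) \<upsilon>"
      "z \<in> \<upsilon> ` (top_of_set unit_circle interior_of {w \<in> unit_circle. \<upsilon> w \<in> A})"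
    | D \<upsilon> where "nondegenerate_interval D" "homeomorphic_map (top_of_set D) (mtop S) \<upsilon>"
      "z \<in> \<upsilon> ` interior {t \<in> D. \<upsilon> t \<in> A}"
    using assms unfolding seg_int_def by blast
  then show thesis
  proof cases
    case 1
    obtain w where w: "\<upsilon> w = z" "w \<in> top_of_set unit_circle interior_of {w \<in> unit_circle. \<upsilon> w \<in> A}"
      using 1(2) by blast
    obtain U where U: "openin (top_of_set unit_circle) U" "U \<subseteq> {w \<in> unit_circle. \<upsilon> w \<in> A}" "w \<in> U"
      using w(2) unfolding interior_of_def by blast
    have w1: "cmod w = 1" using U by auto
    then have w0: "w \<noteq> 0" by auto
    have con: "continuous_map (top_of_set (UNIV::real set)) (top_of_set unit_circle) (\<lambda>t. w * cis t)"
      using w1 by (auto intro!: continuous_intros simp: norm_mult continuous_map_in_subtopology)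
    have "openin (top_of_set UNIV) {t \<in> topspace (top_of_set (UNIV::real set)). w * cis t \<in> U}"
      using openin_continuous_map_preimage[OF con U(1)] .
    then have "open {t. w * cis t \<in> U}" by simp
    moreover have "0 \<in> {t. w * cis t \<in> U}" using U(3) by simp
    ultimately obtain e where e: "e > 0" "ball 0 e \<subseteq> {t. w * cis t \<in> U}" using open_contains_ball by blast
    \<comment> \<open>With \<open>d\<close> at most 1 the angles stay below pi, so that
      \<open>Arg\<close> recovers them and the path is injective.\<close>
    define d where "d = min (e / 2) 1"
    have d: "d > 0" "d < e" "d \<le> 1" using e(1) by (auto simp: d_def)
    have dt: "\<bar>d * t\<bar> < e \<and> \<bar>d * t\<bar> < pi" if "t \<in> {-1..1}" for t
    proof -
      have "\<bar>d * t\<bar> \<le> d * 1" using that d unfolding abs_mult by (intro mult_mono) auto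
      then show ?thesis using d pi_gt3 by linarith
    qed
    have dU: "w * cis (d * t) \<in> U" if "t \<in> {-1..1}" for t
      using e(2) dt[OF that] by (auto simp: subset_iff)
    have "continuous_map (top_of_set {-1..1}) (top_of_set unit_circle) (\<lambda>t. w * cis (d * t))"
      using w1 by (auto intro!: continuous_intros simp: norm_mult)
    then have "continuous_map (top_of_set {-1..1}) (mtop S) (\<upsilon> \<circ> (\<lambda>t. w * cis (d * t)))"
      using homeomorphic_imp_continuous_map[OF 1(1)] continuous_map_compose by blast
    moreover have "inj_on (\<upsilon> \<circ> (\<lambda>t. w * cis (d * t))) {-1..1}"
    proof (rule comp_inj_on)
      show "inj_on (\<lambda>t. w * cis (d * t)) {-1..1}"
      proof (rule inj_on_inverseI[where g = "\<lambda>z. Arg (z / w) / d"])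
        fix t :: real assume "t \<in> {-1..1}"
        then show "Arg (w * cis (d * t) / w) / d = t"
          using w0 d(1) dt[of t] Arg_cis[of "d * t"] by (simp add: abs_less_iff)
      qed
      have "inj_on \<upsilon> unit_circle" using homeomorphic_imp_injective_map[OF 1(1)] by simp
      then show "inj_on \<upsilon> ((\<lambda>t. w * cis (d * t)) ` {-1..1})"
        by (rule inj_on_subset) (use w1 in \<open>auto simp: norm_mult\<close>)
    qed
    moreover have "(\<upsilon> \<circ> (\<lambda>t. w * cis (d * t))) ` {-1..1} \<subseteq> A"
      using dU U(2) by (auto simp: subset_iff)
    ultimately show thesis using that[of "\<upsilon> \<circ> (\<lambda>t. w * cis (d * t))"] w(1) by (simp add: arcin_def)
  next
    case 2
    obtain s where s: "\<upsilon> s = z" "s \<in> interior {t \<in> D. \<upsilon> t \<in> A}" using 2(3) by blast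
    then obtain e where e: "e > 0" "cball s e \<subseteq> {t \<in> D. \<upsilon> t \<in> A}"
      by (meson mem_interior_cball)
    have eD: "s + e * t \<in> D \<and> \<upsilon> (s + e * t) \<in> A" if "t \<in> {-1..1}" for t
    proof -
      have "\<bar>e * t\<bar> \<le> e * 1" using that e(1) unfolding abs_mult by (intro mult_mono) auto
      then have "s + e * t \<in> cball s e" by (simp add: dist_real_def)
      then show ?thesis using e(2) by blast
    qed
    have "continuous_map (top_of_set {-1..1}) (top_of_set D) (\<lambda>t. s + e * t)"
      using eD by (auto intro!: continuous_intros)
    then have "continuous_map (top_of_set {-1..1}) (mtop S) (\<upsilon> \<circ> (\<lambda>t. s + e * t))"
      using homeomorphic_imp_continuous_map[OF 2(2)] continuous_map_compose by blast
    moreover have "inj_on (\<upsilon> \<circ> (\<lambda>t. s + e * t)) {-1..1}"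
    proof (rule comp_inj_on)
      show "inj_on (\<lambda>t. s + e * t) {-1..1}" using e(1) by (auto simp: inj_on_def)
      have "inj_on \<upsilon> D" using homeomorphic_imp_injective_map[OF 2(2)] by simp
      then show "inj_on \<upsilon> ((\<lambda>t. s + e * t) ` {-1..1})"
        by (rule inj_on_subset) (use eD in auto)
    qed
    moreover have "(\<upsilon> \<circ> (\<lambda>t. s + e * t)) ` {-1..1} \<subseteq> A" using eD by auto
    ultimately show thesis using that[of "\<upsilon> \<circ> (\<lambda>t. s + e * t)"] s(1) by (simp add: arcin_def)
  qed
qed

text \<open>The open part of an arc is open in S, so its preimage in the circle is open. Over an
  interval D it corresponds to a set open in the real line, as \<open>seg_int\<close> demands,
  because it is the image of an open interval under an injective continuous real function.\<close>

lemma two_sided_seg_int: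
  assumes S: "line_like S" and r: "arcin (mtop S) A a b r" and t: "a < t" "t < b"
  shows "r t \<in> seg_int S A"
proof -
  interpret curve "mtop S" using line_like_curve[OF S] .
  have op: "openin (mtop S) (r ` {a<..<b})" using arc_open[OF r] .
  have sub: "r ` {a<..<b} \<subseteq> A"
    using r image_mono[of "{a<..<b}" "{a..b}" r] unfolding arcin_def by fastforce
  have rt: "r t \<in> r ` {a<..<b}" "r t \<in> points S" using t arcin_topspace[OF r] by auto
  consider \<upsilon> where "homeomorphic_map (top_of_set unit_circle) (mtop S) \<upsilon>"
    | D \<upsilon> where "nondegenerate_interval D" "homeomorphic_map (top_of_set D) (mtop S) \<upsilon>"
    using S unfolding line_like_def circle_like_def interval_like_def homeomorphic_space by blast
  then show ?thesis
  proof cases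
    case 1
    obtain w where w: "w \<in> unit_circle" "\<upsilon> w = r t"
      using homeomorphic_imp_surjective_map[OF 1] rt(2) by (metis imageE topspace_euclidean_subtopology)
    have "openin (top_of_set unit_circle) {w \<in> topspace (top_of_set unit_circle). \<upsilon> w \<in> r ` {a<..<b}}"
      using openin_continuous_map_preimage[OF homeomorphic_imp_continuous_map[OF 1] op] .
    moreover have "{w \<in> topspace (top_of_set unit_circle). \<upsilon> w \<in> r ` {a<..<b}} \<subseteq> {w \<in> unit_circle. \<upsilon> w \<in> A}"
      using sub by auto
    moreover have "w \<in> {w \<in> topspace (top_of_set unit_circle). \<upsilon> w \<in> r ` {a<..<b}}"
      using w rt(1) by simp
    ultimately have "w \<in> top_of_set unit_circle interior_of {w \<in> unit_circle. \<upsilon> w \<in> A}"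
      unfolding interior_of_def by blast
    then have "\<upsilon> w \<in> \<upsilon> ` (top_of_set unit_circle interior_of {w \<in> unit_circle. \<upsilon> w \<in> A})"
      by (rule imageI)
    then show ?thesis using 1 w(2) unfolding seg_int_def by auto
  next
    case 2
    obtain f where f: "homeomorphic_maps (top_of_set D) (mtop S) \<upsilon> f" using 2(2) homeomorphic_map_maps by blast
    have fc: "continuous_map (mtop S) (top_of_set D) f" and vf: "\<And>x. x \<in> points S \<Longrightarrow> \<upsilon> (f x) = x"
      and fv: "\<And>t. t \<in> D \<Longrightarrow> f (\<upsilon> t) = t"
      using f by (auto simp: homeomorphic_maps_def)
    have "continuous_map (top_of_set {a..b}) (top_of_set D) (f \<circ> r)"
      using fc r continuous_map_compose unfolding arcin_def by blast
    then have co: "continuous_on {a..b} (f \<circ> r)" and fr: "(f \<circ> r) ` {a..b} \<subseteq> D" by auto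
    have rp: "r u \<in> points S" if "u \<in> {a..b}" for u using arcin_topspace[OF r] that by blast
    have "inj_on (f \<circ> r) {a..b}"
      by (rule inj_on_inverseI[where g = "\<lambda>x. inv_into {a..b} r (\<upsilon> x)"])
        (use vf rp r in \<open>simp add: arcin_def\<close>)
    then have "open ((f \<circ> r) ` {a<..<b})"
      using injective_eq_1d_open_map_UNIV[OF co is_interval_cc] open_greaterThanLessThan[of a b]
        greaterThanLessThan_subseteq_atLeastAtMost_iff[of a b a b] by simp
    moreover have "(f \<circ> r) ` {a<..<b} \<subseteq> {t \<in> D. \<upsilon> t \<in> A}"
    proof
      fix x assume "x \<in> (f \<circ> r) ` {a<..<b}"
      then obtain u where u: "u \<in> {a<..<b}" "x = f (r u)" by auto
      then have "x \<in> D" "\<upsilon> x = r u" using fr rp[of u] vf by (auto simp: image_subset_iff)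
      then show "x \<in> {t \<in> D. \<upsilon> t \<in> A}" using sub u(1) by auto
    qed
    moreover have "f (r t) \<in> (f \<circ> r) ` {a<..<b}" using t by auto
    ultimately have "f (r t) \<in> interior {t \<in> D. \<upsilon> t \<in> A}" by (meson interiorI)
    then have "\<upsilon> (f (r t)) \<in> \<upsilon> ` interior {t \<in> D. \<upsilon> t \<in> A}" by (rule imageI)
    then have "r t \<in> \<upsilon> ` interior {t \<in> D. \<upsilon> t \<in> A}" unfolding vf[OF rt(2)] .
    then show ?thesis
      using 2 unfolding seg_int_def by (intro UnI2 CollectI exI[of _ D] exI[of _ \<upsilon>] conjI)
  qed
qed

lemma seg_int_subset: "seg_int S A \<subseteq> A"
proof
  fix z assume "z \<in> seg_int S A"
  then obtain r where "arcin (mtop S) A (-1) 1 r" "r 0 = z" by (rule seg_int_two_sided)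
  then show "z \<in> A" by (force simp: arcin_def image_subset_iff)
qed

text \<open>An end of an arc is not interior: a two-sided arc through it would pull back to an open
  set of parameters inside [a, b] that contains an end point.\<close>

lemma seg_bd_arc:
  assumes S: "line_like S" and p: "arcin (mtop S) C a b p"
  shows "seg_bd S (p ` {a..b}) = {p a, p b}"
proof -
  interpret curve "mtop S" using line_like_curve[OF S] .
  have ab: "a < b" using p by (simp add: arcin_def)
  have "p t \<notin> seg_bd S (p ` {a..b})" if "a < t" "t < b" for t
    using two_sided_seg_int[OF S arcin_image[OF p] that] by (simp add: seg_bd_def)
  moreover have "p e \<notin> seg_int S (p ` {a..b})" if e: "e = a \<or> e = b" for e
  proof
    assume "p e \<in> seg_int S (p ` {a..b})"
    then obtain r where r: "arcin (mtop S) (p ` {a..b}) (-1) 1 r" "r 0 = p e" by (rule seg_int_two_sided)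
    obtain f where f: "continuous_on {-1..1} f" "f ` {-1..1} \<subseteq> {a..b}" "\<And>t. t \<in> {-1..1} \<Longrightarrow> p (f t) = r t"
      using arcin_pull[OF haus p, of "{-1..1}" r] r unfolding arcin_def by blast
    have fe: "f 0 = e" using arcin_inj[OF p, of "f 0" e] f(2) f(3)[of 0] r(2) e ab by (auto simp: image_subset_iff)
    have "inj_on f {-1..1}"
    proof (rule inj_onI)
      fix t u assume "t \<in> {-1..1}" "u \<in> {-1..1}" "f t = f u"
      then show "t = u" using f(3)[of t] f(3)[of u] arcin_inj[OF r(1), of t u] by simp
    qed
    then have "open (f ` {-1<..<1})"
      using injective_eq_1d_open_map_UNIV[OF f(1) is_interval_cc] open_greaterThanLessThan[of "-1::real" 1]
        greaterThanLessThan_subseteq_atLeastAtMost_iff[of "-1::real" 1 "-1" 1] by simp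
    moreover have "f ` {-1<..<1} \<subseteq> {a..b}" using f(2) by (auto simp: image_subset_iff)
    ultimately have "f ` {-1<..<1} \<subseteq> {a<..<b}"
      using interior_maximal[of "f ` {-1<..<1}" "{a..b}"] by simp
    moreover have "e \<in> f ` {-1<..<1}" using fe by force
    ultimately show False using e by auto
  qed
  ultimately show ?thesis using ab unfolding seg_bd_def
    by (fastforce simp: less_le)
qed

section \<open>Local holomorphic extension\<close>

text \<open>
  The power series converges absolutely at a point \<open>y\<close> all of whose coordinates differ from those of \<open>x\<close>,
  hence on the complex polydisc with radii \<open>\<bar>y\<^sub>i - x\<^sub>i\<bar>\<close>, into which the \<open>\<psi>\<^sub>i\<close> can be substituted.
\<close>

lemma real_analytic_comp_holomorphic:
  fixes \<psi> :: "nat \<Rightarrow> complex \<Rightarrow> complex"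
  assumes an: "real_analytic_on m D F" and x: "x \<in> D"
    and acc: "\<And>e. e > 0 \<Longrightarrow> \<exists>y\<in>D. \<forall>i<m. 0 < \<bar>y i - x i\<bar> \<and> \<bar>y i - x i\<bar> < e"
    and hol: "\<And>i. i < m \<Longrightarrow> \<psi> i holomorphic_on ball \<zeta> R" and R: "R > 0"
    and val: "\<And>i. i < m \<Longrightarrow> \<psi> i \<zeta> = of_real (x i)"
  obtains r \<Phi> where "0 < r" "r \<le> R" "\<Phi> holomorphic_on ball \<zeta> r"
    "\<And>z y. z \<in> ball \<zeta> r \<Longrightarrow> y \<in> D \<Longrightarrow> (\<And>i. i < m \<Longrightarrow> \<psi> i z = of_real (y i)) \<Longrightarrow> \<Phi> z = of_real (F y)"
proof -
  define I where "I = {\<alpha> :: nat \<Rightarrow> nat. \<forall>i\<ge>m. \<alpha> i = 0}"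
  obtain s c where s: "s > 0" and c: "\<And>y. y \<in> D \<Longrightarrow> (\<And>i. i < m \<Longrightarrow> \<bar>y i - x i\<bar> < s) \<Longrightarrow>
      ((\<lambda>\<alpha>. c \<alpha> * (\<Prod>i<m. (y i - x i) ^ \<alpha> i)) has_sum F y) I"
    using an x unfolding real_analytic_on_def I_def by blast
  obtain y1 where y1: "y1 \<in> D" "\<And>i. i < m \<Longrightarrow> 0 < \<bar>y1 i - x i\<bar> \<and> \<bar>y1 i - x i\<bar> < s"
    using acc[OF s] by blast
  define \<rho> where "\<rho> = (\<lambda>i. \<bar>y1 i - x i\<bar>)"
  have sm0: "(\<lambda>\<alpha>. c \<alpha> * (\<Prod>i<m. (y1 i - x i) ^ \<alpha> i)) summable_on I"
    using c[OF y1(1)] y1(2) has_sum_imp_summable by blast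
  \<comment> \<open>Unconditionally summable real families are absolutely summable, which yields the
    majorant for the M-test on the complex polydisc.\<close>
  have "(\<lambda>\<alpha>. norm (c \<alpha> * (\<Prod>i<m. (y1 i - x i) ^ \<alpha> i))) summable_on I"
    by (rule summable_on_iff_abs_summable_on_real[THEN iffD1, OF sm0])
  then have sm: "(\<lambda>\<alpha>. \<bar>c \<alpha>\<bar> * (\<Prod>i<m. \<rho> i ^ \<alpha> i)) summable_on I"
    by (simp add: abs_mult abs_prod power_abs \<rho>_def)
  have "\<forall>\<^sub>F z in nhds \<zeta>. \<forall>i\<in>{..<m}. cmod (\<psi> i z - of_real (x i)) < \<rho> i"
  proof (intro eventually_ball_finite ballI)
    fix i assume i: "i \<in> {..<m}"
    have "isCont (\<psi> i) \<zeta>"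
      using hol[of i] i R holomorphic_on_imp_continuous_on[of "\<psi> i" "ball \<zeta> R"]
      by (simp add: continuous_on_eq_continuous_at)
    then have "((\<lambda>z. cmod (\<psi> i z - of_real (x i))) \<longlongrightarrow> cmod (\<psi> i \<zeta> - of_real (x i))) (nhds \<zeta>)"
      by (intro tendsto_intros) (simp add: isCont_def tendsto_at_iff_tendsto_nhds)
    moreover have "cmod (\<psi> i \<zeta> - of_real (x i)) < \<rho> i" using val y1(2) i by (simp add: \<rho>_def)
    ultimately show "\<forall>\<^sub>F z in nhds \<zeta>. cmod (\<psi> i z - of_real (x i)) < \<rho> i"
      by (rule order_tendstoD)
  qed simp
  then obtain d where d: "d > 0" "\<And>z i. dist z \<zeta> < d \<Longrightarrow> i < m \<Longrightarrow> cmod (\<psi> i z - of_real (x i)) < \<rho> i"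
    unfolding eventually_nhds_metric by auto
  define r where "r = min (d / 2) (R / 2)"
  have r: "0 < r" "r < d" "r < R" using d(1) R by (auto simp: r_def)
  define f where "f = (\<lambda>\<alpha> z. of_real (c \<alpha>) * (\<Prod>i<m. (\<psi> i z - of_real (x i)) ^ \<alpha> i))"
  have small: "cmod (\<psi> i z - of_real (x i)) < \<rho> i" if "z \<in> cball \<zeta> r" "i < m" for z i
    using d(2)[of z i] that r by (simp add: dist_commute)
  have "norm (f \<alpha> z) \<le> \<bar>c \<alpha>\<bar> * (\<Prod>i<m. \<rho> i ^ \<alpha> i)" if "z \<in> cball \<zeta> r" for \<alpha> z
    unfolding f_def norm_mult norm_of_real prod_norm[symmetric] norm_power
    using small[OF that] by (intro mult_left_mono prod_mono conjI power_mono) (auto intro: less_imp_le)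
  then have ul: "uniform_limit (cball \<zeta> r) (\<lambda>A z. \<Sum>\<alpha>\<in>A. f \<alpha> z) (\<lambda>z. \<Sum>\<^sub>\<infinity>\<alpha>\<in>I. f \<alpha> z) (finite_subsets_at_top I)"
    using sm by (intro Weierstrass_m_test_general)
  have fh: "f \<alpha> holomorphic_on ball \<zeta> R" for \<alpha>
    unfolding f_def using hol by (intro holomorphic_intros) auto
  then have hs: "(\<lambda>z. \<Sum>\<alpha>\<in>A. f \<alpha> z) holomorphic_on ball \<zeta> R" for A
    by (intro holomorphic_intros)
  have cb: "cball \<zeta> r \<subseteq> ball \<zeta> R" and bb: "ball \<zeta> r \<subseteq> ball \<zeta> R" using r by auto
  have cont: "\<forall>\<^sub>F A in finite_subsets_at_top I. continuous_on (cball \<zeta> r) (\<lambda>z. \<Sum>\<alpha>\<in>A. f \<alpha> z) \<and>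
      (\<lambda>z. \<Sum>\<alpha>\<in>A. f \<alpha> z) holomorphic_on ball \<zeta> r"
    by (intro always_eventually allI conjI holomorphic_on_subset[OF hs bb]
        continuous_on_subset[OF holomorphic_on_imp_continuous_on[OF hs] cb])
  have "(\<lambda>z. \<Sum>\<^sub>\<infinity>\<alpha>\<in>I. f \<alpha> z) holomorphic_on ball \<zeta> r"
    by (rule holomorphic_uniform_limit[OF cont ul]) (simp_all add: finite_subsets_at_top_neq_bot)
  moreover have "(\<Sum>\<^sub>\<infinity>\<alpha>\<in>I. f \<alpha> z) = of_real (F y)"
    if z: "z \<in> ball \<zeta> r" and y: "y \<in> D" and eq: "\<And>i. i < m \<Longrightarrow> \<psi> i z = of_real (y i)" for z y
  proof -
    \<comment> \<open>That the real expansion is valid at \<open>y\<close> need not be assumed: the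
      values \<open>\<psi> i z\<close>, which are the coordinates of \<open>y\<close>, lie in the
      polydisc.\<close>
    have "\<bar>y i - x i\<bar> < s" if "i < m" for i
    proof -
      have "cmod (of_real (y i - x i)) < \<rho> i" using small[of z i] z eq[OF that] that by simp
      then show ?thesis using y1(2)[OF that] unfolding norm_of_real \<rho>_def by linarith
    qed
    then have "((\<lambda>\<alpha>. of_real (c \<alpha> * (\<Prod>i<m. (y i - x i) ^ \<alpha> i)) :: complex) has_sum of_real (F y)) I"
      using c[OF y] has_sum_of_real by blast
    moreover have "of_real (c \<alpha> * (\<Prod>i<m. (y i - x i) ^ \<alpha> i)) = f \<alpha> z" for \<alpha>
      unfolding f_def using eq by simp
    ultimately show ?thesis by (simp add: infsumI)
  qed
  ultimately show thesis using that[of r "\<lambda>z. \<Sum>\<^sub>\<infinity>\<alpha>\<in>I. f \<alpha> z"] r by simp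
qed

text \<open>There are finitely many coordinates, so the smallest radius serves all of them.\<close>

lemma real_analytic_comp_holomorphic_family:
  fixes \<psi> :: "nat \<Rightarrow> complex \<Rightarrow> complex" and n :: nat
  assumes an: "\<And>j. j < n \<Longrightarrow> real_analytic_on m D (F j)" and x: "x \<in> D"
    and acc: "\<And>e. e > 0 \<Longrightarrow> \<exists>y\<in>D. \<forall>i<m. 0 < \<bar>y i - x i\<bar> \<and> \<bar>y i - x i\<bar> < e"
    and hol: "\<And>i. i < m \<Longrightarrow> \<psi> i holomorphic_on ball \<zeta> R" and R: "R > 0"
    and val: "\<And>i. i < m \<Longrightarrow> \<psi> i \<zeta> = of_real (x i)"
  obtains r \<Phi> where "0 < r" "r \<le> R" "\<And>j. j < n \<Longrightarrow> \<Phi> j holomorphic_on ball \<zeta> r"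
    "\<And>j z y. j < n \<Longrightarrow> z \<in> ball \<zeta> r \<Longrightarrow> y \<in> D \<Longrightarrow> (\<And>i. i < m \<Longrightarrow> \<psi> i z = of_real (y i)) \<Longrightarrow>
       \<Phi> j z = of_real (F j y)"
proof -
  define P where "P = (\<lambda>j r \<Phi>. 0 < r \<and> \<Phi> holomorphic_on ball \<zeta> r \<and>
    (\<forall>z y. z \<in> ball \<zeta> r \<longrightarrow> y \<in> D \<longrightarrow> (\<forall>i<m. \<psi> i z = of_real (y i)) \<longrightarrow> \<Phi> z = of_real (F j y)))"
  have "\<exists>r \<Phi>. P j r \<Phi>" if "j < n" for j
    unfolding P_def
    by (rule real_analytic_comp_holomorphic[OF an[OF that] x acc hol R val]) blast+
  then obtain r \<Phi> where P: "\<And>j. j < n \<Longrightarrow> P j (r j) (\<Phi> j)" by metis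
  define r0 where "r0 = Min (insert R (r ` {..<n}))"
  have r0: "0 < r0" "r0 \<le> R" "\<And>j. j < n \<Longrightarrow> r0 \<le> r j"
    using P R unfolding r0_def P_def by auto
  have b: "ball \<zeta> r0 \<subseteq> ball \<zeta> (r j)" if "j < n" for j using r0(3)[OF that] by auto
  have "\<Phi> j holomorphic_on ball \<zeta> r0" if "j < n" for j
    using P[OF that] b[OF that] holomorphic_on_subset unfolding P_def by blast
  moreover have "\<Phi> j z = of_real (F j y)"
    if "j < n" "z \<in> ball \<zeta> r0" "y \<in> D" "\<And>i. i < m \<Longrightarrow> \<psi> i z = of_real (y i)" for j z y
    using P[OF that(1)] b[OF that(1)] that unfolding P_def by blast
  ultimately show thesis using that[OF r0(1,2)] by blast
qed

section \<open>Charts\<close>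

lemma modelled_chart:
  assumes "modelled_on H X" and "c \<in> matlas X"
  shows "openin (mtop X) (fst c)"
    and "openin (subtopology (Euclidean_space (mdim X)) H) (snd c ` fst c)"
    and "homeomorphic_map (subtopology (mtop X) (fst c)) (subtopology (Euclidean_space (mdim X)) (snd c ` fst c)) (snd c)"
    and "fst c \<subseteq> points X"
    and "inj_on (snd c) (fst c)"
    and "\<And>p i. p \<in> fst c \<Longrightarrow> i \<ge> mdim X \<Longrightarrow> snd c p i = 0"
    and "\<And>p. p \<in> fst c \<Longrightarrow> snd c p \<in> H"
proof -
  obtain U \<kappa> where c: "c = (U, \<kappa>)" by (cases c)
  then show 1: "openin (mtop X) (fst c)"
    and 2: "openin (subtopology (Euclidean_space (mdim X)) H) (snd c ` fst c)"
    and 3: "homeomorphic_map (subtopology (mtop X) (fst c)) (subtopology (Euclidean_space (mdim X)) (snd c ` fst c)) (snd c)"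
    using assms unfolding modelled_on_def by auto
  show 4: "fst c \<subseteq> points X" using 1 openin_subset by blast
  show "inj_on (snd c) (fst c)"
    using homeomorphic_imp_injective_map[OF 3] 4 by (simp add: Int_absorb1)
  have "snd c ` fst c \<subseteq> topspace (Euclidean_space (mdim X)) \<inter> H"
    using openin_subset[OF 2] by simp
  then show "\<And>p i. p \<in> fst c \<Longrightarrow> i \<ge> mdim X \<Longrightarrow> snd c p i = 0" "\<And>p. p \<in> fst c \<Longrightarrow> snd c p \<in> H"
    by (auto simp: topspace_Euclidean_space)
qed

lemma modelled_chart_exists:
  assumes "modelled_on H X" "x \<in> points X"
  obtains c where "c \<in> matlas X" "x \<in> fst c"
  using assms unfolding modelled_on_def by (metis (no_types, lifting) UN_E)

lemma openin_chart_dom: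
  assumes X: "modelled_on H X" "c \<in> matlas X" and U: "openin (mtop X) U" "U \<subseteq> fst c"
  shows "openin (subtopology (Euclidean_space (mdim X)) H) (snd c ` U)"
proof -
  note h = modelled_chart[OF X]
  have "openin (subtopology (mtop X) (fst c)) U" using U by (simp add: openin_open_subtopology h(1))
  then have "openin (subtopology (Euclidean_space (mdim X)) (snd c ` fst c)) (snd c ` U)"
    using homeomorphic_imp_open_map[OF h(3)] by (simp add: open_map_def)
  moreover have "subtopology (Euclidean_space (mdim X)) (snd c ` fst c) =
      subtopology (subtopology (Euclidean_space (mdim X)) H) (snd c ` fst c)"
    using h(7) by (simp add: subtopology_subtopology Int_absorb1 image_subset_iff)
  ultimately show ?thesis using h(2) openin_trans_full by metis
qed

lemma chart_rep_eq:
  assumes "modelled_on H X" "c \<in> matlas X" "p \<in> fst c"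
  shows "chart_rep c d f (snd c p) j = snd d (f p) j"
  using modelled_chart(5)[OF assms(1,2)] assms(3) by (simp add: chart_rep_def)

lemma continuous_map_Euclidean_shift:
  "continuous_map euclideanreal (Euclidean_space m) (\<lambda>t i. if i < m then a i + t else 0)"
  unfolding Euclidean_space_def
  by (auto simp: continuous_map_in_subtopology continuous_map_componentwise_UNIV intro!: continuous_intros)

text \<open>Moving along the diagonal changes every coordinate at once without leaving the model.
  This yields the point, with all coordinates different, at which absolute convergence of the power
  series is read off.\<close>

lemma model_accumulation:
  assumes W: "openin (subtopology (Euclidean_space m) H) W" "x \<in> W"
    and H: "\<And>t. t \<ge> 0 \<Longrightarrow> (\<lambda>i. if i < m then x i + t else 0) \<in> H" and e: "e > 0"
  shows "\<exists>y\<in>W. \<forall>i<m. 0 < \<bar>y i - x i\<bar> \<and> \<bar>y i - x i\<bar> < e"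
proof -
  define l where "l = (\<lambda>t i. if i < m then x i + t else 0)"
  have xE: "\<And>i. i \<ge> m \<Longrightarrow> x i = 0"
    using openin_subset[OF W(1)] W(2) by (auto simp: topspace_Euclidean_space)
  have "continuous_map (top_of_set {0..}) (subtopology (Euclidean_space m) H) l"
    using continuous_map_Euclidean_shift[of m x] H
    unfolding l_def by (auto simp: continuous_map_in_subtopology continuous_map_from_subtopology)
  then have "openin (top_of_set {0..}) {t \<in> topspace (top_of_set {0..}). l t \<in> W}"
    using openin_continuous_map_preimage W(1) by blast
  moreover have "l 0 = x" using xE by (auto simp: l_def fun_eq_iff)
  then have "0 \<in> {t \<in> topspace (top_of_set {0::real..}). l t \<in> W}" using W(2) by simp
  ultimately obtain d where d: "d > 0" "\<And>t. t \<in> {0..} \<Longrightarrow> dist t 0 < d \<Longrightarrow> l t \<in> W"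
    unfolding openin_euclidean_subtopology_iff by blast
  define t where "t = min d e / 2"
  have t: "0 < t" "t < d" "t < e" using d(1) e by (auto simp: t_def)
  then have "l t \<in> W" using d(2)[of t] by simp
  moreover have "\<forall>i<m. 0 < \<bar>l t i - x i\<bar> \<and> \<bar>l t i - x i\<bar> < e" using t by (simp add: l_def)
  ultimately show ?thesis by blast
qed

lemma model_1_ball:
  assumes W: "openin (subtopology (Euclidean_space 1) {x. 0 \<le> x 0}) W" "x \<in> W"
  obtains e where "e > 0" "\<And>t. t \<ge> 0 \<Longrightarrow> \<bar>t - x 0\<bar> < e \<Longrightarrow> (\<lambda>i. if i < 1 then t else 0) \<in> W"
proof -
  define l where "l = (\<lambda>t::real. \<lambda>i::nat. if i < 1 then 0 + t else 0)"
  have xE: "\<And>i. i \<ge> 1 \<Longrightarrow> x i = 0" "x 0 \<ge> 0"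
    using openin_subset[OF W(1)] W(2) by (auto simp: topspace_Euclidean_space)
  have "continuous_map (top_of_set {0..}) (subtopology (Euclidean_space 1) {x. 0 \<le> x 0}) l"
    using continuous_map_Euclidean_shift[of 1 "\<lambda>_. 0"]
    unfolding l_def by (auto simp: continuous_map_in_subtopology continuous_map_from_subtopology)
  then have "openin (top_of_set {0..}) {t \<in> topspace (top_of_set {0..}). l t \<in> W}"
    using openin_continuous_map_preimage W(1) by blast
  moreover have "l (x 0) = x" using xE by (auto simp: l_def fun_eq_iff)
  then have "x 0 \<in> {t \<in> topspace (top_of_set {0::real..}). l t \<in> W}" using W(2) xE(2) by simp
  ultimately obtain d where d: "d > 0" "\<And>t. t \<in> {0..} \<Longrightarrow> dist t (x 0) < d \<Longrightarrow> l t \<in> W"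
    unfolding openin_euclidean_subtopology_iff by blast
  show thesis
  proof (rule that[OF d(1)])
    fix t :: real assume "t \<ge> 0" "\<bar>t - x 0\<bar> < d"
    then have "l t \<in> W" using d(2)[of t] by (simp add: dist_real_def)
    then show "(\<lambda>i. if i < 1 then t else 0) \<in> W" unfolding l_def add_0 .
  qed
qed

section \<open>Analytic curves under the action\<close>

definition coord :: "'s set \<times> ('s \<Rightarrow> nat \<Rightarrow> real) \<Rightarrow> 's \<Rightarrow> real" where
  "coord c y = snd c y 0"

lemma holomorphic_eq_on_ball:
  assumes "f holomorphic_on ball z0 r" "g holomorphic_on ball z0 r" "U \<subseteq> ball z0 r"
    and "\<xi> \<in> ball z0 r" "\<xi> islimpt U" "\<And>z. z \<in> U \<Longrightarrow> f z = g z" "w \<in> ball z0 r"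
  shows "f w = g w"
proof -
  have "f w - g w = 0"
  proof (rule analytic_continuation[OF _ _ _ assms(3-5) _ assms(7)])
    show "(\<lambda>z. f z - g z) holomorphic_on ball z0 r" using assms(1,2) by (intro holomorphic_intros)
  qed (use assms(6) in auto)
  then show ?thesis by simp
qed

lemma of_real_in_ball: "complex_of_real t \<in> ball (complex_of_real s) e \<longleftrightarrow> \<bar>t - s\<bar> < e"
  unfolding mem_ball dist_norm of_real_diff[symmetric] norm_of_real by (simp only: abs_minus_commute)

locale acted_curve =
  fixes G :: "'g monoid" and M :: "'m amfd" and \<phi> :: "'g \<Rightarrow> 'm \<Rightarrow> 'm"
    and S :: "'s amfd" and \<iota> :: "'s \<Rightarrow> 'm"
  assumes M: "analytic_manifold M"
    and act: "group_action G (points M) \<phi>"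
    and an: "analytic_in G M \<phi>"
    and sub: "analytic_1_submanifold M S \<iota>"
    and ll: "line_like S"
begin

sublocale curve "mtop S"
  using line_like_curve[OF ll] .

abbreviation "X \<equiv> mtop S"

lemma S_model: "modelled_on {x. 0 \<le> x 0} S" and S_dim: "mdim S = 1"
  and S_conn: "connected_space X" and \<iota>_inj: "inj_on \<iota> (points S)"
  and \<iota>_imm: "analytic_immersion S M \<iota>" and \<iota>_an: "analytic_map S M \<iota>"
  using sub unfolding analytic_1_submanifold_def analytic_manifold_with_boundary_def analytic_immersion_def by auto

lemma M_model: "modelled_on UNIV M" and M_haus: "Hausdorff_space (mtop M)"
  using M unfolding analytic_manifold_def modelled_on_def by auto

lemma \<iota>_cont: "continuous_map X (mtop M) \<iota>"
  using \<iota>_an by (simp add: analytic_map_def)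

lemma \<iota>_in: "y \<in> points S \<Longrightarrow> \<iota> y \<in> points M"
  using continuous_map_image_subset_topspace[OF \<iota>_cont] by blast

lemma grp: "group G"
  using act by (simp add: group_action_def group_hom_def)

lemma \<phi>_an: "g \<in> carrier G \<Longrightarrow> analytic_map M M (\<phi> g)"
  using an by (simp add: analytic_in_def)

lemma \<phi>_cont: "g \<in> carrier G \<Longrightarrow> continuous_map (mtop M) (mtop M) (\<phi> g)"
  using \<phi>_an by (simp add: analytic_map_def)

lemma \<phi>_in: "g \<in> carrier G \<Longrightarrow> x \<in> points M \<Longrightarrow> \<phi> g x \<in> points M"
  using continuous_map_image_subset_topspace[OF \<phi>_cont] by blast

lemma \<phi>_one: "x \<in> points M \<Longrightarrow> \<phi> \<one>\<^bsub>G\<^esub> x = x"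
  using group_action.id_eq_one[OF act] by (metis restrict_apply')

lemma \<phi>_mult: "g \<in> carrier G \<Longrightarrow> h \<in> carrier G \<Longrightarrow> x \<in> points M \<Longrightarrow> \<phi> (g \<otimes>\<^bsub>G\<^esub> h) x = \<phi> g (\<phi> h x)"
  using group_action.composition_rule[OF act] by blast

lemma \<phi>_inv: "g \<in> carrier G \<Longrightarrow> x \<in> points M \<Longrightarrow> \<phi> (inv\<^bsub>G\<^esub> g) (\<phi> g x) = x"
  using group_action.orbit_sym_aux[OF act] by blast

lemma \<phi>_inv': "g \<in> carrier G \<Longrightarrow> x \<in> points M \<Longrightarrow> \<phi> g (\<phi> (inv\<^bsub>G\<^esub> g) x) = x"
  using \<phi>_inv[of "inv\<^bsub>G\<^esub> g"] group.inv_inv[OF grp] group.inv_closed[OF grp] by metis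

lemma \<phi>_eq_iff: "g \<in> carrier G \<Longrightarrow> x \<in> points M \<Longrightarrow> y \<in> points M \<Longrightarrow> \<phi> g x = \<phi> g y \<longleftrightarrow> x = y"
  using \<phi>_inv by metis

lemma \<iota>_eq_iff: "x \<in> points S \<Longrightarrow> y \<in> points S \<Longrightarrow> \<iota> x = \<iota> y \<longleftrightarrow> x = y"
  using \<iota>_inj by (meson inj_on_eq_iff)

abbreviation "H \<equiv> stab_submfd G \<phi> S \<iota>"

lemma H_iff: "g \<in> H \<longleftrightarrow> g \<in> carrier G \<and> (\<forall>z\<in>points S. \<phi> g (\<iota> z) = \<iota> z)"
proof -
  obtain z where "z \<in> points S" using infin by fastforce
  then show ?thesis unfolding stab_submfd_def stabilizer_def by blast
qed

section \<open>Half-line coordinates on S and holomorphic extension\<close>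

lemma coord_inj:
  assumes c: "c \<in> matlas S" and xy: "x \<in> fst c" "y \<in> fst c" and eq: "coord c x = coord c y"
  shows "x = y"
proof -
  note h = modelled_chart[OF S_model c]
  have "snd c x i = snd c y i" for i
    using eq h(6)[OF xy(1), of i] h(6)[OF xy(2), of i] S_dim unfolding coord_def by (cases i) auto
  then show ?thesis using h(5) xy by (meson ext inj_on_eq_iff)
qed

lemma coord_nonneg: "c \<in> matlas S \<Longrightarrow> x \<in> fst c \<Longrightarrow> 0 \<le> coord c x"
  using modelled_chart(7)[OF S_model] by (simp add: coord_def)

lemma coord_cont: 
  assumes c: "c \<in> matlas S"
  shows "continuous_map (subtopology X (fst c)) euclideanreal (coord c)"
proof -
  note h = modelled_chart[OF S_model c]
  have "continuous_map (subtopology X (fst c)) (Euclidean_space (mdim S)) (snd c)"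
    using homeomorphic_imp_continuous_map[OF h(3)] by (simp add: continuous_map_in_subtopology)
  then have "continuous_map (subtopology X (fst c)) (powertop_real UNIV) (snd c)"
    by (simp add: Euclidean_space_def continuous_map_in_subtopology)
  then show ?thesis
    unfolding coord_def by (simp add: continuous_map_componentwise_UNIV)
qed

lemma coord_ball_open:
  assumes c: "c \<in> matlas S"
  shows "openin X {y \<in> fst c. \<bar>coord c y - t\<bar> < e}"
proof -
  note h = modelled_chart[OF S_model c]
  have "openin (subtopology X (fst c)) {y \<in> topspace (subtopology X (fst c)). coord c y \<in> ball t e}"
    by (intro openin_continuous_map_preimage[OF coord_cont[OF c]]) simp
  moreover have "{y \<in> topspace (subtopology X (fst c)). coord c y \<in> ball t e} = {y \<in> fst c. \<bar>coord c y - t\<bar> < e}"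
    using h(4) by (auto simp: dist_real_def abs_minus_commute)
  ultimately show ?thesis using h(1) openin_trans_full by metis
qed

text \<open>The restriction t \<ge> 0 is the trace of a possible boundary point of S. Since the
  coordinate is injective, points with nearby coordinates must belong to \<open>N\<close>.\<close>

lemma chart_nbhd:
  assumes c: "c \<in> matlas S" and z: "z \<in> fst c" and N: "openin X N" "z \<in> N"
  obtains e where "e > 0" "\<And>t. t \<ge> 0 \<Longrightarrow> \<bar>t - coord c z\<bar> < e \<Longrightarrow> \<exists>y\<in>N \<inter> fst c. coord c y = t"
    "\<And>y. y \<in> fst c \<Longrightarrow> \<bar>coord c y - coord c z\<bar> < e \<Longrightarrow> y \<in> N"
proof -
  note h = modelled_chart[OF S_model c]
  have "openin X (N \<inter> fst c)" using N(1) h(1) by blast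
  then have "openin (subtopology (Euclidean_space 1) {x. 0 \<le> x 0}) (snd c ` (N \<inter> fst c))"
    using openin_chart_dom[OF S_model c] S_dim by simp
  then obtain e where e: "e > 0"
      "\<And>t. t \<ge> 0 \<Longrightarrow> \<bar>t - snd c z 0\<bar> < e \<Longrightarrow> (\<lambda>i. if i < 1 then t else 0) \<in> snd c ` (N \<inter> fst c)"
    using model_1_ball[of "snd c ` (N \<inter> fst c)" "snd c z"] N(2) z by blast
  have ex: "\<exists>y\<in>N \<inter> fst c. coord c y = t" if t: "t \<ge> 0" "\<bar>t - coord c z\<bar> < e" for t
  proof -
    obtain y where "y \<in> N \<inter> fst c" "snd c y = (\<lambda>i. if i < 1 then t else 0)"
      using e(2)[OF t(1)] t(2) unfolding coord_def by (metis (no_types, lifting) imageE)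
    then show ?thesis unfolding coord_def by force
  qed
  have "y \<in> N" if y: "y \<in> fst c" "\<bar>coord c y - coord c z\<bar> < e" for y
  proof -
    obtain y' where "y' \<in> N \<inter> fst c" "coord c y' = coord c y"
      using ex[OF coord_nonneg[OF c y(1)] y(2)] by blast
    then show ?thesis using coord_inj[OF c _ y(1)] by blast
  qed
  then show thesis using that[OF e(1)] ex by blast
qed

lemma coord_islimpt:
  assumes c: "c \<in> matlas S" and z: "z \<in> fst c" and N: "openin X N" "z \<in> N"
  shows "complex_of_real (coord c z) islimpt (\<lambda>y. complex_of_real (coord c y)) ` (N \<inter> fst c)"
proof (rule islimptI)
  fix T assume T: "complex_of_real (coord c z) \<in> T" "open T"
  obtain e where e: "e > 0" "\<And>t. t \<ge> 0 \<Longrightarrow> \<bar>t - coord c z\<bar> < e \<Longrightarrow> \<exists>y\<in>N \<inter> fst c. coord c y = t"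
    using chart_nbhd[OF c z N] by metis
  obtain e' where e': "e' > 0" "ball (complex_of_real (coord c z)) e' \<subseteq> T"
    using T open_contains_ball by blast
  \<comment> \<open>A shift to the right stays in the half-line even if \<open>z\<close> is a
    boundary point.\<close>
  define t where "t = coord c z + min e e' / 2"
  have t: "t \<ge> 0" "\<bar>t - coord c z\<bar> < e" "\<bar>t - coord c z\<bar> < e'" "t \<noteq> coord c z"
    using coord_nonneg[OF c z] e(1) e'(1) by (auto simp: t_def)
  obtain y where y: "y \<in> N \<inter> fst c" "coord c y = t" using e(2)[OF t(1,2)] by blast
  have "complex_of_real t \<in> ball (complex_of_real (coord c z)) e'" using t(3) by (simp only: of_real_in_ball)
  then have "complex_of_real t \<in> T" using e'(2) by blast
  then show "\<exists>y\<in>(\<lambda>y. complex_of_real (coord c y)) ` (N \<inter> fst c). y \<in> T \<and> y \<noteq> complex_of_real (coord c z)"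
    using y t(4) by (intro bexI[of _ "complex_of_real t"]) auto
qed

text \<open>Analyticity is given for \<iota> and for the action separately. A chart of M around
  \<iota>(z) is inserted, and the composition argument is applied twice: first to the identity in
  the coordinate of S, then to the extension of \<iota> just obtained.\<close>

lemma local_extension:
  assumes g: "g \<in> carrier G" and c: "c \<in> matlas S" "z \<in> fst c" and d: "d \<in> matlas M" "\<phi> g (\<iota> z) \<in> fst d"
  obtains \<epsilon> \<Phi> where "\<epsilon> > 0" "\<And>j. j < mdim M \<Longrightarrow> \<Phi> j holomorphic_on ball (of_real (coord c z)) \<epsilon>"
    "\<And>y. y \<in> fst c \<Longrightarrow> \<bar>coord c y - coord c z\<bar> < \<epsilon> \<Longrightarrow> \<phi> g (\<iota> y) \<in> fst d"
    "\<And>y j. y \<in> fst c \<Longrightarrow> \<bar>coord c y - coord c z\<bar> < \<epsilon> \<Longrightarrow> j < mdim M \<Longrightarrow>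
       \<Phi> j (of_real (coord c y)) = of_real (snd d (\<phi> g (\<iota> y)) j)"
proof -
  let ?m = "mdim M" and ?z = "complex_of_real (coord c z)"
  note hc = modelled_chart[OF S_model c(1)]
  have zS: "z \<in> points S" using hc(4) c(2) by blast
  obtain d' where d': "d' \<in> matlas M" "\<iota> z \<in> fst d'"
    using modelled_chart_exists[OF M_model \<iota>_in[OF zS]] by blast
  note hd = modelled_chart[OF M_model d(1)] and hd' = modelled_chart[OF M_model d'(1)]
  define N1 where "N1 = {y \<in> fst c. \<iota> y \<in> fst d'}"
  define N2 where "N2 = {x \<in> fst d'. \<phi> g x \<in> fst d}"
  have N1: "openin X N1"
  proof -
    have "N1 = fst c \<inter> {y \<in> points S. \<iota> y \<in> fst d'}" using hc(4) by (auto simp: N1_def)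
    then show ?thesis using hc(1) openin_continuous_map_preimage[OF \<iota>_cont hd'(1)] by auto
  qed
  have N2: "openin (mtop M) N2"
  proof -
    have "N2 = fst d' \<inter> {x \<in> points M. \<phi> g x \<in> fst d}" using hd'(4) by (auto simp: N2_def)
    then show ?thesis using hd'(1) openin_continuous_map_preimage[OF \<phi>_cont[OF g] hd(1)] by auto
  qed
  have D1: "chart_dom c d' \<iota> = snd c ` N1" and D2: "chart_dom d' d (\<phi> g) = snd d' ` N2"
    by (simp_all add: chart_dom_def N1_def N2_def)
  have an1: "real_analytic_on 1 (snd c ` N1) (\<lambda>x. chart_rep c d' \<iota> x i)" if "i < ?m" for i
    using \<iota>_an c(1) d'(1) that S_dim unfolding analytic_map_def D1[symmetric] by auto
  have an2: "real_analytic_on ?m (snd d' ` N2) (\<lambda>x. chart_rep d' d (\<phi> g) x j)" if "j < ?m" for j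
    using \<phi>_an[OF g] d(1) d'(1) that unfolding analytic_map_def D2[symmetric] by auto
  have acc1: "\<exists>y\<in>snd c ` N1. \<forall>i<1. 0 < \<bar>y i - snd c z i\<bar> \<and> \<bar>y i - snd c z i\<bar> < e" if "e > 0" for e
  proof (rule model_accumulation[OF _ _ _ that])
    show "openin (subtopology (Euclidean_space 1) {x. 0 \<le> x 0}) (snd c ` N1)"
      using openin_chart_dom[OF S_model c(1) N1] S_dim by (auto simp: N1_def)
    show "snd c z \<in> snd c ` N1" using c(2) d'(2) by (simp add: N1_def)
    show "(\<lambda>i. if i < 1 then snd c z i + t else 0) \<in> {x. 0 \<le> x 0}" if "t \<ge> 0" for t
      using hc(7)[OF c(2)] that by simp
  qed
  have acc2: "\<exists>y\<in>snd d' ` N2. \<forall>i<?m. 0 < \<bar>y i - snd d' (\<iota> z) i\<bar> \<and> \<bar>y i - snd d' (\<iota> z) i\<bar> < e" if "e > 0" for e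
  proof (rule model_accumulation[OF _ _ _ that])
    show "openin (subtopology (Euclidean_space ?m) UNIV) (snd d' ` N2)"
      using openin_chart_dom[OF M_model d'(1) N2] by (auto simp: N2_def)
    show "snd d' (\<iota> z) \<in> snd d' ` N2" using d'(2) d(2) by (simp add: N2_def)
  qed simp
  obtain r1 \<Psi> where r1: "0 < r1" "\<And>i. i < ?m \<Longrightarrow> \<Psi> i holomorphic_on ball ?z r1"
    "\<And>i w y. i < ?m \<Longrightarrow> w \<in> ball ?z r1 \<Longrightarrow> y \<in> snd c ` N1 \<Longrightarrow> (\<And>l. l < 1 \<Longrightarrow> w = of_real (y l)) \<Longrightarrow>
       \<Psi> i w = of_real (chart_rep c d' \<iota> y i)"
  proof (rule real_analytic_comp_holomorphic_family[where n = ?m and m = 1 and D = "snd c ` N1"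
        and x = "snd c z" and \<psi> = "\<lambda>_ w. w" and R = 1 and \<zeta> = ?z and F = "\<lambda>i x. chart_rep c d' \<iota> x i"])
    show "snd c z \<in> snd c ` N1" using c(2) d'(2) by (simp add: N1_def)
  qed (use an1 acc1 in \<open>auto simp: coord_def intro!: holomorphic_intros\<close>)
  have \<Psi>z: "\<Psi> i ?z = of_real (snd d' (\<iota> z) i)" if "i < ?m" for i
  proof -
    have "\<Psi> i ?z = of_real (chart_rep c d' \<iota> (snd c z) i)"
      by (rule r1(3)[OF that]) (use r1(1) c(2) d'(2) in \<open>auto simp: N1_def coord_def\<close>)
    then show ?thesis using chart_rep_eq[OF S_model c] by simp
  qed
  obtain r2 \<Phi> where r2: "0 < r2" "r2 \<le> r1" "\<And>j. j < ?m \<Longrightarrow> \<Phi> j holomorphic_on ball ?z r2"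
    "\<And>j w y. j < ?m \<Longrightarrow> w \<in> ball ?z r2 \<Longrightarrow> y \<in> snd d' ` N2 \<Longrightarrow> (\<And>l. l < ?m \<Longrightarrow> \<Psi> l w = of_real (y l)) \<Longrightarrow>
       \<Phi> j w = of_real (chart_rep d' d (\<phi> g) y j)"
  proof (rule real_analytic_comp_holomorphic_family[where n = ?m and m = ?m and D = "snd d' ` N2"
        and x = "snd d' (\<iota> z)" and \<psi> = \<Psi> and R = r1 and \<zeta> = ?z and F = "\<lambda>j x. chart_rep d' d (\<phi> g) x j"])
    show "snd d' (\<iota> z) \<in> snd d' ` N2" using d'(2) d(2) by (simp add: N2_def)
  qed (use an2 acc2 r1(1,2) \<Psi>z in auto)
  define N where "N = N1 \<inter> {y \<in> points S. \<iota> y \<in> N2}"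
  have "openin X N" unfolding N_def using N1 openin_continuous_map_preimage[OF \<iota>_cont N2] by auto
  moreover have "z \<in> N" using c(2) d'(2) d(2) zS by (simp add: N_def N1_def N2_def)
  ultimately obtain e where e: "e > 0" "\<And>y. y \<in> fst c \<Longrightarrow> \<bar>coord c y - coord c z\<bar> < e \<Longrightarrow> y \<in> N"
    using chart_nbhd[OF c] by metis
  show thesis
  proof (rule that[of "min e r2" \<Phi>])
    show "min e r2 > 0" using e(1) r2(1) by simp
    show "\<Phi> j holomorphic_on ball ?z (min e r2)" if "j < ?m" for j
      using r2(3)[OF that] by (rule holomorphic_on_subset) auto
    fix y assume y: "y \<in> fst c" "\<bar>coord c y - coord c z\<bar> < min e r2"
    then have yN: "y \<in> N" using e(2) by simp
    then show "\<phi> g (\<iota> y) \<in> fst d" by (simp add: N_def N2_def)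
    have yb: "complex_of_real (coord c y) \<in> ball ?z r2" using y(2) by (simp only: of_real_in_ball)
    then have yb1: "complex_of_real (coord c y) \<in> ball ?z r1" using r2(2) by simp
    have yN1: "y \<in> N1" and yN2: "\<iota> y \<in> N2" using yN by (auto simp: N_def)
    have \<Psi>y: "\<Psi> i (of_real (coord c y)) = of_real (snd d' (\<iota> y) i)" if "i < ?m" for i
    proof -
      have "\<Psi> i (of_real (coord c y)) = of_real (chart_rep c d' \<iota> (snd c y) i)"
        by (rule r1(3)[OF that yb1]) (use yN1 in \<open>auto simp: coord_def\<close>)
      then show ?thesis using chart_rep_eq[OF S_model c(1) y(1)] by simp
    qed
    fix j assume j: "j < ?m"
    have "\<Phi> j (of_real (coord c y)) = of_real (chart_rep d' d (\<phi> g) (snd d' (\<iota> y)) j)"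
      by (rule r2(4)[OF j yb]) (use yN2 \<Psi>y in auto)
    then show "\<Phi> j (of_real (coord c y)) = of_real (snd d (\<phi> g (\<iota> y)) j)"
      using chart_rep_eq[OF M_model d'(1), of "\<iota> y" d "\<phi> g" j] yN2 by (simp add: N2_def)
  qed
qed

section \<open>The identity principle\<close>

lemma chart_coords_eq:
  assumes d: "d \<in> matlas M" "x \<in> fst d" "y \<in> fst d" and eq: "\<And>j. j < mdim M \<Longrightarrow> snd d x j = snd d y j"
  shows "x = y"
proof -
  note h = modelled_chart[OF M_model d(1)]
  have "snd d x j = snd d y j" for j
    using eq[of j] h(6)[OF d(2), of j] h(6)[OF d(3), of j] by (cases "j < mdim M") auto
  then show ?thesis using h(5) d(2,3) by (meson ext inj_on_eq_iff)
qed

text \<open>Freeness arguments only produce agreement along a small arc. The set \<open>Z\<close> of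
  points near which \<open>g\<close> fixes \<iota> is open and closed, and connectedness of S
  spreads the agreement to all of \<iota>(S).\<close>

lemma stab_identity:
  assumes g: "g \<in> carrier G" and p: "arcin X C a b p"
    and fix_p: "\<And>t. t \<in> {a..b} \<Longrightarrow> \<phi> g (\<iota> (p t)) = \<iota> (p t)"
  shows "g \<in> H"
proof -
  define Z where "Z = {z \<in> points S. \<exists>V. openin X V \<and> z \<in> V \<and> (\<forall>y\<in>V. \<phi> g (\<iota> y) = \<iota> y)}"
  have "openin X Z"
  proof (subst openin_subopen, intro ballI)
    fix z assume "z \<in> Z"
    then obtain V where V: "openin X V" "z \<in> V" "\<forall>y\<in>V. \<phi> g (\<iota> y) = \<iota> y" by (auto simp: Z_def)
    then have "V \<subseteq> Z" using openin_subset by (auto simp: Z_def)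
    then show "\<exists>T. openin X T \<and> z \<in> T \<and> T \<subseteq> Z" using V by blast
  qed
  moreover have "closedin X Z"
  proof -
    have "closedin X {y \<in> points S. \<phi> g (\<iota> y) = \<iota> y}"
      using closedin_continuous_maps_eq[OF M_haus continuous_map_compose[OF \<iota>_cont \<phi>_cont[OF g]] \<iota>_cont]
      by (simp add: comp_def)
    moreover have "Z \<subseteq> {y \<in> points S. \<phi> g (\<iota> y) = \<iota> y}" by (auto simp: Z_def)
    ultimately have cl: "X closure_of Z \<subseteq> {y \<in> points S. \<phi> g (\<iota> y) = \<iota> y}" by (simp add: closure_of_minimal)
    have "X closure_of Z \<subseteq> Z"
    proof
      fix z assume z: "z \<in> X closure_of Z"
      then have zS: "z \<in> points S" and fz: "\<phi> g (\<iota> z) = \<iota> z" using cl by auto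
      obtain c where c: "c \<in> matlas S" "z \<in> fst c" using modelled_chart_exists[OF S_model zS] by blast
      obtain d where d: "d \<in> matlas M" "\<iota> z \<in> fst d" using modelled_chart_exists[OF M_model \<iota>_in[OF zS]] by blast
      \<comment> \<open>\<iota> itself is treated as the translate by the neutral element, so that
        the same extension lemma covers both curves.\<close>
      have one: "\<one>\<^bsub>G\<^esub> \<in> carrier G" using grp by (simp add: group.is_monoid monoid.one_closed)
      note hc = modelled_chart[OF S_model c(1)]
      obtain e1 \<Phi> where \<Phi>: "e1 > 0" "\<And>j. j < mdim M \<Longrightarrow> \<Phi> j holomorphic_on ball (of_real (coord c z)) e1"
        "\<And>y. y \<in> fst c \<Longrightarrow> \<bar>coord c y - coord c z\<bar> < e1 \<Longrightarrow> \<phi> g (\<iota> y) \<in> fst d"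
        "\<And>y j. y \<in> fst c \<Longrightarrow> \<bar>coord c y - coord c z\<bar> < e1 \<Longrightarrow> j < mdim M \<Longrightarrow>
           \<Phi> j (of_real (coord c y)) = of_real (snd d (\<phi> g (\<iota> y)) j)"
        using local_extension[OF g c d(1)] d(2) fz by metis
      obtain e2 \<Psi> where \<Psi>: "e2 > 0" "\<And>j. j < mdim M \<Longrightarrow> \<Psi> j holomorphic_on ball (of_real (coord c z)) e2"
        "\<And>y. y \<in> fst c \<Longrightarrow> \<bar>coord c y - coord c z\<bar> < e2 \<Longrightarrow> \<phi> \<one>\<^bsub>G\<^esub> (\<iota> y) \<in> fst d"
        "\<And>y j. y \<in> fst c \<Longrightarrow> \<bar>coord c y - coord c z\<bar> < e2 \<Longrightarrow> j < mdim M \<Longrightarrow>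
           \<Psi> j (of_real (coord c y)) = of_real (snd d (\<phi> \<one>\<^bsub>G\<^esub> (\<iota> y)) j)"
        using local_extension[OF one c d(1)] d(2) \<phi>_one[OF \<iota>_in[OF zS]] by metis
      define e where "e = min e1 e2"
      define N where "N = {y \<in> fst c. \<bar>coord c y - coord c z\<bar> < e}"
      have e: "e > 0" "e \<le> e1" "e \<le> e2" using \<Phi>(1) \<Psi>(1) by (auto simp: e_def)
      have N: "openin X N" "z \<in> N" using coord_ball_open[OF c(1)] c(2) e by (auto simp: N_def)
      \<comment> \<open>The two extensions are compared at a nearby point \<open>w\<close> of
        \<open>Z\<close>, where they agree on an open set; the identity theorem on the disc carries
        the equality to a neighbourhood of \<open>z\<close>.\<close>
      obtain w where w: "w \<in> Z" "w \<in> N" using z N unfolding in_closure_of by blast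
      obtain V where V: "openin X V" "w \<in> V" "\<forall>y\<in>V. \<phi> g (\<iota> y) = \<iota> y" using w(1) by (auto simp: Z_def)
      have wc: "w \<in> fst c" using w(2) by (simp add: N_def)
      let ?U = "(\<lambda>y. complex_of_real (coord c y)) ` ((V \<inter> N) \<inter> fst c)" and ?B = "ball (complex_of_real (coord c z)) e"
      have lim: "complex_of_real (coord c w) islimpt ?U"
        using coord_islimpt[OF c(1) wc] V(1,2) w(2) N(1) by blast
      have inB: "complex_of_real (coord c y) \<in> ?B" if "y \<in> N" for y
        using that unfolding N_def of_real_in_ball by blast
      have eqj: "\<Phi> j x = \<Psi> j x" if j: "j < mdim M" and x: "x \<in> ?B" for j x
      proof (rule holomorphic_eq_on_ball[OF _ _ _ _ lim _ x])
        show "\<Phi> j holomorphic_on ?B" using \<Phi>(2)[OF j] by (rule holomorphic_on_subset) (use e in auto)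
        show "\<Psi> j holomorphic_on ?B" using \<Psi>(2)[OF j] by (rule holomorphic_on_subset) (use e in auto)
        show "?U \<subseteq> ?B" using inB by blast
        show "complex_of_real (coord c w) \<in> ?B" using inB w(2) by blast
        fix u assume "u \<in> ?U"
        then obtain y where y: "y \<in> V" "y \<in> N" "u = complex_of_real (coord c y)" by blast
        then have yc: "y \<in> fst c" "\<bar>coord c y - coord c z\<bar> < e1" "\<bar>coord c y - coord c z\<bar> < e2"
          using e by (auto simp: N_def)
        have "\<phi> \<one>\<^bsub>G\<^esub> (\<iota> y) = \<iota> y" using \<phi>_one \<iota>_in hc(4) yc(1) by blast
        then show "\<Phi> j u = \<Psi> j u"
          using \<Phi>(4)[OF yc(1,2) j] \<Psi>(4)[OF yc(1,3) j] V(3) y(1,3) by simp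
      qed
      have "\<phi> g (\<iota> y) = \<iota> y" if y: "y \<in> N" for y
      proof -
        have yc: "y \<in> fst c" "\<bar>coord c y - coord c z\<bar> < e1" "\<bar>coord c y - coord c z\<bar> < e2"
          using e y by (auto simp: N_def)
        have o: "\<phi> \<one>\<^bsub>G\<^esub> (\<iota> y) = \<iota> y" using \<phi>_one \<iota>_in hc(4) yc(1) by blast
        show ?thesis
        proof (rule chart_coords_eq[OF d(1)])
          show "\<phi> g (\<iota> y) \<in> fst d" using \<Phi>(3)[OF yc(1,2)] .
          show "\<iota> y \<in> fst d" using \<Psi>(3)[OF yc(1,3)] o by simp
          fix j assume j: "j < mdim M"
          have "complex_of_real (snd d (\<phi> g (\<iota> y)) j) = of_real (snd d (\<iota> y) j)"
            using \<Phi>(4)[OF yc(1,2) j] \<Psi>(4)[OF yc(1,3) j] eqj[OF j inB[OF y]] o by simp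
          then show "snd d (\<phi> g (\<iota> y)) j = snd d (\<iota> y) j" by simp
        qed
      qed
      then show "z \<in> Z" using N zS by (auto simp: Z_def)
    qed
    then show ?thesis using closure_of_subset_eq[of Z X] by (auto simp: Z_def)
  qed
  moreover have "Z \<noteq> {}"
  proof -
    have ab: "a < b" using p by (simp add: arcin_def)
    have "p ((a + b) / 2) \<in> p ` {a<..<b}" using ab by auto
    moreover have "\<forall>y\<in>p ` {a<..<b}. \<phi> g (\<iota> y) = \<iota> y" using fix_p by auto
    ultimately have "p ((a + b) / 2) \<in> Z"
      using arc_open[OF p] openin_subset[OF arc_open[OF p]] by (auto simp: Z_def)
    then show ?thesis by blast
  qed
  ultimately have "Z = points S" using S_conn connected_space_clopen_in by blast
  then show ?thesis using g unfolding H_iff Z_def by blast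
qed

section \<open>Extension of related arcs to both sides\<close>

lemma one_closed: "\<one>\<^bsub>G\<^esub> \<in> carrier G"
  using grp by (simp add: group.is_monoid monoid.one_closed)

lemma local_extension_id:
  assumes c: "c \<in> matlas S" "z \<in> fst c" and d: "d \<in> matlas M" "\<iota> z \<in> fst d"
  obtains \<epsilon> \<Psi> where "\<epsilon> > 0" "\<And>j. j < mdim M \<Longrightarrow> \<Psi> j holomorphic_on ball (of_real (coord c z)) \<epsilon>"
    "\<And>y. y \<in> fst c \<Longrightarrow> \<bar>coord c y - coord c z\<bar> < \<epsilon> \<Longrightarrow> \<iota> y \<in> fst d"
    "\<And>y j. y \<in> fst c \<Longrightarrow> \<bar>coord c y - coord c z\<bar> < \<epsilon> \<Longrightarrow> j < mdim M \<Longrightarrow>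
       \<Psi> j (of_real (coord c y)) = of_real (snd d (\<iota> y) j)"
proof -
  have o: "\<phi> \<one>\<^bsub>G\<^esub> (\<iota> y) = \<iota> y" if "y \<in> fst c" for y
    using modelled_chart(4)[OF S_model c(1)] that \<phi>_one \<iota>_in by blast
  obtain \<epsilon> \<Psi> where "\<epsilon> > 0" "\<And>j. j < mdim M \<Longrightarrow> \<Psi> j holomorphic_on ball (of_real (coord c z)) \<epsilon>"
    "\<And>y. y \<in> fst c \<Longrightarrow> \<bar>coord c y - coord c z\<bar> < \<epsilon> \<Longrightarrow> \<phi> \<one>\<^bsub>G\<^esub> (\<iota> y) \<in> fst d"
    "\<And>y j. y \<in> fst c \<Longrightarrow> \<bar>coord c y - coord c z\<bar> < \<epsilon> \<Longrightarrow> j < mdim M \<Longrightarrow>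
       \<Psi> j (of_real (coord c y)) = of_real (snd d (\<phi> \<one>\<^bsub>G\<^esub> (\<iota> y)) j)"
    using local_extension[OF one_closed c d(1)] d(2) o[OF c(2)] by metis
  then show thesis using that[of \<epsilon> \<Psi>] o by simp
qed

lemma arc_into_chart:
  assumes p: "arcin X C a b p" and U: "openin X U" "p a \<in> U"
  obtains \<delta> where "\<delta> > 0" "a + \<delta> \<le> b" "p ` {a..a+\<delta>} \<subseteq> U"
proof -
  have ab: "a < b" and pc: "continuous_map (top_of_set {a..b}) X p" using p by (auto simp: arcin_def)
  have "openin (top_of_set {a..b}) {u \<in> topspace (top_of_set {a..b}). p u \<in> U}"
    using openin_continuous_map_preimage[OF pc U(1)] .
  moreover have "a \<in> {u \<in> topspace (top_of_set {a..b}). p u \<in> U}" using ab U(2) by simp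
  ultimately obtain e where e: "e > 0" "\<And>u. u \<in> {a..b} \<Longrightarrow> dist u a < e \<Longrightarrow> p u \<in> U"
    unfolding openin_euclidean_subtopology_iff by blast
  define \<delta> where "\<delta> = min (e / 2) (b - a)"
  have "\<delta> > 0" "a + \<delta> \<le> b" using e(1) ab by (auto simp: \<delta>_def)
  moreover have "p u \<in> U" if "u \<in> {a..a+\<delta>}" for u
    using e(2)[of u] that e(1) ab by (auto simp: \<delta>_def dist_real_def)
  ultimately show thesis using that by blast
qed

lemma coord_comp_cont:
  assumes c: "c \<in> matlas S" and p: "continuous_map (top_of_set I) X p" "p ` I \<subseteq> fst c"
  shows "continuous_on I (\<lambda>u. coord c (p u))"
  using cont_comp[OF coord_cont[OF c] p] by (simp add: comp_def)

text \<open>A two-sided arc through a point with coordinate 0 would have a full neighbourhood of 0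
  among its coordinates, but coordinates are never negative.\<close>

lemma coord_interior_pos:
  assumes c: "c \<in> matlas S" "y \<in> fst c" and y: "y \<in> seg_int S (points S)"
  shows "coord c y > 0"
proof (rule ccontr)
  assume "\<not> coord c y > 0"
  then have y0: "coord c y = 0" using coord_nonneg[OF c] by simp
  note h = modelled_chart[OF S_model c(1)]
  obtain r where r: "arcin X (points S) (-1) 1 r" "r 0 = y" using seg_int_two_sided[OF y] by blast
  have rc: "continuous_map (top_of_set {-1..1}) X r" using r by (simp add: arcin_def)
  have "openin (top_of_set {-1..1}) {u \<in> topspace (top_of_set {-1..1}). r u \<in> fst c}"
    using openin_continuous_map_preimage[OF rc h(1)] .
  moreover have "0 \<in> {u \<in> topspace (top_of_set {-1..1::real}). r u \<in> fst c}" using r(2) c(2) by simp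
  ultimately obtain e where e: "e > 0" "\<And>u. u \<in> {-1..1} \<Longrightarrow> dist u 0 < e \<Longrightarrow> r u \<in> fst c"
    unfolding openin_euclidean_subtopology_iff by blast
  define \<delta> where "\<delta> = min (e / 2) 1"
  have \<delta>: "0 < \<delta>" "\<delta> < e" "\<delta> \<le> 1" using e(1) by (auto simp: \<delta>_def)
  have rU: "r u \<in> fst c" if "u \<in> {-\<delta>..\<delta>}" for u
    using e(2)[of u] that \<delta> by auto
  have "continuous_map (top_of_set {-\<delta>..\<delta>}) X r"
    using arcin_sub[OF r(1), of "-\<delta>" \<delta>] \<delta> by (auto simp: arcin_def)
  then have co: "continuous_on {-\<delta>..\<delta>} (\<lambda>u. coord c (r u))"
    using coord_comp_cont[OF c(1)] rU by blast
  have inj: "inj_on (\<lambda>u. coord c (r u)) {-\<delta>..\<delta>}"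
  proof (rule inj_onI)
    fix u w assume uw: "u \<in> {-\<delta>..\<delta>}" "w \<in> {-\<delta>..\<delta>}" "coord c (r u) = coord c (r w)"
    then have "r u = r w" using coord_inj[OF c(1)] rU by blast
    then show "u = w" using arcin_inj[OF r(1), of u w] uw \<delta> by simp
  qed
  have "open ((\<lambda>u. coord c (r u)) ` {-\<delta><..<\<delta>})"
    using injective_eq_1d_open_map_UNIV[OF co is_interval_cc] inj open_greaterThanLessThan[of "-\<delta>" \<delta>]
      greaterThanLessThan_subseteq_atLeastAtMost_iff[of "-\<delta>" \<delta> "-\<delta>" \<delta>] by simp
  moreover have "0 \<in> (\<lambda>u. coord c (r u)) ` {-\<delta><..<\<delta>}"
    using y0 r(2) \<delta>(1) by (intro image_eqI[of _ _ 0]) auto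
  ultimately obtain e' where e': "e' > 0" "ball 0 e' \<subseteq> (\<lambda>u. coord c (r u)) ` {-\<delta><..<\<delta>}"
    using open_contains_ball by blast
  have "- (e' / 2) \<in> ball 0 e'" using e'(1) by simp
  then obtain u where "u \<in> {-\<delta><..<\<delta>}" "coord c (r u) = - (e' / 2)" using e'(2) by (metis (no_types, lifting) imageE subsetD)
  then show False using coord_nonneg[OF c(1) rU[of u]] e'(1) by auto
qed

text \<open>If all derivatives vanished, so would the single column of the Jacobian, against
  injectivity of the differential. The positive coordinate turns the derivative within the chart
  domain into an ordinary one.\<close>

lemma immersion_deriv:
  assumes c: "c \<in> matlas S" "y \<in> fst c" and pos: "coord c y > 0" and d: "d \<in> matlas M" "\<iota> y \<in> fst d"
    and \<epsilon>: "\<epsilon> > 0" and hol: "\<And>j. j < mdim M \<Longrightarrow> \<Psi> j holomorphic_on ball (of_real (coord c y)) \<epsilon>"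
    and val: "\<And>x j. x \<in> fst c \<Longrightarrow> \<bar>coord c x - coord c y\<bar> < \<epsilon> \<Longrightarrow> j < mdim M \<Longrightarrow>
       \<Psi> j (of_real (coord c x)) = of_real (snd d (\<iota> x) j)"
  shows "\<exists>j<mdim M. deriv (\<Psi> j) (of_real (coord c y)) \<noteq> 0"
proof (rule ccontr)
  assume "\<not> ?thesis"
  then have d0: "\<And>j. j < mdim M \<Longrightarrow> deriv (\<Psi> j) (of_real (coord c y)) = 0" by blast
  note h = modelled_chart[OF S_model c(1)]
  let ?x = "snd c y" and ?D = "chart_dom c d \<iota>"
  have xD: "?x \<in> ?D" using c d by (simp add: chart_dom_def)
  obtain J where J0: "(\<forall>i < mdim S. \<forall>j < mdim M.
        ((\<lambda>t. chart_rep c d \<iota> (?x(i := t)) j) has_real_derivative J j i) (at (?x i) within {t. ?x(i := t) \<in> ?D})) \<and>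
      (\<forall>v :: nat \<Rightarrow> real. (\<forall>j < mdim M. (\<Sum>i < mdim S. J j i * v i) = 0) \<longrightarrow> (\<forall>i < mdim S. v i = 0))"
    using bspec[OF bspec[OF bspec[OF conjunct2[OF \<iota>_imm[unfolded analytic_immersion_def]] c(1)] d(1)] xD]
    by (rule exE)
  have J: "((\<lambda>t. chart_rep c d \<iota> (?x(0 := t)) j) has_real_derivative J j 0) (at (?x 0) within {t. ?x(0 := t) \<in> ?D})"
    if "j < mdim M" for j
    using conjunct1[OF J0] that S_dim by simp
  \<comment> \<open>The vector with all entries 1 would lie in the kernel of the
    differential.\<close>
  have J2: "(\<forall>j<mdim M. J j 0 = 0) \<Longrightarrow> False"
    using spec[OF conjunct2[OF J0], of "\<lambda>_. 1"] S_dim by (auto dest!: spec[of _ "0::nat"])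
  define N where "N = fst c \<inter> {y \<in> points S. \<iota> y \<in> fst d}"
  have oN: "openin X N" unfolding N_def
    using h(1) openin_continuous_map_preimage[OF \<iota>_cont modelled_chart(1)[OF M_model d(1)]] by blast
  have yN: "y \<in> N" using c d h(4) by (auto simp: N_def)
  obtain e where e: "e > 0" "\<And>t. t \<ge> 0 \<Longrightarrow> \<bar>t - coord c y\<bar> < e \<Longrightarrow> \<exists>x\<in>N \<inter> fst c. coord c x = t"
    using chart_nbhd[OF c oN yN] by metis
  define r where "r = min (min e \<epsilon>) (coord c y)"
  have r: "r > 0" "r \<le> e" "r \<le> \<epsilon>" "r \<le> coord c y" using e(1) \<epsilon> pos by (auto simp: r_def)
  have pt: "?x(0 := t) \<in> ?D \<and> (j < mdim M \<longrightarrow> chart_rep c d \<iota> (?x(0 := t)) j = Re (\<Psi> j (of_real t)))"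
    if "t \<in> ball (coord c y) r" for t j
  proof -
    have t: "t \<ge> 0" "\<bar>t - coord c y\<bar> < e" "\<bar>t - coord c y\<bar> < \<epsilon>"
      using that r by (auto simp: dist_real_def)
    obtain x where x: "x \<in> fst c" "\<iota> x \<in> fst d" "coord c x = t"
      using e(2)[OF t(1,2)] unfolding N_def by blast
    have "?x(0 := t) = snd c x"
    proof
      fix i show "(?x(0 := t)) i = snd c x i"
        using x(3) h(6)[OF c(2), of i] h(6)[OF x(1), of i] S_dim by (cases i) (auto simp: coord_def)
    qed
    moreover have "\<Psi> j (of_real t) = of_real (snd d (\<iota> x) j)" if "j < mdim M"
      using val[OF x(1) _ that] t(3) x(3) by simp
    ultimately show ?thesis
      using x chart_rep_eq[OF S_model c(1) x(1), of d \<iota> j] by (simp add: chart_dom_def)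
  qed
  have "J j 0 = 0" if j: "j < mdim M" for j
  proof -
    let ?f = "\<lambda>t. chart_rep c d \<iota> (?x(0 := t)) j"
    have "ball (coord c y) r \<subseteq> {t. ?x(0 := t) \<in> ?D}" using pt by blast
    then have "(?f has_real_derivative J j 0) (at (coord c y) within ball (coord c y) r)"
      using has_field_derivative_subset[OF J[OF j]] unfolding coord_def by blast
    then have 1: "(?f has_real_derivative J j 0) (at (coord c y))"
      using r(1) by (simp add: at_within_open[of _ "ball (coord c y) r"])
    have "(\<Psi> j has_field_derivative 0) (at (of_real (coord c y)))"
      using holomorphic_derivI[OF hol[OF j] open_ball, of "of_real (coord c y)" UNIV] d0[OF j] \<epsilon> by simp
    then have "((\<lambda>t. \<Psi> j (of_real t)) has_vector_derivative 0) (at (coord c y))"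
      using has_vector_derivative_real_field by fastforce
    then have "((\<lambda>t. Re (\<Psi> j (of_real t))) has_vector_derivative Re 0) (at (coord c y))"
      using bounded_linear.has_vector_derivative[OF bounded_linear_Re] by blast
    then have "((\<lambda>t. Re (\<Psi> j (of_real t))) has_real_derivative 0) (at (coord c y))"
      by (simp add: has_real_derivative_iff_has_vector_derivative)
    then have "(?f has_real_derivative 0) (at (coord c y))"
      by (rule has_field_derivative_transform_within_open[of _ _ _ "ball (coord c y) r"])
        (use r(1) pt j in auto)
    then show ?thesis using 1 DERIV_unique by blast
  qed
  then show False using J2 by blast
qed

lemma chart_inverse_cont:
  fixes f :: "real \<Rightarrow> real"
  assumes c: "c \<in> matlas S" and f: "continuous_on I f" "\<And>u. u \<in> I \<Longrightarrow> f u \<in> coord c ` fst c"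
  shows "continuous_map (top_of_set I) X (\<lambda>u. inv_into (fst c) (coord c) (f u))"
    and "\<And>u. u \<in> I \<Longrightarrow> inv_into (fst c) (coord c) (f u) \<in> fst c"
    and "\<And>u. u \<in> I \<Longrightarrow> coord c (inv_into (fst c) (coord c) (f u)) = f u"
proof -
  note h = modelled_chart[OF S_model c(1)]
  let ?P = "\<lambda>u. inv_into (fst c) (coord c) (f u)"
  show 1: "?P u \<in> fst c" and 2: "coord c (?P u) = f u" if "u \<in> I" for u
    using f(2)[OF that] by (simp_all add: inv_into_into f_inv_into_f)
  show "continuous_map (top_of_set I) X ?P"
    unfolding continuous_map_def
  proof (intro conjI allI impI)
    show "?P \<in> topspace (top_of_set I) \<rightarrow> points S" using 1 h(4) by auto
    fix N assume N: "openin X N"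
    have "\<exists>e>0. \<forall>u'\<in>I. dist u' u < e \<longrightarrow> ?P u' \<in> N" if u: "u \<in> I" "?P u \<in> N" for u
    proof -
      obtain e where e: "e > 0" "\<And>y. y \<in> fst c \<Longrightarrow> \<bar>coord c y - coord c (?P u)\<bar> < e \<Longrightarrow> y \<in> N"
        using chart_nbhd[OF c 1[OF u(1)] N u(2)] by metis
      obtain e' where e': "e' > 0" "\<And>u'. u' \<in> I \<Longrightarrow> dist u' u < e' \<Longrightarrow> dist (f u') (f u) < e"
        using f(1) u(1) e(1) unfolding continuous_on_iff by blast
      have "?P u' \<in> N" if "u' \<in> I" "dist u' u < e'" for u'
        using e(2)[OF 1[OF that(1)]] e'(2)[OF that] 2[OF that(1)] 2[OF u(1)] by (simp add: dist_real_def)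
      then show ?thesis using e'(1) by blast
    qed
    then show "openin (top_of_set I) {x \<in> topspace (top_of_set I). ?P x \<in> N}"
      unfolding openin_euclidean_subtopology_iff by auto
  qed
qed

text \<open>
  The reparametrization that relates the two curves is \<open>\<Psi>\<^sub>j\<^sup>-\<^sup>1 \<circ> \<Phi>\<^sub>j\<close> for a coordinate \<open>j\<close> with
  \<open>\<Psi>\<^sub>j' \<noteq> 0\<close>, hence holomorphic, and it is real on the real axis by reflection.
\<close>

lemma two_sided_extension:
  assumes g: "g \<in> carrier G" and p: "arcin X C a b p" and q: "arcin X C' a b q"
    and pq: "\<And>u. u \<in> {a..b} \<Longrightarrow> \<phi> g (\<iota> (p u)) = \<iota> (q u)"
    and int: "p a \<in> seg_int S (points S)" "q a \<in> seg_int S (points S)"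
  obtains P Q where "arcin X (points S) (-1) 1 P" "arcin X (points S) (-1) 1 Q" "P 0 = p a" "Q 0 = q a"
    "\<And>u. u \<in> {-1..1} \<Longrightarrow> \<phi> g (\<iota> (P u)) = \<iota> (Q u)"
proof -
  have ab: "a < b" using p by (simp add: arcin_def)
  have xS: "p a \<in> points S" and yS: "q a \<in> points S"
    using arcin_topspace[OF p] arcin_topspace[OF q] ab by auto
  obtain c where c: "c \<in> matlas S" "p a \<in> fst c" using modelled_chart_exists[OF S_model xS] by blast
  obtain c' where c': "c' \<in> matlas S" "q a \<in> fst c'" using modelled_chart_exists[OF S_model yS] by blast
  obtain d where d: "d \<in> matlas M" "\<iota> (q a) \<in> fst d" using modelled_chart_exists[OF M_model \<iota>_in[OF yS]] by blast
  note hc = modelled_chart[OF S_model c(1)] and hc' = modelled_chart[OF S_model c'(1)]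
  define s where "s = coord c (p a)"
  define t where "t = coord c' (q a)"
  have s0: "s > 0" and t0: "t > 0" using coord_interior_pos c c' int by (auto simp: s_def t_def)
  have ga: "\<phi> g (\<iota> (p a)) = \<iota> (q a)" using pq ab by simp
  obtain e1 \<Phi> where \<Phi>: "e1 > 0" "\<And>j. j < mdim M \<Longrightarrow> \<Phi> j holomorphic_on ball (of_real s) e1"
    "\<And>y. y \<in> fst c \<Longrightarrow> \<bar>coord c y - s\<bar> < e1 \<Longrightarrow> \<phi> g (\<iota> y) \<in> fst d"
    "\<And>y j. y \<in> fst c \<Longrightarrow> \<bar>coord c y - s\<bar> < e1 \<Longrightarrow> j < mdim M \<Longrightarrow>
       \<Phi> j (of_real (coord c y)) = of_real (snd d (\<phi> g (\<iota> y)) j)"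
    using local_extension[OF g c d(1)] d(2) ga unfolding s_def by metis
  obtain e2 \<Psi> where \<Psi>: "e2 > 0" "\<And>j. j < mdim M \<Longrightarrow> \<Psi> j holomorphic_on ball (of_real t) e2"
    "\<And>y. y \<in> fst c' \<Longrightarrow> \<bar>coord c' y - t\<bar> < e2 \<Longrightarrow> \<iota> y \<in> fst d"
    "\<And>y j. y \<in> fst c' \<Longrightarrow> \<bar>coord c' y - t\<bar> < e2 \<Longrightarrow> j < mdim M \<Longrightarrow>
       \<Psi> j (of_real (coord c' y)) = of_real (snd d (\<iota> y) j)"
    using local_extension_id[OF c' d] unfolding t_def by metis
  \<comment> \<open>Near \<open>t\<close> this coordinate function of \<iota> is invertible as a
    holomorphic function. Its inverse defines the reparametrization \<tau>.\<close>
  obtain j0 where j0: "j0 < mdim M" "deriv (\<Psi> j0) (of_real t) \<noteq> 0"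
    using immersion_deriv[OF c' _ d \<Psi>(1)] \<Psi>(2,4) t0 unfolding t_def by blast
  obtain e3 where e3: "e3 > 0" "\<And>u. u \<ge> 0 \<Longrightarrow> \<bar>u - t\<bar> < e3 \<Longrightarrow> u \<in> coord c' ` fst c'"
    using chart_nbhd[OF c' hc'(1) c'(2)] unfolding t_def by (metis IntD2 image_eqI)
  obtain e4 where e4: "e4 > 0" "\<And>u. u \<ge> 0 \<Longrightarrow> \<bar>u - s\<bar> < e4 \<Longrightarrow> u \<in> coord c ` fst c"
    using chart_nbhd[OF c hc(1) c(2)] unfolding s_def by (metis IntD2 image_eqI)
  \<comment> \<open>The bound by \<open>t\<close> keeps the real points of the disc nonnegative;
    with the bound by \<open>e3\<close> they are coordinates of points of S.\<close>
  define e5 where "e5 = min e2 (min e3 t)"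
  have e5: "e5 > 0" "e5 \<le> e2" "e5 \<le> e3" "e5 \<le> t" using \<Psi>(1) e3(1) t0 by (auto simp: e5_def)
  have "\<Psi> j0 holomorphic_on ball (of_real t) e5"
    using \<Psi>(2)[OF j0(1)] by (rule holomorphic_on_subset) (use e5 in auto)
  then obtain r where r: "r > 0" "ball (of_real t) r \<subseteq> ball (complex_of_real t) e5" "inj_on (\<Psi> j0) (ball (of_real t) r)"
    using has_complex_derivative_locally_injective[of "\<Psi> j0" "ball (of_real t) e5" "of_real t"] e5(1) j0(2) by auto
  have rr: "r \<le> e5" using r(1,2) by (simp add: ball_subset_ball_iff)
  let ?B = "ball (complex_of_real t) r" and ?W = "\<Psi> j0 ` ball (complex_of_real t) r"
  have hB: "\<Psi> j holomorphic_on ?B" if "j < mdim M" for j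
    using \<Psi>(2)[OF that] by (rule holomorphic_on_subset) (use rr e5 in auto)
  obtain \<tau>\<^sub>0 where \<tau>\<^sub>0: "\<tau>\<^sub>0 holomorphic_on ?W" "\<And>z. z \<in> ?B \<Longrightarrow> \<tau>\<^sub>0 (\<Psi> j0 z) = z"
    using holomorphic_has_inverse[OF hB[OF j0(1)] open_ball r(3)] by metis
  have oW: "open ?W" using open_mapping_thm3[OF hB[OF j0(1)] open_ball r(3)] .
  have cs: "continuous_on (ball (of_real s) e1) (\<Phi> j0)"
    using \<Phi>(2)[OF j0(1)] holomorphic_on_imp_continuous_on by blast
  have "\<Phi> j0 (of_real s) = \<Psi> j0 (of_real t)"
    using \<Phi>(4)[OF c(2) _ j0(1)] \<Psi>(4)[OF c'(2) _ j0(1)] \<Phi>(1) \<Psi>(1) ga by (simp add: s_def t_def)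
  then have "of_real s \<in> ball (of_real s) e1 \<inter> \<Phi> j0 -` ?W" using r(1) \<Phi>(1) by auto
  moreover have "open (ball (of_real s) e1 \<inter> \<Phi> j0 -` ?W)"
    using continuous_open_preimage[OF cs open_ball oW] .
  ultimately obtain e6 where e6: "e6 > 0" "ball (complex_of_real s) e6 \<subseteq> ball (of_real s) e1 \<inter> \<Phi> j0 -` ?W"
    using open_contains_ball by blast
  define e where "e = min (min e1 e6) (min e4 s)"
  have e: "e > 0" "e \<le> e1" "e \<le> e6" "e \<le> e4" "e \<le> s" using \<Phi>(1) e6(1) e4(1) s0 by (auto simp: e_def)
  let ?A = "ball (complex_of_real s) e"
  have A6: "?A \<subseteq> ball (complex_of_real s) e6" and A1: "?A \<subseteq> ball (complex_of_real s) e1" using e by auto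
  have hA: "\<Phi> j holomorphic_on ?A" if "j < mdim M" for j
    using \<Phi>(2)[OF that] A1 by (rule holomorphic_on_subset)
  define \<tau> where "\<tau> = \<tau>\<^sub>0 \<circ> \<Phi> j0"
  have \<Phi>W: "\<Phi> j0 ` ?A \<subseteq> ?W" using e6(2) A6 by blast
  have h\<tau>: "\<tau> holomorphic_on ?A"
    unfolding \<tau>_def using holomorphic_on_compose[OF hA[OF j0(1)] holomorphic_on_subset[OF \<tau>\<^sub>0(1) \<Phi>W]] .
  have \<tau>B: "\<tau> z \<in> ?B" if z: "z \<in> ?A" for z
  proof -
    obtain w where w: "w \<in> ?B" "\<Phi> j0 z = \<Psi> j0 w" using \<Phi>W z by blast
    then show ?thesis using \<tau>\<^sub>0(2)[OF w(1)] by (simp add: \<tau>_def)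
  qed
  have o1: "openin X {y \<in> fst c. \<bar>coord c y - s\<bar> < e}" and p1: "p a \<in> {y \<in> fst c. \<bar>coord c y - s\<bar> < e}"
    using coord_ball_open[OF c(1)] c(2) e(1) by (auto simp: s_def)
  obtain \<delta>1 where \<delta>1: "\<delta>1 > 0" "a + \<delta>1 \<le> b" "p ` {a..a+\<delta>1} \<subseteq> {y \<in> fst c. \<bar>coord c y - s\<bar> < e}"
    by (rule arc_into_chart[OF p o1 p1])
  have o2: "openin X {y \<in> fst c'. \<bar>coord c' y - t\<bar> < r}" and q2: "q a \<in> {y \<in> fst c'. \<bar>coord c' y - t\<bar> < r}"
    using coord_ball_open[OF c'(1)] c'(2) r(1) by (auto simp: t_def)
  obtain \<delta>2 where \<delta>2: "\<delta>2 > 0" "a + \<delta>2 \<le> b" "q ` {a..a+\<delta>2} \<subseteq> {y \<in> fst c'. \<bar>coord c' y - t\<bar> < r}"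
    by (rule arc_into_chart[OF q o2 q2])
  define \<delta> where "\<delta> = min \<delta>1 \<delta>2"
  have \<delta>: "\<delta> > 0" "a + \<delta> \<le> b" "\<delta> \<le> \<delta>1" "\<delta> \<le> \<delta>2" using \<delta>1(1,2) \<delta>2(1) by (auto simp: \<delta>_def)
  have pu: "p u \<in> fst c" "\<bar>coord c (p u) - s\<bar> < e" and qu: "q u \<in> fst c'" "\<bar>coord c' (q u) - t\<bar> < r"
    if "u \<in> {a..a+\<delta>}" for u
  proof -
    have "u \<in> {a..a+\<delta>1}" "u \<in> {a..a+\<delta>2}" using that \<delta> by auto
    then show "p u \<in> fst c" "\<bar>coord c (p u) - s\<bar> < e" "q u \<in> fst c'" "\<bar>coord c' (q u) - t\<bar> < r"
      using \<delta>1(3) \<delta>2(3) by blast+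
  qed
  have \<tau>p: "\<tau> (of_real (coord c (p u))) = of_real (coord c' (q u))" if u: "u \<in> {a..a+\<delta>}" for u
  proof -
    have "\<Phi> j0 (of_real (coord c (p u))) = of_real (snd d (\<phi> g (\<iota> (p u))) j0)"
      using \<Phi>(4)[OF pu(1)[OF u] _ j0(1)] pu(2)[OF u] e(2) by simp
    also have "\<dots> = of_real (snd d (\<iota> (q u)) j0)" using pq u \<delta>(2) by simp
    also have "\<dots> = \<Psi> j0 (of_real (coord c' (q u)))"
      using \<Psi>(4)[OF qu(1)[OF u] _ j0(1)] qu(2)[OF u] rr e5(2) by simp
    finally show ?thesis
      using \<tau>\<^sub>0(2)[of "of_real (coord c' (q u))"] qu(2)[OF u] unfolding \<tau>_def comp_def of_real_in_ball by simp
  qed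
  \<comment> \<open>On these points, the coordinates along the beginning of \<open>p\<close>, the
    relation between the two curves is known. Everything below is continued from them by the
    identity theorem.\<close>
  let ?U = "(\<lambda>u. complex_of_real (coord c (p u))) ` {a..a+\<delta>}"
  have UA: "?U \<subseteq> ?A" using pu(2) unfolding image_subset_iff of_real_in_ball by blast
  have sA: "complex_of_real s \<in> ?A" using e(1) by simp
  have lim: "complex_of_real s islimpt ?U"
  proof (rule connected_imp_perfect)
    have "continuous_map (top_of_set {a..a+\<delta>}) X p"
      using arcin_sub[OF p, of a "a + \<delta>"] \<delta> by (auto simp: arcin_def)
    then have "continuous_on {a..a+\<delta>} (\<lambda>u. coord c (p u))" using coord_comp_cont[OF c(1)] pu(1) by blast
    then show "connected ?U" by (intro connected_continuous_image continuous_intros) auto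
    show "complex_of_real s \<in> ?U" using \<delta>(1) by (intro image_eqI[of _ _ a]) (auto simp: s_def)
    show "?U \<noteq> {z}" for z
    proof
      assume z: "?U = {z}"
      have "a \<in> {a..a+\<delta>}" "a + \<delta> \<in> {a..a+\<delta>}" using \<delta>(1) by auto
      then have "complex_of_real (coord c (p a)) \<in> ?U" "complex_of_real (coord c (p (a + \<delta>))) \<in> ?U" by blast+
      then have "complex_of_real (coord c (p a)) = complex_of_real (coord c (p (a + \<delta>)))" unfolding z by simp
      then have "p a = p (a + \<delta>)" using coord_inj[OF c(1)] pu(1) \<delta>(1) by simp
      then show False using arcin_inj[OF p, of a "a + \<delta>"] \<delta> by simp
    qed
  qed
  \<comment> \<open>Where \<tau> is known it is real. There it coincides with its reflection in the
    real axis, hence on the whole disc.\<close>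
  have real\<tau>: "\<tau> (of_real u) = of_real (Re (\<tau> (of_real u)))" if u: "\<bar>u - s\<bar> < e" for u
  proof -
    have cA: "cnj ` ?A = ?A"
    proof -
      have "cnj z \<in> ?A" if "z \<in> ?A" for z
        using that complex_mod_cnj[of "of_real s - z"] by (simp add: dist_norm)
      then show ?thesis by (force intro: image_eqI[of _ cnj "cnj _"])
    qed
    have "\<tau> (of_real u) = (cnj \<circ> \<tau> \<circ> cnj) (of_real u)"
    proof (rule holomorphic_eq_on_ball[OF h\<tau> _ UA sA lim])
      show "cnj \<circ> \<tau> \<circ> cnj holomorphic_on ?A"
        using holomorphic_on_compose_cnj_cnj[of \<tau> ?A] h\<tau> unfolding cA by simp
      show "complex_of_real u \<in> ?A" using u unfolding of_real_in_ball .
      fix z assume "z \<in> ?U"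
      then obtain v where "v \<in> {a..a+\<delta>}" "z = of_real (coord c (p v))" by blast
      then show "\<tau> z = (cnj \<circ> \<tau> \<circ> cnj) z" using \<tau>p by simp
    qed
    then have "Im (\<tau> (of_real u)) = 0" by (simp add: complex_eq_iff)
    then show ?thesis by (simp add: complex_eq_iff)
  qed
  \<comment> \<open>\<tau> was built from one coordinate. That it relates the curves in all
    coordinates follows again from agreement on the known points.\<close>
  have \<Phi>\<Psi>: "\<Phi> j z = \<Psi> j (\<tau> z)" if j: "j < mdim M" and z: "z \<in> ?A" for j z
  proof -
    have "\<Phi> j z = (\<Psi> j \<circ> \<tau>) z"
    proof (rule holomorphic_eq_on_ball[OF hA[OF j] _ UA sA lim _ z])
      have "\<tau> ` ?A \<subseteq> ?B" using \<tau>B by blast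
      then show "\<Psi> j \<circ> \<tau> holomorphic_on ?A"
        using holomorphic_on_compose[OF h\<tau>] holomorphic_on_subset[OF hB[OF j]] by blast
      fix z assume "z \<in> ?U"
      then obtain v where v: "v \<in> {a..a+\<delta>}" "z = of_real (coord c (p v))" by blast
      have "\<Phi> j z = of_real (snd d (\<phi> g (\<iota> (p v))) j)"
        using \<Phi>(4)[OF pu(1)[OF v(1)] _ j] pu(2)[OF v(1)] e(2) v(2) by simp
      also have "\<dots> = of_real (snd d (\<iota> (q v)) j)" using pq v(1) \<delta>(2) by simp
      also have "\<dots> = \<Psi> j (of_real (coord c' (q v)))"
        using \<Psi>(4)[OF qu(1)[OF v(1)] _ j] qu(2)[OF v(1)] rr e5(2) by simp
      finally show "\<Phi> j z = (\<Psi> j \<circ> \<tau>) z" using \<tau>p[OF v(1)] v(2) by simp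
    qed
    then show ?thesis by simp
  qed
  \<comment> \<open>Half the radius, so that parameters from -1 to 1 stay strictly inside the
    disc.\<close>
  define \<eta> where "\<eta> = e / 2"
  define l where "l = (\<lambda>u. s + \<eta> * u)"
  define \<theta> where "\<theta> = (\<lambda>u. Re (\<tau> (of_real (l u))))"
  have l: "\<bar>l u - s\<bar> < e" if "u \<in> {-1..1}" for u
  proof -
    have "\<bar>\<eta> * u\<bar> \<le> \<eta> * 1" unfolding abs_mult \<eta>_def using e(1) that by (intro mult_mono) auto
    then show ?thesis using e(1) by (simp add: l_def \<eta>_def)
  qed
  have \<tau>l: "\<tau> (of_real (l u)) = of_real (\<theta> u)" if "u \<in> {-1..1}" for u
    using real\<tau>[OF l[OF that]] by (simp add: \<theta>_def)
  have lA: "complex_of_real (l u) \<in> ?A" if "u \<in> {-1..1}" for u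
    using l[OF that] unfolding of_real_in_ball .
  have \<theta>: "\<bar>\<theta> u - t\<bar> < r" if "u \<in> {-1..1}" for u
    using \<tau>B[OF lA[OF that]] unfolding \<tau>l[OF that] of_real_in_ball .
  have lr: "l u \<in> coord c ` fst c" if "u \<in> {-1..1}" for u
    by (rule e4(2)) (use l[OF that] e in auto)
  have \<theta>r: "\<theta> u \<in> coord c' ` fst c'" if "u \<in> {-1..1}" for u
    by (rule e3(2)) (use \<theta>[OF that] rr e5 in auto)
  have cl: "continuous_on {-1..1} l" unfolding l_def by (intro continuous_intros)
  have "continuous_on ((\<lambda>u. complex_of_real (l u)) ` {-1..1}) \<tau>"
    using holomorphic_on_imp_continuous_on[OF h\<tau>] lA by (meson continuous_on_subset image_subset_iff)
  then have "continuous_on {-1..1} (\<lambda>u. \<tau> (of_real (l u)))"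
    using continuous_on_compose[of "{-1..1}" "\<lambda>u. complex_of_real (l u)" \<tau>] cl continuous_on_of_real by (simp add: comp_def)
  then have c\<theta>: "continuous_on {-1..1} \<theta>" unfolding \<theta>_def by (intro continuous_intros)
  define P where "P = (\<lambda>u. inv_into (fst c) (coord c) (l u))"
  define Q where "Q = (\<lambda>u. inv_into (fst c') (coord c') (\<theta> u))"
  have P: "continuous_map (top_of_set {-1..1}) X P" "\<And>u. u \<in> {-1..1} \<Longrightarrow> P u \<in> fst c"
      "\<And>u. u \<in> {-1..1} \<Longrightarrow> coord c (P u) = l u"
    unfolding P_def by (use chart_inverse_cont[OF c(1) cl] lr in blast)+
  have Q: "continuous_map (top_of_set {-1..1}) X Q" "\<And>u. u \<in> {-1..1} \<Longrightarrow> Q u \<in> fst c'"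
      "\<And>u. u \<in> {-1..1} \<Longrightarrow> coord c' (Q u) = \<theta> u"
    unfolding Q_def by (use chart_inverse_cont[OF c'(1) c\<theta>] \<theta>r in blast)+
  have PS: "P u \<in> points S" and QS: "Q u \<in> points S" if "u \<in> {-1..1}" for u
    using P(2)[OF that] Q(2)[OF that] hc(4) hc'(4) by blast+
  have PQ: "\<phi> g (\<iota> (P u)) = \<iota> (Q u)" if u: "u \<in> {-1..1}" for u
  proof (rule chart_coords_eq[OF d(1)])
    have 1: "\<bar>coord c (P u) - s\<bar> < e1" using P(3)[OF u] l[OF u] e(2) by simp
    have 2: "\<bar>coord c' (Q u) - t\<bar> < e2" using Q(3)[OF u] \<theta>[OF u] rr e5(2) by simp
    show "\<phi> g (\<iota> (P u)) \<in> fst d" using \<Phi>(3)[OF P(2)[OF u] 1] .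
    show "\<iota> (Q u) \<in> fst d" using \<Psi>(3)[OF Q(2)[OF u] 2] .
    fix j assume j: "j < mdim M"
    have "complex_of_real (snd d (\<phi> g (\<iota> (P u))) j) = \<Phi> j (of_real (l u))"
      using \<Phi>(4)[OF P(2)[OF u] 1 j] P(3)[OF u] by simp
    also have "\<dots> = \<Psi> j (of_real (\<theta> u))" using \<Phi>\<Psi>[OF j lA[OF u]] \<tau>l[OF u] by simp
    also have "\<dots> = of_real (snd d (\<iota> (Q u)) j)" using \<Psi>(4)[OF Q(2)[OF u] 2 j] Q(3)[OF u] by simp
    finally show "snd d (\<phi> g (\<iota> (P u))) j = snd d (\<iota> (Q u)) j" by simp
  qed
  have Pinj: "u = v" if "u \<in> {-1..1}" "v \<in> {-1..1}" "P u = P v" for u v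
  proof -
    have "l u = l v" using P(3)[OF that(1)] P(3)[OF that(2)] that(3) by metis
    then show ?thesis using e(1) by (simp add: l_def \<eta>_def)
  qed
  \<comment> \<open>Injectivity passes from \<open>P\<close> to \<open>Q\<close> because both
    \<iota> and the translation are injective.\<close>
  have Qinj: "u = v" if "u \<in> {-1..1}" "v \<in> {-1..1}" "Q u = Q v" for u v
  proof (rule Pinj[OF that(1,2)])
    have "\<phi> g (\<iota> (P u)) = \<phi> g (\<iota> (P v))" using PQ[OF that(1)] PQ[OF that(2)] that(3) by metis
    then show "P u = P v"
      using \<phi>_eq_iff[OF g \<iota>_in[OF PS[OF that(1)]] \<iota>_in[OF PS[OF that(2)]]]
        \<iota>_eq_iff[OF PS[OF that(1)] PS[OF that(2)]] by blast
  qed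
  show thesis
  proof (rule that[of P Q])
    show "arcin X (points S) (-1) 1 P"
      using P(1) PS Pinj unfolding arcin_def by (auto simp: inj_on_def)
    show "arcin X (points S) (-1) 1 Q"
      using Q(1) QS Qinj unfolding arcin_def by (auto simp: inj_on_def)
    show "P 0 = p a" using P(2,3)[of 0] c coord_inj[OF c(1)] by (simp add: l_def s_def)
    have "\<theta> 0 = t" using \<tau>p[of a] \<delta>(1) by (simp add: \<theta>_def l_def s_def t_def)
    then show "Q 0 = q a" using Q(2,3)[of 0] c' coord_inj[OF c'(1)] by (simp add: t_def)
  qed (use PQ in blast)
qed

end

section \<open>Overlaps and boundary classes\<close>

text \<open>Either \<open>f\<close> drops below \<open>m\<close> somewhere inside and stays there
  nearby, or it never does and the middle third will do.\<close>

lemma continuous_locally_one_sided: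
  fixes f :: "real \<Rightarrow> real"
  assumes f: "continuous_on {c..d} f" and cd: "c < d"
  obtains c' d' where "c \<le> c'" "c' < d'" "d' \<le> d"
    "(\<forall>t\<in>{c'..d'}. f t \<le> m) \<or> (\<forall>t\<in>{c'..d'}. m \<le> f t)"
proof (cases "\<exists>t\<in>{c<..<d}. f t < m")
  case True
  then obtain t where t: "t \<in> {c<..<d}" "f t < m" by blast
  obtain e where e: "e > 0" "\<And>u. u \<in> {c..d} \<Longrightarrow> dist u t < e \<Longrightarrow> dist (f u) (f t) < m - f t"
    using f t unfolding continuous_on_iff by (metis diff_gt_0_iff_gt greaterThanLessThan_subseteq_atLeastAtMost_iff order_refl subsetD)
  define d' where "d' = min d (t + e / 2)"
  have d': "t < d'" "d' \<le> d" "d' < t + e" using t(1) e(1) by (auto simp: d'_def)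
  have "f u \<le> m" if "u \<in> {t..d'}" for u
  proof -
    have "dist (f u) (f t) < m - f t" using e(2)[of u] that d' t(1) by (auto simp: dist_real_def)
    then show ?thesis by (simp add: dist_real_def abs_less_iff)
  qed
  then show thesis using that[of t d'] d' t(1) by auto
next
  case False
  then show thesis using that[of "(2 * c + d) / 3" "(c + 2 * d) / 3"] cd by (auto simp: not_less)
qed

context acted_curve
begin

text \<open>An injective continuous map from a compact set into a Hausdorff space is an embedding.
  This settles embeddedness wherever arcs are concerned.\<close>

lemma compact_embedded:
  assumes C: "compactin X C" and E: "E \<subseteq> C"
  shows "embedded M S \<iota> E"
proof -
  have CX: "C \<subseteq> points S" using C by (simp add: compactin_subspace)
  have "embedding_map (subtopology X C) (mtop M) \<iota>"
  proof (rule continuous_imp_embedding_map)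
    show "continuous_map (subtopology X C) (mtop M) \<iota>" using \<iota>_cont by (rule continuous_map_from_subtopology)
    show "compact_space (subtopology X C)" using C by (simp add: compactin_subspace)
    show "inj_on \<iota> (topspace (subtopology X C))" using \<iota>_inj by (rule inj_on_subset) auto
  qed (rule M_haus)
  then have h: "homeomorphic_map (subtopology X C) (subtopology (mtop M) (\<iota> ` C)) \<iota>"
    using CX by (simp add: embedding_map_def Int_absorb1)
  have "homeomorphic_map (subtopology (subtopology X C) E) (subtopology (subtopology (mtop M) (\<iota> ` C)) (\<iota> ` E)) \<iota>"
    by (rule homeomorphic_map_subtopologies[OF h]) (use E CX \<iota>_in in auto)
  then show ?thesis
    using E CX unfolding embedded_def embedding_map_def
    by (simp add: subtopology_subtopology Int_absorb1 image_mono subset_trans[OF E CX])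
qed

text \<open>The image of an injective immersion may accumulate at itself, so a path in \<iota>(S)
  need not lift continuously. Embeddedness of \<open>D\<close> is what makes the lift
  continuous.\<close>

lemma embedded_lift:
  assumes emb: "embedded M S \<iota> D" and D: "D \<subseteq> points S"
    and \<gamma>: "continuous_map (top_of_set I) (mtop M) \<gamma>" "\<gamma> ` I \<subseteq> \<iota> ` D"
  obtains q where "continuous_map (top_of_set I) X q" "q ` I \<subseteq> D" "\<And>t. t \<in> I \<Longrightarrow> \<iota> (q t) = \<gamma> t"
proof -
  have "homeomorphic_map (subtopology X D) (subtopology (mtop M) (\<iota> ` D)) \<iota>"
    using emb D by (simp add: embedded_def embedding_map_def Int_absorb1)
  then obtain k where k: "homeomorphic_maps (subtopology X D) (subtopology (mtop M) (\<iota> ` D)) \<iota> k"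
    using homeomorphic_map_maps by blast
  have \<gamma>c: "continuous_map (top_of_set I) (subtopology (mtop M) (\<iota> ` D)) \<gamma>"
    using \<gamma> by (auto simp: continuous_map_in_subtopology)
  have "continuous_map (subtopology (mtop M) (\<iota> ` D)) (subtopology X D) k"
    using k by (simp add: homeomorphic_maps_def)
  then have kc: "continuous_map (top_of_set I) (subtopology X D) (k \<circ> \<gamma>)"
    using \<gamma>c continuous_map_compose by blast
  have "(k \<circ> \<gamma>) ` I \<subseteq> D"
    using continuous_map_image_subset_topspace[OF kc] D by auto
  moreover have "\<iota> ((k \<circ> \<gamma>) t) = \<gamma> t" if "t \<in> I" for t
  proof -
    have "\<gamma> t \<in> topspace (subtopology (mtop M) (\<iota> ` D))"
      using continuous_map_image_subset_topspace[OF \<gamma>c] that by auto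
    then show ?thesis using k by (auto simp: homeomorphic_maps_def)
  qed
  moreover have "continuous_map (top_of_set I) X (k \<circ> \<gamma>)"
    using kc by (simp add: continuous_map_in_subtopology)
  ultimately show thesis using that by blast
qed

lemma translate_cont:
  assumes "g \<in> carrier G" "continuous_map (top_of_set I) X p"
  shows "continuous_map (top_of_set I) (mtop M) (\<lambda>t. \<phi> g (\<iota> (p t)))"
  using continuous_map_compose[OF continuous_map_compose[OF assms(2) \<iota>_cont] \<phi>_cont[OF assms(1)]]
  by (simp add: comp_def)

lemma translate_inj:
  assumes "g \<in> carrier G" "x \<in> points S" "y \<in> points S" "\<phi> g (\<iota> x) = \<phi> g (\<iota> y)"
  shows "x = y"
  using assms \<phi>_eq_iff \<iota>_eq_iff \<iota>_in by metis

text \<open>Lets a group element act on arcs of S itself instead of curves in M.\<close>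

lemma transport:
  assumes g: "g \<in> carrier G" and p: "arcin X C a b p" and D: "embedded M S \<iota> D" "D \<subseteq> points S"
    and im: "\<And>t. t \<in> {a..b} \<Longrightarrow> \<phi> g (\<iota> (p t)) \<in> \<iota> ` D"
  obtains q where "arcin X D a b q" "\<And>t. t \<in> {a..b} \<Longrightarrow> \<phi> g (\<iota> (p t)) = \<iota> (q t)"
proof -
  have pc: "continuous_map (top_of_set {a..b}) X p" using p by (simp add: arcin_def)
  have "(\<lambda>t. \<phi> g (\<iota> (p t))) ` {a..b} \<subseteq> \<iota> ` D" using im by blast
  then obtain q where q: "continuous_map (top_of_set {a..b}) X q" "q ` {a..b} \<subseteq> D"
      "\<And>t. t \<in> {a..b} \<Longrightarrow> \<iota> (q t) = \<phi> g (\<iota> (p t))"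
    using embedded_lift[OF D translate_cont[OF g pc]] by metis
  have "inj_on q {a..b}"
  proof (rule inj_onI)
    fix t u assume tu: "t \<in> {a..b}" "u \<in> {a..b}" "q t = q u"
    then have "\<phi> g (\<iota> (p t)) = \<phi> g (\<iota> (p u))" using q(3)[OF tu(1)] q(3)[OF tu(2)] by simp
    then have "p t = p u" using translate_inj[OF g] arcin_topspace[OF p] tu by blast
    then show "t = u" using arcin_inj[OF p tu(1,2)] by blast
  qed
  then have "arcin X D a b q" using q p by (simp add: arcin_def)
  then show thesis using that q(3) by metis
qed

lemma segments_arc: "arcin X C a b p \<Longrightarrow> p ` {a..b} \<in> segments S"
proof -
  assume p: "arcin X C a b p"
  have "a < b" using p by (simp add: arcin_def)
  moreover from this have "p a \<noteq> p b" using arcin_inj[OF p, of a b] by auto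
  ultimately show ?thesis using arcin_connectedin[OF p] unfolding segments_def by fastforce
qed

lemma segment_arc:
  assumes "A \<in> segments S"
  obtains p where "arcin X A 0 1 p"
proof -
  obtain x y where "connectedin X A" "x \<in> A" "y \<in> A" "x \<noteq> y"
    using assms unfolding segments_def by blast
  then show thesis using arc_between that by metis
qed

text \<open>With the converse \<open>arcs_overlap\<close> this trades open embedded segments for two
  arcs with a common parameter, which can be restricted, reversed and composed.\<close>

lemma overlap_arcs:
  assumes g: "g \<in> carrier G" and o: "overlap M \<phi> S \<iota> g A A'"
  obtains p q where "arcin X A 0 1 p" "arcin X A' 0 1 q" "\<And>t. t \<in> {0..1} \<Longrightarrow> \<phi> g (\<iota> (p t)) = \<iota> (q t)"
proof -
  obtain O1 O2 where O: "O1 \<in> segments S" "O2 \<in> segments S" "O1 \<subseteq> A" "O2 \<subseteq> A'"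
      "embedded M S \<iota> O2" "\<phi> g ` \<iota> ` O1 = \<iota> ` O2" "openin X O2"
    using o unfolding overlap_def by blast
  obtain p where p: "arcin X O1 0 1 p" using segment_arc[OF O(1)] by blast
  have im: "\<phi> g (\<iota> (p t)) \<in> \<iota> ` O2" if "t \<in> {0..1}" for t
  proof -
    have "p t \<in> O1" using p that by (auto simp: arcin_def)
    then show ?thesis using O(6) by blast
  qed
  obtain q where "arcin X O2 0 1 q" "\<And>t. t \<in> {0..1} \<Longrightarrow> \<phi> g (\<iota> (p t)) = \<iota> (q t)"
    using transport[OF g p O(5) openin_subset[OF O(7)] im] by blast
  then show thesis using that arcin_mono[OF p O(3)] arcin_mono O(4) by blast
qed

text \<open>Open parameter intervals restore what the definition asks for: their images are open in
  S, and they lie in compact arcs, on which \<iota> is an embedding.\<close>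

lemma arcs_overlap:
  assumes p: "arcin X A a b p" and q: "arcin X A' a b q"
    and eq: "\<And>t. t \<in> {a..b} \<Longrightarrow> \<phi> g (\<iota> (p t)) = \<iota> (q t)"
  shows "overlap M \<phi> S \<iota> g A A'"
proof -
  have ab: "a < b" using p by (simp add: arcin_def)
  have seg: "r ` {a<..<b} \<in> segments S" if r: "arcin X C a b r" for r C
  proof -
    have "connectedin (top_of_set {a..b}) {a<..<b}" by (auto simp: connectedin_subtopology)
    then have "connectedin X (r ` {a<..<b})"
      using r connectedin_continuous_map_image unfolding arcin_def by blast
    moreover have "r ((2 * a + b) / 3) \<noteq> r ((a + 2 * b) / 3)"
      using arcin_inj[OF r, of "(2 * a + b) / 3" "(a + 2 * b) / 3"] ab by auto
    moreover have "(2 * a + b) / 3 \<in> {a<..<b}" "(a + 2 * b) / 3 \<in> {a<..<b}" using ab by auto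
    ultimately show ?thesis unfolding segments_def by blast
  qed
  have emb: "embedded M S \<iota> (r ` {a<..<b})" and sub: "r ` {a<..<b} \<subseteq> C" if r: "arcin X C a b r" for r C
  proof -
    have i: "r ` {a<..<b} \<subseteq> r ` {a..b}" by (intro image_mono) auto
    then show "embedded M S \<iota> (r ` {a<..<b})" by (rule compact_embedded[OF arcin_compactin[OF r]])
    show "r ` {a<..<b} \<subseteq> C" using i r by (auto simp: arcin_def)
  qed
  have "\<phi> g ` \<iota> ` p ` {a<..<b} = \<iota> ` q ` {a<..<b}"
    unfolding image_image using eq by (intro image_cong) auto
  then show ?thesis
    unfolding overlap_def using seg[OF p] seg[OF q] arc_open[OF p] arc_open[OF q] sub[OF p] sub[OF q] emb[OF p] emb[OF q]
    by blast
qed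

section \<open>Freeness tested on arcs\<close>

abbreviation "Free \<equiv> free_segments G M \<phi> S \<iota>"

lemma free_arcs:
  assumes "A \<in> Free" "g \<in> carrier G" "arcin X A a b p" "arcin X A a b q"
    "\<And>t. t \<in> {a..b} \<Longrightarrow> \<phi> g (\<iota> (p t)) = \<iota> (q t)"
  shows "g \<in> H"
  using assms(1,2) arcs_overlap[OF assms(3-5)] unfolding free_segments_def by blast

text \<open>One implication is enough: an element of the stabilizer overlaps every segment with
  itself, through any arc in it.\<close>

lemma freeI:
  assumes A: "A \<in> segments S"
    and *: "\<And>g p q. g \<in> carrier G \<Longrightarrow> arcin X A 0 1 p \<Longrightarrow> arcin X A 0 1 q \<Longrightarrow>
       (\<And>t. t \<in> {0..1} \<Longrightarrow> \<phi> g (\<iota> (p t)) = \<iota> (q t)) \<Longrightarrow> g \<in> H"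
  shows "A \<in> Free"
proof -
  have "g \<in> H" if "g \<in> carrier G" "overlap M \<phi> S \<iota> g A A" for g
    using overlap_arcs[OF that] * that(1) by metis
  moreover have "overlap M \<phi> S \<iota> g A A" if "g \<in> H" for g
  proof -
    obtain p where p: "arcin X A 0 1 p" using segment_arc[OF A] by blast
    have "\<phi> g (\<iota> (p t)) = \<iota> (p t)" if "t \<in> {0..1}" for t
      using \<open>g \<in> H\<close> arcin_topspace[OF p] that unfolding H_iff by blast
    then show ?thesis using arcs_overlap[OF p p] by blast
  qed
  ultimately show ?thesis using A unfolding free_segments_def by blast
qed

lemma inv_closed: "g \<in> carrier G \<Longrightarrow> inv\<^bsub>G\<^esub> g \<in> carrier G"
  using grp by (simp add: group.inv_closed)

lemma mult_closed: "g \<in> carrier G \<Longrightarrow> h \<in> carrier G \<Longrightarrow> g \<otimes>\<^bsub>G\<^esub> h \<in> carrier G"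
  using grp by (simp add: group.is_monoid monoid.m_closed)

text \<open>
  Freeness gives only \<open>g\<^sup>-\<^sup>1 h g \<in> H\<close>, and \<open>H\<close> need not be normal. But then \<open>h\<close> fixes the arc \<open>\<iota> \<circ> p\<close>, hence all
  of \<open>\<iota>(S)\<close> by the identity principle.
\<close>

lemma translate_free:
  assumes A: "A \<in> Free" and g: "g \<in> carrier G" and \<alpha>: "arcin X A a b \<alpha>" and \<beta>: "arcin X C a b \<beta>"
    and eq: "\<And>t. t \<in> {a..b} \<Longrightarrow> \<phi> g (\<iota> (\<alpha> t)) = \<iota> (\<beta> t)"
    and h: "h \<in> carrier G" and p: "arcin X (\<beta> ` {a..b}) c d p" and q: "arcin X (\<beta> ` {a..b}) c d q"
    and pq: "\<And>t. t \<in> {c..d} \<Longrightarrow> \<phi> h (\<iota> (p t)) = \<iota> (q t)"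
  shows "h \<in> H"
proof -
  have lift: "\<exists>f. arcin X A c d (\<lambda>t. \<alpha> (f t)) \<and> (\<forall>t\<in>{c..d}. f t \<in> {a..b} \<and> \<beta> (f t) = r t)"
    if r: "arcin X (\<beta> ` {a..b}) c d r" for r
  proof -
    obtain f where f: "continuous_on {c..d} f" "inj_on f {c..d}" "\<And>t. t \<in> {c..d} \<Longrightarrow> f t \<in> {a..b}"
        "\<And>t. t \<in> {c..d} \<Longrightarrow> \<beta> (f t) = r t"
      using arc_factor[OF \<beta> r] by blast
    then have im: "f ` {c..d} \<subseteq> {a..b}" by blast
    have "arcin X (\<alpha> ` f ` {c..d}) c d (\<alpha> \<circ> f)" using arcin_comp[OF \<alpha> f(1,2) im] r by (simp add: arcin_def)
    moreover have "\<alpha> ` f ` {c..d} \<subseteq> A" using im \<alpha> unfolding arcin_def by blast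
    ultimately have "arcin X A c d (\<lambda>t. \<alpha> (f t))" using arcin_mono unfolding comp_def by blast
    moreover have "\<forall>t\<in>{c..d}. f t \<in> {a..b} \<and> \<beta> (f t) = r t" using f(3,4) by blast
    ultimately show ?thesis by blast
  qed
  obtain f where f: "arcin X A c d (\<lambda>t. \<alpha> (f t))" "\<And>t. t \<in> {c..d} \<Longrightarrow> f t \<in> {a..b} \<and> \<beta> (f t) = p t"
    using lift[OF p] by blast
  obtain f' where f': "arcin X A c d (\<lambda>t. \<alpha> (f' t))" "\<And>t. t \<in> {c..d} \<Longrightarrow> f' t \<in> {a..b} \<and> \<beta> (f' t) = q t"
    using lift[OF q] by blast
  \<comment> \<open>\<open>h\<close> carried back to \<open>A\<close> by \<open>g\<close>; it takes
    one arc of \<open>A\<close> to another.\<close>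
  let ?k = "inv\<^bsub>G\<^esub> g \<otimes>\<^bsub>G\<^esub> (h \<otimes>\<^bsub>G\<^esub> g)"
  have k: "?k \<in> carrier G" using g h inv_closed mult_closed by simp
  have kx: "\<phi> ?k (\<iota> x) = \<phi> (inv\<^bsub>G\<^esub> g) (\<phi> h (\<phi> g (\<iota> x)))" if "x \<in> points S" for x
    using that g h inv_closed mult_closed by (simp add: \<phi>_mult \<iota>_in \<phi>_in)
  have \<alpha>S: "\<alpha> u \<in> points S" if "u \<in> {a..b}" for u using arcin_topspace[OF \<alpha>] that by blast
  have "\<phi> ?k (\<iota> (\<alpha> (f t))) = \<iota> (\<alpha> (f' t))" if t: "t \<in> {c..d}" for t
  proof -
    have "\<phi> h (\<phi> g (\<iota> (\<alpha> (f t)))) = \<phi> g (\<iota> (\<alpha> (f' t)))"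
      using eq f(2)[OF t] f'(2)[OF t] pq[OF t] by simp
    then show ?thesis using kx \<alpha>S f(2)[OF t] f'(2)[OF t] \<phi>_inv[OF g] \<iota>_in by metis
  qed
  then have kH: "?k \<in> H" using free_arcs[OF A k f(1) f'(1)] by blast
  show ?thesis
  proof (rule stab_identity[OF h p])
    fix t assume t: "t \<in> {c..d}"
    have x: "\<alpha> (f t) \<in> points S" using \<alpha>S f(2)[OF t] by blast
    have "\<phi> (inv\<^bsub>G\<^esub> g) (\<phi> h (\<phi> g (\<iota> (\<alpha> (f t))))) = \<iota> (\<alpha> (f t))"
      using kH x kx[OF x] unfolding H_iff by metis
    then have "\<phi> h (\<phi> g (\<iota> (\<alpha> (f t)))) = \<phi> g (\<iota> (\<alpha> (f t)))"
      using \<phi>_inv'[OF g] \<phi>_in[OF h] \<phi>_in[OF g] \<iota>_in[OF x] by metis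
    moreover have "\<phi> g (\<iota> (\<alpha> (f t))) = \<iota> (p t)" using eq f(2)[OF t] by simp
    ultimately show "\<phi> h (\<iota> (p t)) = \<iota> (p t)" by simp
  qed
qed

section \<open>Cosets as restrictions to the image of S, and the boundary class\<close>

lemma cls_iff:
  assumes "g \<in> carrier G"
  shows "x \<in> cls G \<phi> S \<iota> g \<longleftrightarrow> x \<in> carrier G \<and> (\<forall>z\<in>points S. \<phi> x (\<iota> z) = \<phi> g (\<iota> z))"
proof
  assume "x \<in> cls G \<phi> S \<iota> g"
  then obtain h where h: "h \<in> H" "x = g \<otimes>\<^bsub>G\<^esub> h" unfolding cls_def l_coset_def by blast
  then show "x \<in> carrier G \<and> (\<forall>z\<in>points S. \<phi> x (\<iota> z) = \<phi> g (\<iota> z))"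
    using assms mult_closed \<phi>_mult \<iota>_in unfolding H_iff by simp
next
  assume x: "x \<in> carrier G \<and> (\<forall>z\<in>points S. \<phi> x (\<iota> z) = \<phi> g (\<iota> z))"
  let ?h = "inv\<^bsub>G\<^esub> g \<otimes>\<^bsub>G\<^esub> x"
  have "?h \<in> H" unfolding H_iff
    using x assms mult_closed inv_closed \<phi>_mult \<iota>_in \<phi>_inv by simp
  moreover have "x = g \<otimes>\<^bsub>G\<^esub> ?h"
  proof -
    have mon: "monoid G" using grp by (rule group.is_monoid)
    have xG: "x \<in> carrier G" using x by blast
    have "g \<otimes>\<^bsub>G\<^esub> ?h = (g \<otimes>\<^bsub>G\<^esub> inv\<^bsub>G\<^esub> g) \<otimes>\<^bsub>G\<^esub> x"
      by (rule monoid.m_assoc[OF mon assms inv_closed[OF assms] xG, symmetric])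
    also have "\<dots> = x"
      unfolding group.r_inv[OF grp assms] by (rule monoid.l_one[OF mon xG])
    finally show ?thesis by (rule sym)
  qed
  ultimately show "x \<in> cls G \<phi> S \<iota> g" unfolding cls_def l_coset_def by blast
qed

lemma cls_self: "g \<in> carrier G \<Longrightarrow> g \<in> cls G \<phi> S \<iota> g"
  by (simp add: cls_iff)

lemma cls_eqI:
  assumes "g \<in> carrier G" "h \<in> carrier G" "\<And>z. z \<in> points S \<Longrightarrow> \<phi> g (\<iota> z) = \<phi> h (\<iota> z)"
  shows "cls G \<phi> S \<iota> g = cls G \<phi> S \<iota> h"
  unfolding set_eq_iff cls_iff[OF assms(1)] cls_iff[OF assms(2)] using assms(3) by metis

lemma lcosets_cls:
  assumes "c \<in> lcosets\<^bsub>G\<^esub> H" "g \<in> c"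
  shows "g \<in> carrier G" "c = cls G \<phi> S \<iota> g"
proof -
  obtain r where r: "r \<in> carrier G" "c = cls G \<phi> S \<iota> r"
    using assms(1) unfolding LCOSETS_def cls_def by blast
  then show "g \<in> carrier G" using assms(2) cls_iff by blast
  moreover have "\<phi> g (\<iota> z) = \<phi> r (\<iota> z)" if "z \<in> points S" for z
    using assms(2) r cls_iff that by blast
  ultimately show "c = cls G \<phi> S \<iota> g" using r cls_eqI by blast
qed

lemma cls_lcosets: "g \<in> carrier G \<Longrightarrow> cls G \<phi> S \<iota> g \<in> lcosets\<^bsub>G\<^esub> H"
  unfolding LCOSETS_def cls_def by blast

text \<open>
  If \<open>g\<close> folded \<open>A\<close> outward at its end \<open>a(1)\<close>, its class would be the boundary class of \<open>A\<close> there, although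
  it fixes \<open>\<iota>(a(1))\<close>: this contradicts positivity.
\<close>

lemma positive_outward:
  assumes a: "arcin X A 0 1 a" "a ` {0..1} = A" and A: "A \<in> Free"
    and pos: "positive_segment G M \<phi> S \<iota> A" and zint: "a 1 \<in> seg_int S (points S)"
    and g: "g \<in> carrier G" and b: "arcin X C 0 \<delta> b" and b0: "b 0 = a 1" and \<delta>: "\<delta> \<le> 1"
    and out: "\<And>t. 0 < t \<Longrightarrow> t \<le> \<delta> \<Longrightarrow> b t \<notin> A"
    and eq: "\<And>t. t \<in> {0..\<delta>} \<Longrightarrow> \<phi> g (\<iota> (a (1 - t))) = \<iota> (b t)"
  shows False
proof -
  let ?z = "a 1"
  have \<delta>0: "\<delta> > 0" using b by (simp add: arcin_def)
  \<comment> \<open>\<open>A\<close> traversed backwards from \<open>a 1\<close>, in step with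
    \<open>b\<close>.\<close>
  define \<alpha> where "\<alpha> = (\<lambda>t. a (1 - t))"
  have \<alpha>: "arcin X A 0 \<delta> \<alpha>"
    using arcin_affine[OF a(1), of "-1" 0 \<delta> 1] \<delta> \<delta>0 a(2) by (simp add: \<alpha>_def)
  have eq\<alpha>: "\<phi> g (\<iota> (\<alpha> t)) = \<iota> (b t)" if "t \<in> {0..\<delta>}" for t
    using eq[OF that] by (simp add: \<alpha>_def)
  define K1 where "K1 = \<alpha> ` {0..\<delta>}"
  define K2 where "K2 = b ` {0..\<delta>}"
  have aS: "a t \<in> points S" if "t \<in> {0..1}" for t using arcin_topspace[OF a(1)] that by blast
  have \<alpha>S: "\<alpha> t \<in> points S" if "t \<in> {0..\<delta>}" for t using arcin_topspace[OF \<alpha>] that by blast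
  have b\<delta>: "b \<delta> \<notin> A" using out \<delta>0 by simp
  have bdA: "seg_bd S A = {a 0, a 1}" using seg_bd_arc[OF ll a(1)] a(2) by simp
  have K2F: "K2 \<in> Free"
  proof (rule freeI)
    show "K2 \<in> segments S" unfolding K2_def by (rule segments_arc[OF b])
    show "h \<in> H" if "h \<in> carrier G" "arcin X K2 0 1 p" "arcin X K2 0 1 q"
      "\<And>t. t \<in> {0..1} \<Longrightarrow> \<phi> h (\<iota> (p t)) = \<iota> (q t)" for h p q
      using translate_free[OF A g \<alpha> b eq\<alpha> that(1)] that(2-4) unfolding K2_def by blast
  qed
  \<comment> \<open>The property that singles out \<open>bd_class\<close> at \<open>a 1\<close>. The
    class is a definite description, so uniqueness has to be shown along with existence.\<close>
  let ?Q = "\<lambda>c. c \<in> lcosets\<^bsub>G\<^esub> H \<and> c \<noteq> cls G \<phi> S \<iota> \<one>\<^bsub>G\<^esub> \<and>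
        (\<exists>g\<in>c. \<exists>A\<^sub>b \<in> segments S. \<exists>b. \<exists>A\<^sub>z \<in> Free.
           compactin (mtop S) A\<^sub>b \<and> A\<^sub>b \<subseteq> A \<and> b \<in> seg_bd S A \<inter> seg_bd S A\<^sub>b \<and>
           compactin (mtop S) A\<^sub>z \<and> A \<inter> A\<^sub>z = {?z} \<and> seg_bd S A \<inter> seg_bd S A\<^sub>z = {?z} \<and>
           \<phi> g ` \<iota> ` A\<^sub>b = \<iota> ` A\<^sub>z \<and> \<phi> g (\<iota> b) = \<iota> ?z)"
  have bd: "bd_class G M \<phi> S \<iota> A ?z = (THE c. ?Q c)" unfolding bd_class_def ..
  have Qg: "?Q (cls G \<phi> S \<iota> g)"
  proof (intro conjI)
    show "cls G \<phi> S \<iota> g \<in> lcosets\<^bsub>G\<^esub> H" by (rule cls_lcosets[OF g])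
    show "cls G \<phi> S \<iota> g \<noteq> cls G \<phi> S \<iota> \<one>\<^bsub>G\<^esub>"
    proof
      assume "cls G \<phi> S \<iota> g = cls G \<phi> S \<iota> \<one>\<^bsub>G\<^esub>"
      then have "g \<in> cls G \<phi> S \<iota> \<one>\<^bsub>G\<^esub>" using cls_self[OF g] by simp
      then have "\<phi> g (\<iota> (\<alpha> \<delta>)) = \<iota> (\<alpha> \<delta>)"
        using cls_iff[OF one_closed] \<alpha>S[of \<delta>] \<phi>_one \<iota>_in \<delta>0 by simp
      then have "\<iota> (\<alpha> \<delta>) = \<iota> (b \<delta>)" using eq\<alpha>[of \<delta>] \<delta>0 by simp
      moreover have "\<alpha> \<delta> \<in> points S" "b \<delta> \<in> points S"
        using \<alpha>S[of \<delta>] arcin_topspace[OF b] \<delta>0 by (auto simp: image_subset_iff)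
      ultimately have "b \<delta> = \<alpha> \<delta>" using \<iota>_eq_iff by simp
      moreover have "\<alpha> \<delta> \<in> A" using \<alpha> \<delta>0 by (auto simp: arcin_def image_subset_iff)
      ultimately show False using b\<delta> by simp
    qed
    have 1: "K1 \<in> segments S" unfolding K1_def by (rule segments_arc[OF \<alpha>])
    have 2: "compactin X K1" unfolding K1_def by (rule arcin_compactin[OF \<alpha>])
    have 3: "K1 \<subseteq> A" using \<alpha> by (simp add: K1_def arcin_def)
    have 4: "?z \<in> seg_bd S A \<inter> seg_bd S K1"
      using bdA seg_bd_arc[OF ll \<alpha>] by (simp add: K1_def \<alpha>_def)
    have 5: "compactin X K2" unfolding K2_def by (rule arcin_compactin[OF b])
    have zA: "?z \<in> A" using a(2) by force
    have zK: "?z \<in> K2" using b0 \<delta>0 unfolding K2_def by (intro image_eqI[of _ _ 0]) auto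
    have 6: "A \<inter> K2 = {?z}"
    proof -
      have "x = ?z" if x: "x \<in> A" "x \<in> K2" for x
      proof -
        obtain t where t: "t \<in> {0..\<delta>}" "x = b t" using x(2) by (auto simp: K2_def)
        then have "t = 0" using out[of t] x(1) by force
        then show ?thesis using t b0 by simp
      qed
      then show ?thesis using zA zK by blast
    qed
    have 7: "seg_bd S A \<inter> seg_bd S K2 = {?z}"
    proof -
      have "seg_bd S K2 = {b 0, b \<delta>}" unfolding K2_def by (rule seg_bd_arc[OF ll b])
      moreover have "a 0 \<in> A" using a(2) by force
      ultimately show ?thesis using bdA b0 b\<delta> 6 zA by auto
    qed
    have 8: "\<phi> g ` \<iota> ` K1 = \<iota> ` K2"
      unfolding K1_def K2_def image_image using eq\<alpha> by (intro image_cong) auto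
    have 9: "\<phi> g (\<iota> ?z) = \<iota> ?z" using eq\<alpha>[of 0] \<delta>0 b0 by (simp add: \<alpha>_def)
    show "\<exists>g\<in>cls G \<phi> S \<iota> g. \<exists>A\<^sub>b \<in> segments S. \<exists>b. \<exists>A\<^sub>z \<in> Free.
           compactin (mtop S) A\<^sub>b \<and> A\<^sub>b \<subseteq> A \<and> b \<in> seg_bd S A \<inter> seg_bd S A\<^sub>b \<and>
           compactin (mtop S) A\<^sub>z \<and> A \<inter> A\<^sub>z = {?z} \<and> seg_bd S A \<inter> seg_bd S A\<^sub>z = {?z} \<and>
           \<phi> g ` \<iota> ` A\<^sub>b = \<iota> ` A\<^sub>z \<and> \<phi> g (\<iota> b) = \<iota> ?z"
      by (intro bexI[OF _ cls_self[OF g]] bexI[OF _ 1] exI[of _ ?z] bexI[OF _ K2F] conjI) (rule 2 3 4 5 6 7 8 9)+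
  qed
  \<comment> \<open>A competing witness also carries a part of \<open>A\<close> onto a germ that
    leaves \<open>A\<close> at \<open>a 1\<close>. Such a germ must follow \<open>b\<close>, so the
    two witnesses differ by an overlap of \<open>A\<close> with itself.\<close>
  have uniq: "c = cls G \<phi> S \<iota> g" if Qc: "?Q c" for c
  proof -
    obtain g' A\<^sub>b A\<^sub>z where g': "g' \<in> c" and Ab: "A\<^sub>b \<subseteq> A" and Az: "A\<^sub>z \<in> Free" "A \<inter> A\<^sub>z = {?z}"
        and im: "\<phi> g' ` \<iota> ` A\<^sub>b = \<iota> ` A\<^sub>z"
      using Qc by blast
    have cl: "c \<in> lcosets\<^bsub>G\<^esub> H" using Qc by blast
    have g'G: "g' \<in> carrier G" and c: "c = cls G \<phi> S \<iota> g'" using lcosets_cls[OF cl g'] by auto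
    have seg: "A\<^sub>z \<in> segments S" using Az(1) by (simp add: free_segments_def)
    have AzS: "A\<^sub>z \<subseteq> points S" using seg connectedin_subset_topspace unfolding segments_def by blast
    obtain y where y: "y \<in> A\<^sub>z" "y \<noteq> ?z" using seg unfolding segments_def by blast
    have con: "connectedin X A\<^sub>z" using seg by (simp add: segments_def)
    have zAz: "?z \<in> A\<^sub>z" using Az(2) by blast
    obtain r where r: "arcin X A\<^sub>z 0 1 r" "r 0 = ?z" "r 1 = y"
      using arc_between[OF con zAz y(1)] y(2) by metis
    have rA: "r ` {0..1} \<subseteq> A\<^sub>z" using r(1) by (simp add: arcin_def)
    \<comment> \<open>\<open>A\<close> prolonged by \<open>b\<close>. Now \<open>a 1\<close> is an
      inner point of an arc, and \<open>germ\<close> tells which way \<open>A\<^sub>z\<close>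
      goes.\<close>
    define \<rho> where "\<rho> = (\<lambda>t. if t \<le> 1 then a t else b (1 * t + - 1))"
    have \<rho>: "arcin X (A \<union> b ` {0..\<delta>}) 0 (1 + \<delta>) \<rho>"
      unfolding \<rho>_def
    proof (rule arcin_join[OF a(1)])
      show "arcin X (b ` {0..\<delta>}) 1 (1 + \<delta>) (\<lambda>t. b (1 * t + - 1))"
        by (rule arcin_affine[OF b]) (use \<delta>0 in auto)
      show "a 1 = b (1 * 1 + - 1)" using b0 by simp
      fix t u assume tu: "t \<in> {0..1}" "u \<in> {1..1+\<delta>}" "a t = b (1 * u + - 1)"
      have "b (u - 1) \<in> A" using tu a(2) by force
      then have "u = 1" using out[of "u - 1"] tu(2) by force
      then show "t = 1 \<and> u = 1" using tu b0 arcin_inj[OF a(1), of t 1] by simp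
    qed
    have "\<exists>d>0. d \<le> \<delta> \<and> b ` {0..d} \<subseteq> A\<^sub>z"
    proof (rule germ[OF \<rho>, of 1 A\<^sub>z r])
      show "arcin X A\<^sub>z 0 1 r" by (rule r(1))
      show "r 0 = \<rho> 1" using r(2) by (simp add: \<rho>_def)
    next
      fix d assume d: "d > 0" "1 + d \<le> 1 + \<delta>" "\<rho> ` {1..1+d} \<subseteq> r ` {0..1}"
      have "b t \<in> A\<^sub>z" if t: "t \<in> {0..d}" for t
      proof -
        have "\<rho> (1 + t) \<in> \<rho> ` {1..1+d}" using t by auto
        then have "\<rho> (1 + t) \<in> A\<^sub>z" using d(3) rA by blast
        moreover have "\<rho> (1 + t) = b t" using t b0 by (cases "t = 0") (auto simp: \<rho>_def)
        ultimately show ?thesis by simp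
      qed
      then show ?thesis using d by auto
    next
      \<comment> \<open>Going backwards would give \<open>A\<close> and \<open>A\<^sub>z\<close> a
        second common point.\<close>
      fix d assume d: "d > 0" "0 \<le> 1 - d" "\<rho> ` {1-d..1} \<subseteq> r ` {0..1}"
      have "\<rho> (1 - d) \<in> \<rho> ` {1-d..1}" using d by auto
      then have "\<rho> (1 - d) \<in> A\<^sub>z" using d(3) rA by blast
      moreover have "\<rho> (1 - d) = a (1 - d)" using d by (simp add: \<rho>_def)
      moreover have "a (1 - d) \<in> A" using d a(2) by auto
      ultimately have "a (1 - d) = a 1" using Az(2) by auto
      then have False using arcin_inj[OF a(1), of "1 - d" 1] d by simp
      then show ?thesis ..
    qed (use \<delta>0 in auto)
    then obtain d where d: "d > 0" "d \<le> \<delta>" "b ` {0..d} \<subseteq> A\<^sub>z" by blast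
    have AS: "A \<subseteq> points S" using arcin_topspace[OF a(1)] a(2) by simp
    have bd': "arcin X (b ` {0..d}) 0 d b" using arcin_sub[OF b] d by simp
    have Ac: "compactin X A" using arcin_compactin[OF a(1)] a(2) by simp
    have "\<phi> (inv\<^bsub>G\<^esub> g') (\<iota> (b t)) \<in> \<iota> ` A" if t: "t \<in> {0..d}" for t
    proof -
      have "\<iota> (b t) \<in> \<phi> g' ` \<iota> ` A\<^sub>b" using d(3) t im by blast
      then obtain x where x: "x \<in> A\<^sub>b" "\<iota> (b t) = \<phi> g' (\<iota> x)" by blast
      then have "\<phi> (inv\<^bsub>G\<^esub> g') (\<iota> (b t)) = \<iota> x" using \<phi>_inv[OF g'G] \<iota>_in Ab AS by (metis subsetD)
      then show ?thesis using x(1) Ab by blast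
    qed
    then obtain p' where p': "arcin X A 0 d p'" "\<And>t. t \<in> {0..d} \<Longrightarrow> \<phi> (inv\<^bsub>G\<^esub> g') (\<iota> (b t)) = \<iota> (p' t)"
      using transport[OF inv_closed[OF g'G] bd' compact_embedded[OF Ac order_refl] AS] by metis
    \<comment> \<open>From \<open>A\<close> to the germ by \<open>g'\<close>, then back to
      \<open>A\<close> by the inverse of \<open>g\<close>.\<close>
    let ?k = "inv\<^bsub>G\<^esub> g \<otimes>\<^bsub>G\<^esub> g'"
    have k: "?k \<in> carrier G" using g g'G inv_closed mult_closed by simp
    have \<alpha>d: "arcin X A 0 d \<alpha>" using arcin_mono[OF arcin_sub[OF \<alpha>, of 0 d]] d \<alpha> by (auto simp: arcin_def)
    have "\<phi> ?k (\<iota> (p' t)) = \<iota> (\<alpha> t)" if t: "t \<in> {0..d}" for t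
    proof -
      have t\<delta>: "t \<in> {0..\<delta>}" using t d(2) by simp
      have bS: "b t \<in> points S" and pS: "p' t \<in> points S"
        using arcin_topspace[OF b] t\<delta> arcin_topspace[OF p'(1)] t by blast+
      have "\<phi> g' (\<iota> (p' t)) = \<iota> (b t)" using p'(2)[OF t] \<phi>_inv'[OF g'G \<iota>_in[OF bS]] by simp
      also have "\<dots> = \<phi> g (\<iota> (\<alpha> t))" using eq\<alpha>[OF t\<delta>] by simp
      finally show ?thesis
        using \<phi>_mult[OF inv_closed[OF g] g'G \<iota>_in[OF pS]] \<phi>_inv[OF g \<iota>_in[OF \<alpha>S[OF t\<delta>]]] by simp
    qed
    then have kH: "?k \<in> H" using free_arcs[OF A k p'(1) \<alpha>d] by blast
    show ?thesis
      unfolding c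
    proof (rule cls_eqI[OF g'G g])
      fix z assume z: "z \<in> points S"
      have "\<phi> (inv\<^bsub>G\<^esub> g) (\<phi> g' (\<iota> z)) = \<iota> z"
        using kH z \<phi>_mult[OF inv_closed[OF g] g'G \<iota>_in[OF z]] unfolding H_iff by simp
      then show "\<phi> g' (\<iota> z) = \<phi> g (\<iota> z)" using \<phi>_inv'[OF g \<phi>_in[OF g'G \<iota>_in[OF z]]] by simp
    qed
  qed
  have "(THE c. ?Q c) = cls G \<phi> S \<iota> g" by (rule the_equality[of ?Q, OF Qg uniq])
  then have "g \<in> bd_class G M \<phi> S \<iota> A ?z" using bd cls_self[OF g] by simp
  moreover have "?z \<in> seg_bd S A \<inter> seg_int S (points S)" using bdA zint by simp
  ultimately have "g \<notin> stabilizer G \<phi> (\<iota> ?z)" using pos unfolding positive_segment_def by blast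
  moreover have "\<phi> g (\<iota> ?z) = \<iota> ?z" using eq\<alpha>[of 0] \<delta>0 b0 by (simp add: \<alpha>_def)
  ultimately show False using g by (simp add: stabilizer_def)
qed

end

section \<open>The shifted segment\<close>

text \<open>
  \<open>A = a[0,1]\<close> and \<open>B\<^sub>1 = b(J)\<close> are consecutive segments with common point \<open>a(1) = b(0)\<close>, and \<open>g\<close> shifts the part \<open>a(J)\<close>
  of \<open>A\<close> onto \<open>B\<^sub>1\<close>. Thus \<open>\<rho>\<close>, which is \<open>a\<close> followed by \<open>b\<close>, satisfies \<open>g \<cdot> \<iota>(\<rho>(t)) = \<iota>(\<rho>(1 + t))\<close>, and the segment sought
  is \<open>\<rho>[s, 1 + s]\<close>. On the circle both ends of \<open>A\<close> may meet \<open>B\<^sub>1\<close>, which is the second alternative in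
  \<open>disj\<close>. The last assumption says that no free segment containing \<open>B\<^sub>1\<close> leaves \<open>B\<^sub>1\<close> at its far end.
\<close>

locale adjacent_translate = acted_curve G M \<phi> S \<iota>
  for G :: "'g monoid" and M :: "'m amfd" and \<phi> :: "'g \<Rightarrow> 'm \<Rightarrow> 'm"
    and S :: "'s amfd" and \<iota> :: "'s \<Rightarrow> 'm" +
  fixes A B\<^sub>1 :: "'s set" and g :: 'g and a b :: "real \<Rightarrow> 's" and J :: "real set"
  assumes A_free: "A \<in> Free" and g: "g \<in> carrier G"
    and a: "arcin X A 0 1 a" and aA: "a ` {0..1} = A"
    and J: "is_interval J" "J \<subseteq> {0..1}" "0 \<in> J"
    and b_cont: "continuous_map (top_of_set J) X b" and b_inj: "inj_on b J" and bB: "b ` J = B\<^sub>1"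
    and eq: "\<And>t. t \<in> J \<Longrightarrow> \<phi> g (\<iota> (a t)) = \<iota> (b t)"
    and b0: "b 0 = a 1"
    and disj: "\<And>t u. t \<in> {0..1} \<Longrightarrow> u \<in> J \<Longrightarrow> a t = b u \<Longrightarrow>
      t = 1 \<and> u = 0 \<or> t = 0 \<and> 0 < u \<and> (\<forall>v\<in>J. v \<le> u)"
    and at_end: "\<And>B q s. B \<in> Free \<Longrightarrow> s \<in> J \<Longrightarrow> 0 < s \<Longrightarrow> (\<And>v. v \<in> J \<Longrightarrow> v \<le> s) \<Longrightarrow> B\<^sub>1 \<subseteq> B \<Longrightarrow>
      arcin X B 0 1 q \<Longrightarrow> q 0 = b s \<Longrightarrow> (\<And>u. 0 < u \<Longrightarrow> u \<le> 1 \<Longrightarrow> q u \<notin> B\<^sub>1) \<Longrightarrow> False"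
begin

definition \<rho> :: "real \<Rightarrow> 's" where
  "\<rho> t = (if t \<le> 1 then a t else b (t - 1))"

lemma \<rho>_left: "t \<le> 1 \<Longrightarrow> \<rho> t = a t"
  by (simp add: \<rho>_def)

lemma \<rho>_right: "1 \<le> t \<Longrightarrow> \<rho> t = b (t - 1)"
  using b0 by (cases "t = 1") (auto simp: \<rho>_def)

lemma J_sub: "s \<in> J \<Longrightarrow> {0..s} \<subseteq> J"
  using J unfolding is_interval_1 by (meson atLeastAtMost_iff subsetI)

lemma J_le: "s \<in> J \<Longrightarrow> s \<le> 1"
  using J(2) by auto

lemma b_arc: "s \<in> J \<Longrightarrow> 0 < s \<Longrightarrow> arcin X B\<^sub>1 0 s b"
  using J_sub[of s] bB b_inj continuous_map_from_subtopology_mono[OF b_cont]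
  unfolding arcin_def by (meson image_mono inj_on_subset subset_trans equalityD1)

text \<open>The start \<open>c\<close> is positive because on the circle \<open>a 0\<close> may
  coincide with the far end of \<open>B\<^sub>1\<close>, and then \<rho> is not injective from 0
  on.\<close>

lemma \<rho>_arc:
  assumes s: "s \<in> J" "0 < s" and c: "0 < c" "c < 1"
  shows "arcin X (A \<union> B\<^sub>1) c (1 + s) \<rho>"
proof -
  have 1: "arcin X A c 1 a"
    using arcin_sub[OF a, of c 1] c a arcin_mono[of X "a ` {c..1}" c 1 a A] image_mono[of "{c..1}" "{0..1}" a] aA by auto
  have "arcin X (b ` {0..s}) 1 (1 + s) (\<lambda>t. b (1 * t + - 1))"
    by (rule arcin_affine[OF b_arc[OF s]]) (use s in auto)
  moreover have "b ` {0..s} \<subseteq> B\<^sub>1" using J_sub[OF s(1)] bB by blast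
  ultimately have 2: "arcin X B\<^sub>1 1 (1 + s) (\<lambda>t. b (t - 1))" using arcin_mono by fastforce
  have "arcin X (A \<union> B\<^sub>1) c (1 + s) (\<lambda>t. if t \<le> 1 then a t else b (t - 1))"
  proof (rule arcin_join[OF 1 2])
    fix t u assume tu: "t \<in> {c..1}" "u \<in> {1..1+s}" "a t = b (u - 1)"
    have "u - 1 \<in> J" using J_sub[OF s(1)] tu(2) by auto
    then show "t = 1 \<and> u = 1" using disj[of t "u - 1"] tu c by auto
  qed (use b0 in simp)
  then show ?thesis unfolding \<rho>_def .
qed

lemma shift_arc:
  assumes s: "s \<in> J" "0 < s"
  shows "arcin X (\<rho> ` {s..1+s}) s (1 + s) \<rho>"
  using arcin_sub[OF \<rho>_arc[OF s, of "s / 2"], of s "1 + s"] s J_le[OF s(1)] by simp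

section \<open>Freeness and maximality of the shifted piece\<close>

lemma g_notin_H: "g \<notin> H"
proof
  assume "g \<in> H"
  have a0: "a 0 \<in> points S" using arcin_topspace[OF a] by auto
  have "\<phi> g (\<iota> (a 0)) = \<iota> (a 0)" using \<open>g \<in> H\<close> a0 unfolding H_iff by blast
  then have "\<iota> (a 0) = \<iota> (a 1)" using eq[OF J(3)] b0 by simp
  moreover have "a 1 \<in> points S" using arcin_topspace[OF a] by auto
  ultimately have "a 0 = a 1" using \<iota>_eq_iff[OF a0] by blast
  then show False using arcin_inj[OF a, of 0 1] by simp
qed

text \<open>After the shift is undone the parameters must agree, but [s, 1] and [0, s] share only
  \<open>s\<close>: the injective function \<open>f\<close> would be constant.\<close>

lemma no_left_to_right:
  fixes c d :: real
  assumes s: "s \<in> J" "0 < s" and h: "h \<in> carrier G" and cd: "c < d"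
    and f: "continuous_on {c..d} f" "inj_on f {c..d}" "\<And>t. t \<in> {c..d} \<Longrightarrow> f t \<in> {s..1}"
    and f': "continuous_on {c..d} f'" "inj_on f' {c..d}" "\<And>t. t \<in> {c..d} \<Longrightarrow> f' t \<in> {1..1+s}"
    and hf: "\<And>t. t \<in> {c..d} \<Longrightarrow> \<phi> h (\<iota> (\<rho> (f t))) = \<iota> (\<rho> (f' t))"
  shows False
proof -
  have s1: "s \<le> 1" using J_le[OF s(1)] .
  have F: "arcin X A c d (\<lambda>t. a (f t))"
    using arcin_mono[OF arcin_comp[OF a f(1,2) _ cd], of A] f(3) s aA unfolding comp_def by fastforce
  have F': "arcin X A c d (\<lambda>t. a (f' t - 1))"
  proof -
    have "continuous_on {c..d} (\<lambda>t. f' t - 1)" "inj_on (\<lambda>t. f' t - 1) {c..d}"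
      using f'(1,2) by (auto intro!: continuous_intros simp: inj_on_def)
    then show ?thesis
      using arcin_mono[OF arcin_comp[OF a _ _ _ cd], of "\<lambda>t. f' t - 1" A] f'(3) s1 aA unfolding comp_def by fastforce
  qed
  let ?k = "inv\<^bsub>G\<^esub> g \<otimes>\<^bsub>G\<^esub> h"
  have k: "?k \<in> carrier G" using g h inv_closed mult_closed by simp
  have aS: "a t \<in> points S" if "t \<in> {0..1}" for t using arcin_topspace[OF a] that by blast
  have mem: "f t \<in> {0..1}" "f' t - 1 \<in> {0..1}" "f' t - 1 \<in> J" if "t \<in> {c..d}" for t
    using f(3)[OF that] f'(3)[OF that] s s1 J_sub[OF s(1)] by auto
  have "\<phi> ?k (\<iota> (a (f t))) = \<iota> (a (f' t - 1))" if t: "t \<in> {c..d}" for t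
  proof -
    have "\<phi> h (\<iota> (a (f t))) = \<iota> (b (f' t - 1))"
      using hf[OF t] \<rho>_left[of "f t"] \<rho>_right[of "f' t"] f(3)[OF t] f'(3)[OF t] by simp
    also have "\<dots> = \<phi> g (\<iota> (a (f' t - 1)))" using eq[OF mem(3)[OF t]] by simp
    finally show ?thesis
      using \<phi>_mult[OF inv_closed[OF g] h \<iota>_in[OF aS[OF mem(1)[OF t]]]] \<phi>_inv[OF g \<iota>_in[OF aS[OF mem(2)[OF t]]]] by simp
  qed
  note kk = this
  then have kH: "?k \<in> H" using free_arcs[OF A_free k F F'] by blast
  have fs: "f t = s" if t: "t \<in> {c..d}" for t
  proof -
    have "\<iota> (a (f t)) = \<iota> (a (f' t - 1))" using kk[OF t] kH aS[OF mem(1)[OF t]] unfolding H_iff by simp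
    then have "f t = f' t - 1"
      using \<iota>_eq_iff[OF aS[OF mem(1)[OF t]] aS[OF mem(2)[OF t]]] arcin_inj[OF a mem(1)[OF t] mem(2)[OF t]] by blast
    then show ?thesis using f(3)[OF t] f'(3)[OF t] by auto
  qed
  then have "f c = f d" using cd by simp
  then show False using f(2) cd by (simp add: inj_on_eq_iff)
qed

lemma shift_free:
  assumes s: "s \<in> J" "0 < s"
  shows "\<rho> ` {s..1+s} \<in> Free"
proof (rule freeI)
  show "\<rho> ` {s..1+s} \<in> segments S" by (rule segments_arc[OF shift_arc[OF s]])
  fix h p q assume h: "h \<in> carrier G" and p: "arcin X (\<rho> ` {s..1+s}) 0 1 p" and q: "arcin X (\<rho> ` {s..1+s}) 0 1 q"
    and pq: "\<And>t. t \<in> {0..1} \<Longrightarrow> \<phi> h (\<iota> (p t)) = \<iota> (q t)"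
  have s1: "s \<le> 1" using J_le[OF s(1)] .
  obtain f where f: "continuous_on {0..1} f" "inj_on f {0..1}" "\<And>t. t \<in> {0..1} \<Longrightarrow> f t \<in> {s..1+s}"
    "\<And>t. t \<in> {0..1} \<Longrightarrow> \<rho> (f t) = p t"
    using arc_factor[OF shift_arc[OF s] p] by blast
  obtain f' where f': "continuous_on {0..1} f'" "inj_on f' {0..1}" "\<And>t. t \<in> {0..1} \<Longrightarrow> f' t \<in> {s..1+s}"
    "\<And>t. t \<in> {0..1} \<Longrightarrow> \<rho> (f' t) = q t"
    using arc_factor[OF shift_arc[OF s] q] by blast
  \<comment> \<open>The parameter interval is cut down twice, so that each of the two arcs stays on
    one side of the joint \<rho>(1). A subarc of the overlap is enough to put \<open>h\<close> into
    the stabilizer.\<close>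
  obtain c0 d0 where cd0: "0 \<le> c0" "c0 < d0" "d0 \<le> 1"
    "(\<forall>t\<in>{c0..d0}. f t \<le> 1) \<or> (\<forall>t\<in>{c0..d0}. 1 \<le> f t)"
    by (rule continuous_locally_one_sided[OF f(1), of 1]) auto
  have "continuous_on {c0..d0} f'" using continuous_on_subset[OF f'(1)] cd0 by auto
  then obtain c d where cd: "c0 \<le> c" "c < d" "d \<le> d0"
    "(\<forall>t\<in>{c..d}. f' t \<le> 1) \<or> (\<forall>t\<in>{c..d}. 1 \<le> f' t)"
    using continuous_locally_one_sided[of c0 d0 f' 1] cd0(2) by metis
  have sub: "{c..d} \<subseteq> {0..1}" using cd cd0 by auto
  have F: "continuous_on {c..d} f" "inj_on f {c..d}" "\<And>t. t \<in> {c..d} \<Longrightarrow> f t \<in> {s..1+s}"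
    using f(1-3) sub continuous_on_subset inj_on_subset by blast+
  have F': "continuous_on {c..d} f'" "inj_on f' {c..d}" "\<And>t. t \<in> {c..d} \<Longrightarrow> f' t \<in> {s..1+s}"
    using f'(1-3) sub continuous_on_subset inj_on_subset by blast+
  have pf: "\<rho> (f t) = p t" "\<rho> (f' t) = q t" "\<phi> h (\<iota> (p t)) = \<iota> (q t)" if "t \<in> {c..d}" for t
    using f(4) f'(4) pq that sub by blast+
  have pcd: "arcin X (p ` {c..d}) c d p" and qcd: "arcin X (q ` {c..d}) c d q"
    using arcin_sub[OF p, of c d] arcin_sub[OF q, of c d] cd cd0 by auto
  have fl: "(\<forall>t\<in>{c..d}. f t \<le> 1) \<or> (\<forall>t\<in>{c..d}. 1 \<le> f t)" using cd0(4) cd by auto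
  have inA: "\<rho> x \<in> A" if "s \<le> x" "x \<le> 1" for x using that s(2) \<rho>_left[of x] aA by auto
  have inB: "\<rho> x \<in> b ` {0..s}" if "x \<le> 1 + s" "1 \<le> x" for x using that \<rho>_right[of x] by auto
  consider "\<forall>t\<in>{c..d}. f t \<le> 1" "\<forall>t\<in>{c..d}. f' t \<le> 1" | "\<forall>t\<in>{c..d}. 1 \<le> f t" "\<forall>t\<in>{c..d}. 1 \<le> f' t"
    | "\<forall>t\<in>{c..d}. f t \<le> 1" "\<forall>t\<in>{c..d}. 1 \<le> f' t" | "\<forall>t\<in>{c..d}. 1 \<le> f t" "\<forall>t\<in>{c..d}. f' t \<le> 1"
    using fl cd(4) by blast
  then show "h \<in> H"
  proof cases
    case 1
    have "p t \<in> A" "q t \<in> A" if t: "t \<in> {c..d}" for t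
      using inA[of "f t"] inA[of "f' t"] F(3)[OF t] F'(3)[OF t] 1 t pf(1,2)[OF t] by auto
    then have "arcin X A c d p" "arcin X A c d q" using arcin_mono[OF pcd] arcin_mono[OF qcd] by blast+
    then show ?thesis using free_arcs[OF A_free h] pf(3) by blast
  next
    case 2
    have "p t \<in> b ` {0..s}" "q t \<in> b ` {0..s}" if t: "t \<in> {c..d}" for t
      using inB[of "f t"] inB[of "f' t"] F(3)[OF t] F'(3)[OF t] 2 t pf(1,2)[OF t] by auto
    then have 1: "arcin X (b ` {0..s}) c d p" "arcin X (b ` {0..s}) c d q"
      using arcin_mono[OF pcd] arcin_mono[OF qcd] by blast+
    have as: "arcin X A 0 s a"
      using arcin_mono[OF arcin_sub[OF a, of 0 s]] s(2) s1 aA image_mono[of "{0..s}" "{0..1}" a] by auto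
    have eqs: "\<phi> g (\<iota> (a t)) = \<iota> (b t)" if "t \<in> {0..s}" for t using eq J_sub[OF s(1)] that by blast
    \<comment> \<open>The right part is the translate of a part of \<open>A\<close> and inherits its
      freeness.\<close>
    show ?thesis by (rule translate_free[OF A_free g as b_arc[OF s] eqs h 1 pf(3)])
  next
    case 3
    have False
      by (rule no_left_to_right[OF s h cd(2) F(1,2) _ F'(1,2)]) (use 3 F(3) F'(3) pf in auto)
    then show ?thesis ..
  next
    case 4
    \<comment> \<open>The inverse of \<open>h\<close> exchanges the two arcs and leads back to the
      previous case.\<close>
    have "\<phi> (inv\<^bsub>G\<^esub> h) (\<iota> (q t)) = \<iota> (p t)" if t: "t \<in> {c..d}" for t
      using pf(3)[OF t] \<phi>_inv[OF h] \<iota>_in arcin_topspace[OF pcd] t by (metis image_subset_iff)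
    then have False
      by (intro no_left_to_right[OF s inv_closed[OF h] cd(2) F'(1,2) _ F(1,2)]) (use 4 F(3) F'(3) pf in auto)
    then show ?thesis ..
  qed
qed

lemma shift_maximal:
  assumes s: "s \<in> J" "0 < s" and B: "B \<in> Free" "\<rho> ` {s..1+s} \<subseteq> B"
  shows "B = \<rho> ` {s..1+s}"
proof (rule ccontr)
  assume "B \<noteq> \<rho> ` {s..1+s}"
  then have sub: "\<rho> ` {s..1+s} \<subset> B" using B(2) by blast
  have s1: "s \<le> 1" using J_le[OF s(1)] .
  have con: "connectedin X B" using B(1) by (simp add: free_segments_def segments_def)
  obtain q where q: "arcin X B 0 1 q" "q 0 \<in> {\<rho> s, \<rho> (1 + s)}"
    "\<And>u. 0 < u \<Longrightarrow> u \<le> 1 \<Longrightarrow> q u \<notin> \<rho> ` {s..1+s}"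
    using outward[OF shift_arc[OF s] con sub] by blast
  have qB: "q ` {0..1} \<subseteq> B" using q(1) by (simp add: arcin_def)
  \<comment> \<open>\<open>q\<close> leaves the segment at once and does not return, so its start is
    the only common point.\<close>
  have only0: "\<rho> x = q 0" if x: "x \<in> {s..1+s}" "\<rho> x \<in> q ` {0..1}" for x
  proof -
    obtain u where u: "u \<in> {0..1}" "\<rho> x = q u" using x(2) by blast
    moreover have "\<rho> x \<in> \<rho> ` {s..1+s}" using x(1) by blast
    ultimately have "u = 0" using q(3)[of u] by force
    then show ?thesis using u by simp
  qed
  have \<rho>B: "\<rho> x \<in> B" if "x \<in> {s..1+s}" for x using that B(2) by blast
  show False
  proof (cases "q 0 = \<rho> s")
    case True
    \<comment> \<open>Starting at s / 2 makes \<open>s\<close> an inner parameter, as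
      \<open>germ\<close> requires.\<close>
    have R: "arcin X (A \<union> B\<^sub>1) (s / 2) (1 + s) \<rho>" using \<rho>_arc[OF s, of "s / 2"] s s1 by simp
    show False
    proof (rule germ[OF R, of s B q])
      fix \<delta> assume d: "\<delta> > 0" "s + \<delta> \<le> 1 + s" "\<rho> ` {s..s+\<delta>} \<subseteq> q ` {0..1}"
      have "\<rho> (s + \<delta>) \<in> \<rho> ` {s..s+\<delta>}" using d(1) by auto
      then have "\<rho> (s + \<delta>) \<in> q ` {0..1}" using d(3) by blast
      then have "\<rho> (s + \<delta>) = \<rho> s" using only0[of "s + \<delta>"] d True by simp
      then show False using arcin_inj[OF R, of "s + \<delta>" s] d s by simp
    next
      \<comment> \<open>\<open>B\<close> contains a germ of \<rho> before \<open>s\<close> and,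
        within the segment, the shifted germ before 1 + s. So \<open>g\<close> overlaps
        \<open>B\<close> with itself and would lie in the stabilizer.\<close>
      fix \<delta> assume d: "\<delta> > 0" "s / 2 \<le> s - \<delta>" "\<rho> ` {s-\<delta>..s} \<subseteq> q ` {0..1}"
      have pa: "arcin X (a ` {s-\<delta>..s}) (s - \<delta>) s a" using arcin_sub[OF a, of "s - \<delta>" s] d s s1 by simp
      have "a t \<in> B" if t: "t \<in> {s-\<delta>..s}" for t
      proof -
        have "\<rho> t \<in> B" using d(3) qB t by blast
        then show ?thesis using \<rho>_left[of t] t s1 by simp
      qed
      then have p: "arcin X B (s - \<delta>) s a" using arcin_mono[OF pa] by blast
      have pb: "arcin X (b ` {s-\<delta>..s}) (s - \<delta>) s b" using arcin_sub[OF b_arc[OF s], of "s - \<delta>" s] d s by simp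
      have "b t \<in> B" if t: "t \<in> {s-\<delta>..s}" for t
        using \<rho>B[of "1 + t"] \<rho>_right[of "1 + t"] t d s s1 by simp
      then have p': "arcin X B (s - \<delta>) s b" using arcin_mono[OF pb] by blast
      have "\<phi> g (\<iota> (a t)) = \<iota> (b t)" if "t \<in> {s-\<delta>..s}" for t
        by (rule eq[OF subsetD[OF J_sub[OF s(1)]]]) (use that d s(2) in auto)
      then show False using free_arcs[OF B(1) g p p'] g_notin_H by blast
    qed (use q(1) True s in auto)
  next
    case False
    then have q0: "q 0 = \<rho> (1 + s)" using q(2) by blast
    show False
    proof (cases "\<exists>v\<in>J. s < v")
      case True
      \<comment> \<open>There is room in \<open>J\<close> beyond \<open>s\<close>. Now the outer
        germ after 1 + s is the translate of the inner germ after \<open>s\<close>.\<close>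
      then obtain v where v: "v \<in> J" "s < v" by blast
      have v0: "0 < v" and v1: "v \<le> 1" using v s J_le by auto
      have R: "arcin X (A \<union> B\<^sub>1) (s / 2) (1 + v) \<rho>" using \<rho>_arc[OF v(1) v0, of "s / 2"] s s1 by simp
      show False
      proof (rule germ[OF R, of "1 + s" B q])
        fix \<delta> assume d: "\<delta> > 0" "1 + s + \<delta> \<le> 1 + v" "\<rho> ` {1+s..1+s+\<delta>} \<subseteq> q ` {0..1}"
        have pa: "arcin X (a ` {s..s+\<delta>}) s (s + \<delta>) a" using arcin_sub[OF a, of s "s + \<delta>"] d s v1 by simp
        have "a t \<in> B" if t: "t \<in> {s..s+\<delta>}" for t
          using \<rho>B[of t] \<rho>_left[of t] t d s v1 by simp
        then have p: "arcin X B s (s + \<delta>) a" using arcin_mono[OF pa] by blast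
        have pb: "arcin X (b ` {s..s+\<delta>}) s (s + \<delta>) b"
          using arcin_sub[OF b_arc[OF v(1) v0], of s "s + \<delta>"] d s by simp
        have "b t \<in> B" if t: "t \<in> {s..s+\<delta>}" for t
        proof -
          have "\<rho> (1 + t) \<in> \<rho> ` {1+s..1+s+\<delta>}" using t by auto
          then have "\<rho> (1 + t) \<in> B" using d(3) qB by blast
          then show ?thesis using \<rho>_right[of "1 + t"] t s by simp
        qed
        then have p': "arcin X B s (s + \<delta>) b" using arcin_mono[OF pb] by blast
        have "\<phi> g (\<iota> (a t)) = \<iota> (b t)" if "t \<in> {s..s+\<delta>}" for t
          by (rule eq[OF subsetD[OF J_sub[OF v(1)]]]) (use that d s(2) in auto)
        then show False using free_arcs[OF B(1) g p p'] g_notin_H by blast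
      next
        fix \<delta> assume d: "\<delta> > 0" "s / 2 \<le> 1 + s - \<delta>" "\<rho> ` {1+s-\<delta>..1+s} \<subseteq> q ` {0..1}"
        \<comment> \<open>The minimum with 1, the length of the parameter interval, keeps
          \<open>x\<close> at least \<open>s\<close>.\<close>
        define x where "x = 1 + s - min \<delta> 1"
        have x: "x \<in> {1+s-\<delta>..1+s}" "x \<in> {s..1+s}" "x < 1 + s" using d(1) by (auto simp: x_def)
        have "\<rho> x \<in> q ` {0..1}" using d(3) x(1) by blast
        then have "\<rho> x = \<rho> (1 + s)" using only0[OF x(2)] q0 by simp
        then show False using arcin_inj[OF R, of x "1 + s"] x s v by simp
      qed (use q(1) q0 s v in auto)
    next
      case False
      \<comment> \<open>Here \<open>s\<close> is the last parameter of \<open>J\<close>, so the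
        segment ends where \<open>B\<^sub>1\<close> does and \<open>at_end\<close> applies.\<close>
      have B1: "B\<^sub>1 \<subseteq> \<rho> ` {s..1+s}"
      proof
        fix x assume "x \<in> B\<^sub>1"
        then obtain u where u: "u \<in> J" "x = b u" using bB by blast
        then have "u \<le> s" "0 \<le> u" using False J(2) by auto
        then have "x = \<rho> (1 + u)" "1 + u \<in> {s..1+s}" using u(2) \<rho>_right[of "1 + u"] s1 by auto
        then show "x \<in> \<rho> ` {s..1+s}" by blast
      qed
      show False
      proof (rule at_end[OF B(1) s _ _ q(1)])
        show "v \<le> s" if "v \<in> J" for v using False that by auto
        show "B\<^sub>1 \<subseteq> B" using B1 B(2) by blast
        show "q 0 = b s" using q0 \<rho>_right[of "1 + s"] s by simp
        show "q u \<notin> B\<^sub>1" if "0 < u" "u \<le> 1" for u using q(3)[OF that] B1 by blast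
      qed
    qed
  qed
qed

lemma shift_segment:
  assumes s: "s \<in> J" "0 < s"
  obtains A' where "A' \<in> max_free_segments G M \<phi> S \<iota>" "compactin X A'" "A' \<subseteq> A \<union> B\<^sub>1" "b ` {0..s} \<subseteq> A'"
    "seg_bd S A' = {a s, b s}" "a s \<in> A"
    "b s \<in> seg_int S B\<^sub>1 \<Longrightarrow> s < 1 \<and> A' \<subset> seg_int S (A \<union> B\<^sub>1)"
    "s < 1 \<Longrightarrow> a s \<in> seg_int S A \<and> a 1 \<in> seg_int S A'"
proof
  let ?A = "\<rho> ` {s..1+s}"
  have s1: "s \<le> 1" using J_le[OF s(1)] .
  note arc = shift_arc[OF s]
  have R: "arcin X (A \<union> B\<^sub>1) (s / 2) (1 + s) \<rho>" using \<rho>_arc[OF s, of "s / 2"] s s1 by simp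
  have end1: "\<rho> s = a s" "\<rho> (1 + s) = b s" using \<rho>_left[of s] \<rho>_right[of "1 + s"] s s1 by auto
  show "?A \<in> max_free_segments G M \<phi> S \<iota>"
    using shift_free[OF s] shift_maximal[OF s] unfolding max_free_segments_def by blast
  show "compactin X ?A" by (rule arcin_compactin[OF arc])
  have "{s..1+s} \<subseteq> {s/2..1+s}" using s(2) by auto
  then show "?A \<subseteq> A \<union> B\<^sub>1" using R unfolding arcin_def by blast
  show "b ` {0..s} \<subseteq> ?A"
  proof
    fix x assume "x \<in> b ` {0..s}"
    then obtain u where u: "u \<in> {0..s}" "x = b u" by blast
    then have "x = \<rho> (1 + u)" "1 + u \<in> {s..1+s}" using \<rho>_right[of "1 + u"] s1 by auto
    then show "x \<in> ?A" by blast
  qed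
  show "seg_bd S ?A = {a s, b s}" using seg_bd_arc[OF ll arc] end1 by simp
  show "a s \<in> A" using aA s s1 by auto
  show "s < 1 \<and> ?A \<subset> seg_int S (A \<union> B\<^sub>1)" if int: "b s \<in> seg_int S B\<^sub>1"
  proof -
    \<comment> \<open>Otherwise \<open>B\<^sub>1\<close> is the arc b[0,s] and \<open>b s\<close> is
      one of its ends.\<close>
    have "\<exists>v\<in>J. s < v"
    proof (rule ccontr)
      assume n: "\<not> (\<exists>v\<in>J. s < v)"
      then have "J \<subseteq> {0..s}" using J(2) by force
      then have "B\<^sub>1 = b ` {0..s}" using J_sub[OF s(1)] bB by blast
      then have "b s \<in> seg_bd S B\<^sub>1" using seg_bd_arc[OF ll b_arc[OF s]] by simp
      then show False using int by (simp add: seg_bd_def)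
    qed
    then obtain v where v: "v \<in> J" "s < v" by blast
    have v0: "0 < v" and v1: "v \<le> 1" using v s J_le by auto
    have R': "arcin X (A \<union> B\<^sub>1) (s / 2) (1 + v) \<rho>" using \<rho>_arc[OF v(1) v0, of "s / 2"] s s1 by simp
    have "?A \<subseteq> seg_int S (A \<union> B\<^sub>1)"
    proof
      fix x assume "x \<in> ?A"
      then obtain t where t: "t \<in> {s..1+s}" "x = \<rho> t" by blast
      then show "x \<in> seg_int S (A \<union> B\<^sub>1)" using two_sided_seg_int[OF ll R', of t] s v by auto
    qed
    \<comment> \<open>A point shortly before the segment, still inside the longer arc, makes the
      inclusion proper.\<close>
    moreover have "\<rho> (3 * s / 4) \<in> seg_int S (A \<union> B\<^sub>1)" using two_sided_seg_int[OF ll R', of "3 * s / 4"] s v s1 by auto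
    moreover have "\<rho> (3 * s / 4) \<notin> ?A"
    proof
      assume "\<rho> (3 * s / 4) \<in> ?A"
      then obtain t where t: "t \<in> {s..1+s}" "\<rho> (3 * s / 4) = \<rho> t" by blast
      then show False using arcin_inj[OF R', of "3 * s / 4" t] s v s1 by auto
    qed
    ultimately show ?thesis using v(2) v1 by auto
  qed
  show "a s \<in> seg_int S A \<and> a 1 \<in> seg_int S ?A" if "s < 1"
    using two_sided_seg_int[OF ll a s(2) that] two_sided_seg_int[OF ll arc, of 1] \<rho>_left[of 1] that s(2) by simp
qed

text \<open>\<open>J\<close> may be half-open, so \<open>b\<close> cannot be inverted as an arc.
  Instead \<open>K\<close> is carried back into \<open>A\<close> by the inverse of \<open>g\<close>
  and parametrized there by \<open>a\<close>.\<close>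

lemma compact_subsegment:
  assumes K: "K \<in> segments S" "compactin X K" "K \<subseteq> B\<^sub>1" and bd: "seg_bd S K = {b 0, z}" and K': "K \<noteq> points S"
  obtains s where "s \<in> J" "0 < s" "K = b ` {0..s}" "z = b s"
proof -
  obtain x y where xy: "connectedin X K" "x \<in> K" "y \<in> K" "x \<noteq> y" using K(1) unfolding segments_def by blast
  obtain p c d where p: "arcin X K c d p" "p ` {c..d} = K" 
    by (rule compact_arc[OF xy(1) K(2) K' xy(2-4)])
  have cd: "c < d" using p(1) by (simp add: arcin_def)
  have AS: "A \<subseteq> points S" using arcin_topspace[OF a] aA by simp
  have Ac: "compactin X A" using arcin_compactin[OF a] aA by simp
  have bS: "b u \<in> points S" if "u \<in> J" for u
    using continuous_map_image_subset_topspace[OF b_cont] that by auto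
  have aS: "a t \<in> points S" if "t \<in> {0..1}" for t using arcin_topspace[OF a] that by blast
  have im: "\<exists>v\<in>J. p t = b v \<and> \<phi> (inv\<^bsub>G\<^esub> g) (\<iota> (p t)) = \<iota> (a v)" if t: "t \<in> {c..d}" for t
  proof -
    have "p t \<in> b ` J" using p(2) t K(3) bB by blast
    then obtain v where v: "v \<in> J" "p t = b v" by blast
    have "\<phi> (inv\<^bsub>G\<^esub> g) (\<iota> (b v)) = \<iota> (a v)"
      using eq[OF v(1)] \<phi>_inv[OF g \<iota>_in[OF aS]] v(1) J(2) by (metis subsetD)
    then show ?thesis using v by auto
  qed
  have im': "\<phi> (inv\<^bsub>G\<^esub> g) (\<iota> (p t)) \<in> \<iota> ` A" if t: "t \<in> {c..d}" for t
    using im[OF t] J(2) aA by auto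
  obtain r where r: "arcin X A c d r" "\<And>t. t \<in> {c..d} \<Longrightarrow> \<phi> (inv\<^bsub>G\<^esub> g) (\<iota> (p t)) = \<iota> (r t)"
    using transport[OF inv_closed[OF g] p(1) compact_embedded[OF Ac order_refl] AS im'] by blast
  have "arcin X (a ` {0..1}) c d r" using r(1) aA by simp
  then obtain f where f: "continuous_on {c..d} f" "inj_on f {c..d}" "\<And>t. t \<in> {c..d} \<Longrightarrow> f t \<in> {0..1}"
    "\<And>t. t \<in> {c..d} \<Longrightarrow> a (f t) = r t"
    using arc_factor[OF a] by blast
  have fJ: "f t \<in> J \<and> b (f t) = p t" if t: "t \<in> {c..d}" for t
  proof -
    obtain v where v: "v \<in> J" "p t = b v" "\<iota> (r t) = \<iota> (a v)" using im[OF t] r(2)[OF t] by metis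
    have v01: "v \<in> {0..1}" using v(1) J(2) by blast
    have "r t \<in> points S" using arcin_topspace[OF r(1)] t by blast
    then have "r t = a v" using v(3) \<iota>_eq_iff aS[OF v01] by blast
    then have "f t = v" using f(4)[OF t] arcin_inj[OF a f(3)[OF t] v01] by simp
    then show ?thesis using v by simp
  qed
  have Kf: "K = b ` f ` {c..d}" using p(2) fJ by (force simp: image_image)
  have bds: "{b 0, z} = {b (f c), b (f d)}" using seg_bd_arc[OF ll p(1)] p(2) bd fJ cd by auto
  have fcd: "f c \<in> J" "f d \<in> J" "f c \<noteq> f d" using fJ cd f(2) by (auto simp: inj_on_eq_iff)
  have con: "is_interval (f ` {c..d})"
    using connected_continuous_image[OF f(1)] is_interval_connected_1 by auto
  \<comment> \<open>A continuous injective real function is monotone, so the values of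
    \<open>f\<close> lie between those at \<open>c\<close> and \<open>d\<close>.\<close>
  have btw: "f t \<in> {min (f c) (f d)..max (f c) (f d)}" if t: "t \<in> {c..d}" for t
  proof (cases "t = c \<or> t = d")
    case False
    then have "c < t" "t < d" using t by auto
    then show ?thesis using continuous_inj_imp_mono[of c t d f] f(1,2) by auto
  qed auto
  have img: "f ` {c..d} = {min (f c) (f d)..max (f c) (f d)}"
  proof
    show "f ` {c..d} \<subseteq> {min (f c) (f d)..max (f c) (f d)}" using btw by blast
    have "f c \<in> f ` {c..d}" "f d \<in> f ` {c..d}" using cd by auto
    then have "min (f c) (f d) \<in> f ` {c..d}" "max (f c) (f d) \<in> f ` {c..d}"
      unfolding min_def max_def by presburger+
    then show "{min (f c) (f d)..max (f c) (f d)} \<subseteq> f ` {c..d}"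
      using con unfolding is_interval_1 by (meson atLeastAtMost_iff subsetI)
  qed
  have inj: "b u = b v \<longleftrightarrow> u = v" if "u \<in> J" "v \<in> J" for u v using b_inj that by (meson inj_on_eq_iff)
  have nonneg: "0 \<le> f c" "0 \<le> f d" using fcd J(2) by auto
  \<comment> \<open>\<open>p\<close> may run in either direction. The end of \<open>K\<close> at
    \<open>b 0\<close> has parameter 0, the least element of \<open>J\<close>.\<close>
  consider "b 0 = b (f c)" "z = b (f d)" | "b 0 = b (f d)" "z = b (f c)"
    using bds unfolding doubleton_eq_iff by blast
  then show thesis
  proof cases
    case 1
    then have "f c = 0" using inj[OF J(3) fcd(1)] by simp
    then show thesis using that[of "f d"] fcd img Kf 1 nonneg by auto
  next
    case 2
    then have "f d = 0" using inj[OF J(3) fcd(2)] by simp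
    then show thesis using that[of "f c"] fcd img Kf 2 nonneg by auto
  qed
qed

end

section \<open>Orientation of the adjacent translate\<close>

context acted_curve
begin

lemma arc_with_ends:
  assumes K: "connectedin X K" "compactin X K" "K \<noteq> points S" and bd: "seg_bd S K = {z0, z1}" "z0 \<noteq> z1"
  obtains a where "arcin X K 0 1 a" "a ` {0..1} = K" "a 0 = z0" "a 1 = z1"
proof -
  have zK: "z0 \<in> K" "z1 \<in> K" using bd(1) unfolding seg_bd_def by blast+
  obtain p x y where p: "arcin X K x y p" "p ` {x..y} = K"
    by (rule compact_arc[OF K zK bd(2)])
  have xy: "x < y" using p(1) by (simp add: arcin_def)
  have "{z0, z1} = {p x, p y}" using seg_bd_arc[OF ll p(1)] p(2) bd(1) by simp
  then have "z0 = p x \<and> z1 = p y \<or> z0 = p y \<and> z1 = p x" unfolding doubleton_eq_iff by blast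
  then obtain x' y' where xy': "z0 = p x'" "z1 = p y'" "x' = x \<and> y' = y \<or> x' = y \<and> y' = x" by blast
  \<comment> \<open>Negative when the parametrization found by \<open>compact_arc\<close> runs the
    wrong way.\<close>
  define m where "m = y' - x'"
  have m0: "m \<noteq> 0" using xy' xy by (auto simp: m_def)
  define a where "a = (\<lambda>t. p (m * t + x'))"
  have arc: "arcin X (p ` {x..y}) 0 1 a"
    unfolding a_def by (rule arcin_affine[OF p(1) m0]) (use xy' xy in \<open>auto simp: m_def\<close>)
  moreover have "p ` {x..y} \<subseteq> a ` {0..1}"
  proof
    fix w assume "w \<in> p ` {x..y}"
    then obtain u where u: "u \<in> {x..y}" "w = p u" by blast
    define t where "t = (u - x') / m"
    have "m * t + x' = u" using m0 by (simp add: t_def)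
    moreover have "t \<in> {0..1}"
    proof (cases "x' = x")
      case True
      then have "m = y - x" using xy' by (auto simp: m_def)
      then show ?thesis using True u(1) xy by (simp add: t_def)
    next
      case False
      then have "m = x - y" "x' = y" using xy' by (auto simp: m_def)
      then show ?thesis using u(1) xy by (simp add: t_def divide_nonpos_neg divide_le_eq)
    qed
    ultimately show "w \<in> a ` {0..1}" using u(2) unfolding a_def by (metis imageI)
  qed
  ultimately have "a ` {0..1} = K" using p(2) unfolding arcin_def by blast
  moreover have "a 0 = z0" "a 1 = z1" using xy' by (simp_all add: a_def m_def)
  ultimately show thesis using that arc p(2) by simp
qed

text \<open>\<open>D\<close> is the part of \<open>A\<close> carried onto \<open>B1\<close>: all of
  \<open>A\<close>, or a boundary segment of it when S ends with \<open>B1\<close>. The substance is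
  to locate the parameter \<open>e\<close> of \<open>z1\<close>.\<close>

lemma adjacent_setup:
  assumes A: "A \<in> Free" "compactin X A" "A \<subset> seg_int S (points S)" and pos: "positive_segment G M \<phi> S \<iota> A"
    and g: "g \<in> carrier G" and B1: "B1 \<in> segments S" "embedded M S \<iota> B1"
    and AB: "A \<inter> B1 = seg_bd S A \<inter> seg_bd S B1"
    and D: "D \<in> segments S" "D \<subseteq> A" "connectedin X (A - D)" "\<phi> g ` \<iota> ` D = \<iota> ` B1"
    and bd: "seg_bd S A = {z0, z1}" "z1 \<in> seg_bd S B1"
    and at_end: "\<And>B q. B \<in> Free \<Longrightarrow> compactin X B1 \<Longrightarrow> B1 \<subseteq> B \<Longrightarrow> arcin X B 0 1 q \<Longrightarrow>
      q 0 \<in> seg_bd S B1 \<Longrightarrow> q 0 \<noteq> z1 \<Longrightarrow> (\<And>u. 0 < u \<Longrightarrow> u \<le> 1 \<Longrightarrow> q u \<notin> B1) \<Longrightarrow> False"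
  obtains a b J where "adjacent_translate G M \<phi> S \<iota> A B1 g a b J" "a 0 = z0" "a 1 = z1" "a ` J = D"
proof -
  have seg: "connectedin X A" "\<exists>x\<in>A. \<exists>y\<in>A. x \<noteq> y" using A(1) by (auto simp: free_segments_def segments_def)
  have AS: "A \<subseteq> points S" using seg(1) connectedin_subset_topspace by blast
  have BS: "B1 \<subseteq> points S" using B1(1) connectedin_subset_topspace unfolding segments_def by blast
  have An: "A \<noteq> points S" using A(3) seg_int_subset[of S "points S"] by blast
  have z01: "z0 \<noteq> z1"
  proof
    assume z: "z0 = z1"
    obtain x y where xy: "x \<in> A" "y \<in> A" "x \<noteq> y" using seg(2) by blast
    obtain p c d where p: "arcin X A c d p" "p ` {c..d} = A" 
      by (rule compact_arc[OF seg(1) A(2) An xy])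
    have "p c = z0" "p d = z0" using seg_bd_arc[OF ll p(1)] p(2) bd(1) z by auto
    then show False using arcin_inj[OF p(1), of c d] p(1) by (auto simp: arcin_def)
  qed
  obtain a where a: "arcin X A 0 1 a" "a ` {0..1} = A" "a 0 = z0" "a 1 = z1"
    by (rule arc_with_ends[OF seg(1) A(2) An bd(1) z01])
  have aS: "a t \<in> points S" if "t \<in> {0..1}" for t using arcin_topspace[OF a(1)] that by blast
  \<comment> \<open>\<open>J\<close> and its complement in [0, 1] are both intervals, because
    \<open>D\<close> and the rest of \<open>A\<close> are connected.\<close>
  define J where "J = {t \<in> {0..1}. a t \<in> D}"
  have aJ: "a ` J = D" using D(2) a(2) by (auto simp: J_def)
  have J01: "J \<subseteq> {0..1}" by (auto simp: J_def)
  have hom: "homeomorphic_map (top_of_set {0..1}) (subtopology X A) a"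
    using arcin_homeomorphic[OF haus a(1)] a(2) by simp
  have "connectedin (subtopology X A) (a ` J)" using D(1,2) aJ by (simp add: segments_def connectedin_subtopology)
  then have Jc: "is_interval J"
    using homeomorphic_map_connectedness[OF hom, of J] J01
    by (simp add: connectedin_subtopology is_interval_connected_1)
  have "a ` ({0..1} - J) = A - D" using a(2) by (auto simp: J_def)
  then have "connectedin (subtopology X A) (a ` ({0..1} - J))" using D(3) by (simp add: connectedin_subtopology)
  then have Jcc: "is_interval ({0..1} - J)"
    using homeomorphic_map_connectedness[OF hom, of "{0..1} - J"]
    by (simp add: connectedin_subtopology is_interval_connected_1)
  have "continuous_map (top_of_set {0..1}) X a" using a(1) by (simp add: arcin_def)
  then have acJ: "continuous_map (top_of_set J) X a" using J01 continuous_map_from_subtopology_mono by blast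
  have "(\<lambda>t. \<phi> g (\<iota> (a t))) ` J \<subseteq> \<iota> ` B1"
    using D(4) aJ unfolding image_image[symmetric] by blast
  then obtain b where b: "continuous_map (top_of_set J) X b" "b ` J \<subseteq> B1" "\<And>t. t \<in> J \<Longrightarrow> \<iota> (b t) = \<phi> g (\<iota> (a t))"
    using embedded_lift[OF B1(2) BS translate_cont[OF g acJ]] by metis
  have bS: "b t \<in> points S" if "t \<in> J" for t using b(2) BS that by blast
  have bB: "b ` J = B1"
  proof
    show "B1 \<subseteq> b ` J"
    proof
      fix x assume x: "x \<in> B1"
      then have "\<iota> x \<in> \<phi> g ` \<iota> ` a ` J" using D(4) aJ by auto
      then obtain t where t: "t \<in> J" "\<iota> x = \<phi> g (\<iota> (a t))" by blast
      then have "\<iota> x = \<iota> (b t)" using b(3) by simp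
      then have "x = b t" using \<iota>_eq_iff x BS bS[OF t(1)] by blast
      then show "x \<in> b ` J" using t(1) by blast
    qed
  qed (rule b(2))
  have binj: "u = v" if "u \<in> J" "v \<in> J" "b u = b v" for u v
  proof -
    have "\<phi> g (\<iota> (a u)) = \<phi> g (\<iota> (a v))" using b(3)[OF that(1)] b(3)[OF that(2)] that(3) by simp
    moreover have u01: "u \<in> {0..1}" and v01: "v \<in> {0..1}" using J01 that by blast+
    ultimately have "a u = a v" using translate_inj[OF g aS[OF u01] aS[OF v01]] by blast
    then show ?thesis using arcin_inj[OF a(1) u01 v01] by blast
  qed
  have Jsub: "{c..d} \<subseteq> J" if "c \<in> J" "d \<in> J" for c d
    using Jc that unfolding is_interval_1 by (meson atLeastAtMost_iff subsetI)
  have Jarc: "arcin X B1 c d b" if cd: "c \<in> J" "d \<in> J" "c < d" for c d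
  proof -
    have "inj_on b {c..d}" using binj Jsub[OF cd(1,2)] by (meson inj_onI subsetD)
    moreover have "b ` {c..d} \<subseteq> B1" using Jsub[OF cd(1,2)] b(2) by blast
    ultimately show ?thesis
      using cd(3) continuous_map_from_subtopology_mono[OF b(1) Jsub[OF cd(1,2)]] by (simp add: arcin_def)
  qed
  \<comment> \<open>Inner parameters of \<open>J\<close> give inner points of \<open>B1\<close>, so
    the boundary point \<open>z1\<close> can only sit at an end of \<open>J\<close>.\<close>
  have Jint: "b u \<notin> seg_bd S B1" if "c \<in> J" "d \<in> J" "c < u" "u < d" for c d u
    using two_sided_seg_int[OF ll Jarc[OF that(1,2)] that(3,4)] that(3,4) by (simp add: seg_bd_def)
  have bdA: "t = 0 \<or> t = 1" if t: "t \<in> {0..1}" "a t \<in> seg_bd S A" for t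
  proof -
    have "a t = a 0 \<or> a t = a 1" using t(2) bd(1) a by auto
    then show ?thesis using arcin_inj[OF a(1) t(1), of 0] arcin_inj[OF a(1) t(1), of 1] by auto
  qed
  have inter: "(t = 0 \<or> t = 1) \<and> b u \<in> seg_bd S B1" if tu: "t \<in> {0..1}" "u \<in> J" "a t = b u" for t u
  proof -
    have "a t \<in> A" using tu(1) a(2) by blast
    moreover have "a t \<in> B1" unfolding tu(3) using tu(2) bB by blast
    ultimately have "a t \<in> seg_bd S A" "a t \<in> seg_bd S B1" using AB by blast+
    then show ?thesis using bdA[OF tu(1)] tu(3) by simp
  qed
  have zint: "a t \<in> seg_int S (points S)" if "t \<in> {0..1}" for t using A(3) a(2) that by blast
  have "z1 \<in> B1" using bd(2) by (simp add: seg_bd_def)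
  then obtain e where e: "e \<in> J" "b e = z1" using bB by blast
  have e01: "e \<in> {0..1}" using e(1) J01 by blast
  \<comment> \<open>A second parameter, which tells on which side of \<open>e\<close> the interval
    \<open>J\<close> lies.\<close>
  obtain c where c: "c \<in> J" "c \<noteq> e"
  proof -
    obtain x y where "x \<in> D" "y \<in> D" "x \<noteq> y" using D(1) unfolding segments_def by blast
    then show thesis using that aJ by (metis imageE)
  qed
  have c01: "c \<in> {0..1}" using c(1) J01 by blast
  have nonint: "\<not> (d < e \<and> e < d')" if "d \<in> J" "d' \<in> J" for d d'
    using Jint[OF that, of e] e(2) bd(2) by blast
  have "e \<noteq> 1"
  proof
    assume e1: "e = 1"
    \<comment> \<open>For 0 < t \<le> \<delta> the parameter 1 - t then lies strictly between
      \<open>c\<close> and 1, so b(1 - t) is an inner point of \<open>B1\<close> and not in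
      \<open>A\<close>.\<close>
    define \<delta> where "\<delta> = (1 - c) / 2"
    have cl: "c < 1" using c c01 e1 by auto
    have \<delta>: "0 < \<delta>" "\<delta> \<le> 1" "c < 1 - \<delta>" using cl c01 by (auto simp: \<delta>_def field_simps)
    have 1: "arcin X (b ` {c..1}) 0 \<delta> (\<lambda>t. b (1 - t))"
      using arcin_affine[OF Jarc[OF c(1) e(1)[unfolded e1] cl], of "-1" 0 \<delta> 1] \<delta> by simp
    show False
    proof (rule positive_outward[OF a(1,2) A(1) pos zint g 1 _ \<delta>(2)])
      show "b (1 - 0) = a 1" using e e1 a(4) by simp
      show "b (1 - t) \<notin> A" if t: "0 < t" "t \<le> \<delta>" for t
      proof
        assume "b (1 - t) \<in> A"
        moreover have uJ: "1 - t \<in> J"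
          by (rule subsetD[OF Jsub[OF c(1) e(1)[unfolded e1]]]) (use t \<delta> in auto)
        ultimately have "b (1 - t) \<in> seg_bd S B1" using AB bB by blast
        then show False using Jint[OF c(1) e(1)[unfolded e1], of "1 - t"] t \<delta> by simp
      qed
      show "\<phi> g (\<iota> (a (1 - t))) = \<iota> (b (1 - t))" if t: "t \<in> {0..\<delta>}" for t
        by (rule b(3)[symmetric], rule subsetD[OF Jsub[OF c(1) e(1)[unfolded e1]]]) (use t \<delta> in auto)
    qed simp
  qed
  moreover have "\<not> (0 < e \<and> e < 1)"
  proof
    assume ee: "0 < e \<and> e < 1"
    text \<open>\<open>w\<close> is the end of \<open>[0,1]\<close> on the side of \<open>e\<close> that \<open>J\<close> does not meet.\<close>
    define w :: real where "w = (if e < c then 0 else 1)"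
    have w01: "w \<in> {0..1}" "w \<noteq> e" using ee by (auto simp: w_def)
    have offJ: "(w - e) * u + e \<notin> J" if "0 < u" for u
    proof
      assume x: "(w - e) * u + e \<in> J"
      show False
      proof (cases "e < c")
        case True
        then have "(w - e) * u + e < e" using ee that by (simp add: w_def mult_less_0_iff)
        then show False using nonint[OF x c(1)] True by blast
      next
        case False
        then have "e < (w - e) * u + e" using ee that by (simp add: w_def)
        then show False using nonint[OF c(1) x] False c(2) by simp
      qed
    qed
    \<comment> \<open>\<open>p\<close> runs from a(e) into \<open>D\<close>, its image
      \<open>q\<close> from \<open>z1\<close> into \<open>B1\<close>, and \<open>q'\<close> from
      a(e) away from \<open>D\<close>.\<close>
    define p where "p = (\<lambda>u. a ((c - e) * u + e))"
    define q where "q = (\<lambda>u. b ((c - e) * u + e))"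
    define q' where "q' = (\<lambda>u. a ((w - e) * u + e))"
    have affJ: "(c - e) * u + e \<in> J" if u: "u \<in> {0..1}" for u
    proof -
      have "(c - e) * u + e = (1 - u) *\<^sub>R e + u *\<^sub>R c" by (simp add: algebra_simps)
      moreover have "\<dots> \<in> J"
        using Jc c(1) e(1) u unfolding is_interval_convex_1 by (intro convexD) auto
      ultimately show ?thesis by simp
    qed
    have p: "arcin X A 0 1 p"
      unfolding p_def a(2)[symmetric] by (rule arcin_affine[OF a(1)]) (use c c01 e01 in auto)
    have q': "arcin X A 0 1 q'"
      unfolding q'_def a(2)[symmetric] by (rule arcin_affine[OF a(1)]) (use w01 e01 in auto)
    have "inj_on q {0..1}"
    proof (rule inj_onI)
      fix u v assume uv: "u \<in> {0..1}" "v \<in> {0..1}" "q u = q v"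
      then have "(c - e) * u + e = (c - e) * v + e" using binj[OF affJ affJ] unfolding q_def by blast
      then show "u = v" using c(2) by simp
    qed
    moreover have "continuous_map (top_of_set {0..1}) (top_of_set J) (\<lambda>u. (c - e) * u + e)"
      using affJ by (auto intro!: continuous_intros)
    then have "continuous_map (top_of_set {0..1}) X q"
      using continuous_map_compose[OF _ b(1)] unfolding q_def comp_def by blast
    moreover have "q ` {0..1} \<subseteq> B1" using affJ b(2) unfolding q_def by blast
    ultimately have q: "arcin X B1 0 1 q" by (simp add: arcin_def)
    have pq: "\<phi> g (\<iota> (p u)) = \<iota> (q u)" if "u \<in> {0..1}" for u
      using b(3)[OF affJ[OF that]] by (simp add: p_def q_def)
    have pe: "p 0 = a e" and qe: "q 0 = a 1" using e(2) a(4) by (simp_all add: p_def q_def)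
    obtain P Q where PQ: "arcin X (points S) (-1) 1 P" "arcin X (points S) (-1) 1 Q" "P 0 = a e" "Q 0 = a 1"
      "\<And>u. u \<in> {-1..1} \<Longrightarrow> \<phi> g (\<iota> (P u)) = \<iota> (Q u)"
      using two_sided_extension[OF g p q pq] zint e01 pe qe by (metis atLeastAtMost_iff order_refl zero_le_one)
    have q'A: "q' ` {0..1} \<subseteq> A" using q' by (simp add: arcin_def)
    \<comment> \<open>The extended curve \<open>P\<close> passes through a(e), so one of its sides
      follows \<open>q'\<close>; the sign of \<open>m\<close> records which.\<close>
    obtain m where m: "m \<noteq> 0" "\<bar>m\<bar> \<le> 1" "\<And>u. u \<in> {0..1} \<Longrightarrow> P (m * u) \<in> q' ` {0..1}"
    proof (rule germ[OF PQ(1) _ _ q', of 0])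
      show "q' 0 = P 0" using PQ(3) by (simp add: q'_def)
      fix \<delta> assume d: "\<delta> > 0" "(0::real) + \<delta> \<le> 1" "P ` {0..0+\<delta>} \<subseteq> q' ` {0..1}"
      have "P (\<delta> * u) \<in> q' ` {0..1}" if "u \<in> {0..1}" for u
      proof -
        have "\<delta> * u \<in> {0..0+\<delta>}" using d(1) that by (auto simp: mult_left_le)
        then show ?thesis using d(3) by blast
      qed
      then show thesis using that[of \<delta>] d by simp
    next
      fix \<delta> assume d: "\<delta> > 0" "-1 \<le> (0::real) - \<delta>" "P ` {0-\<delta>..0} \<subseteq> q' ` {0..1}"
      have "P ((- \<delta>) * u) \<in> q' ` {0..1}" if "u \<in> {0..1}" for u
      proof -
        have "(- \<delta>) * u \<in> {0-\<delta>..0}" using d(1) that by (auto simp: mult_left_le)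
        then show ?thesis using d(3) by blast
      qed
      then show thesis using that[of "- \<delta>"] d by simp
    qed auto
    define P' where "P' = (\<lambda>u. P (m * u + 0))"
    define Q' where "Q' = (\<lambda>u. Q (m * u + 0))"
    have mb: "-1 \<le> m" "m \<le> 1" using m(2) by auto
    have P': "arcin X (P ` {-1..1}) 0 1 P'" unfolding P'_def by (rule arcin_affine[OF PQ(1) m(1)]) (use mb in auto)
    have Q': "arcin X (Q ` {-1..1}) 0 1 Q'" unfolding Q'_def by (rule arcin_affine[OF PQ(2) m(1)]) (use mb in auto)
    have P'q: "P' u \<in> q' ` {0..1}" if "u \<in> {0..1}" for u using m(3)[OF that] by (simp add: P'_def)
    have PQ': "\<phi> g (\<iota> (P' u)) = \<iota> (Q' u)" if u: "u \<in> {0..1}" for u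
    proof -
      have "\<bar>m * u\<bar> \<le> 1 * 1" unfolding abs_mult using m(2) u by (intro mult_mono) auto
      then have "m * u + 0 \<in> {-1..1}" by (auto simp: abs_le_iff)
      then show ?thesis using PQ(5) unfolding P'_def Q'_def by blast
    qed
    have Q'0: "Q' 0 = a 1" using PQ(4) by (simp add: Q'_def)
    \<comment> \<open>\<open>q\<close> on the parameters from 1 to 2, to be attached to
      \<open>a\<close> at \<open>z1\<close>. On the joined arc the image of the side of
      \<open>P\<close> along \<open>q'\<close> leaves \<open>z1\<close> either into
      \<open>B1\<close> or into \<open>A\<close>.\<close>
    define r where "r = (\<lambda>u. q ((1/2) * u + - (1/2)))"
    have r: "arcin X (q ` {0..1}) 1 2 r" unfolding r_def by (rule arcin_affine[OF q]) auto
    have rB: "r u = b ((c - e) * ((u - 1) / 2) + e)" for u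
    proof -
      have "(1/2) * u + - (1/2) = (u - 1) / 2" by (simp add: field_simps)
      then show ?thesis by (simp only: r_def q_def)
    qed
    have rA: "r u \<notin> A" if u: "1 < u" "u \<le> 2" for u
    proof
      assume "r u \<in> A"
      then obtain t where t: "t \<in> {0..1}" "a t = r u" using a(2) by (metis imageE)
      let ?v = "(c - e) * ((u - 1) / 2) + e"
      have vJ: "?v \<in> J" by (rule affJ) (use u in auto)
      have bd: "b ?v \<in> seg_bd S B1" using inter[OF t(1) vJ] t(2) rB by simp
      have 1: "?v - e = (c - e) * ((u - 1) / 2)" and 2: "c - ?v = (c - e) * (1 - (u - 1) / 2)"
        by (simp_all add: algebra_simps)
      show False
      proof (cases "e < c")
        case True
        then have "?v - e > 0" "c - ?v > 0" unfolding 1 2 using u by auto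
        then show False using Jint[OF e(1) c(1), of ?v] bd by simp
      next
        case False
        then have "e - c > 0" using c(2) by simp
        then have "?v - e < 0" "c - ?v < 0" unfolding 1 2 using u by (auto simp: mult_less_0_iff)
        then show False using Jint[OF c(1) e(1), of ?v] bd by simp
      qed
    qed
    have R: "arcin X (A \<union> q ` {0..1}) 0 2 (\<lambda>t. if t \<le> 1 then a t else r t)"
    proof (rule arcin_join[OF a(1) r])
      show "a 1 = r 1" using qe by (simp add: r_def)
      fix t u assume tu: "t \<in> {0..1}" "u \<in> {1..2}" "a t = r u"
      have "r u \<in> A" using tu a(2) by (metis imageI)
      then have "u = 1" using rA[of u] tu(2) by force
      then show "t = 1 \<and> u = 1" using tu qe arcin_inj[OF a(1) tu(1), of 1] by (simp add: r_def)
    qed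
    show False
    proof (rule germ[OF R _ _ Q', of 1])
      show "Q' 0 = (if (1::real) \<le> 1 then a 1 else r 1)" using Q'0 by simp
    next
      \<comment> \<open>Into \<open>B1\<close>: the points reached are also images of points of
        \<open>D\<close>. Translation is injective, but beyond its start \<open>q'\<close> has no
        parameters in \<open>J\<close>.\<close>
      fix \<delta> :: real assume d: "\<delta> > 0" "1 + \<delta> \<le> 2" "(\<lambda>t. if t \<le> 1 then a t else r t) ` {1..1+\<delta>} \<subseteq> Q' ` {0..1}"
      have "(\<lambda>t. if t \<le> 1 then a t else r t) (1 + \<delta>) \<in> Q' ` {0..1}"
        by (rule subsetD[OF d(3)], rule imageI) (use d in auto)
      then have "r (1 + \<delta>) \<in> Q' ` {0..1}" using d(1) by simp
      then obtain u where u: "u \<in> {0..1}" "Q' u = r (1 + \<delta>)" by (metis imageE)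
      let ?v = "(c - e) * (\<delta> / 2) + e"
      have vJ: "?v \<in> J" by (rule affJ) (use d in auto)
      have v01: "?v \<in> {0..1}" using vJ J01 by blast
      have "\<phi> g (\<iota> (P' u)) = \<phi> g (\<iota> (a ?v))" using PQ'[OF u(1)] u(2) rB[of "1 + \<delta>"] b(3)[OF vJ] by simp
      moreover have "P' u \<in> points S" using arcin_topspace[OF P'] u(1) by blast
      ultimately have "P' u = a ?v" using translate_inj[OF g _ aS[OF v01]] by blast
      then obtain x where x: "x \<in> {0..1}" "a ?v = q' x" using P'q[OF u(1)] by (metis imageE)
      have x01: "(w - e) * x + e \<in> {0..1}"
      proof -
        have "(w - e) * x + e = (1 - x) *\<^sub>R e + x *\<^sub>R w" by (simp add: algebra_simps)
        moreover have "\<dots> \<in> {0..1}"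
          using e01 w01(1) x(1) convex_real_interval(5)[of 0 1] by (intro convexD) auto
        ultimately show ?thesis by simp
      qed
      have vx: "?v = (w - e) * x + e" using x(2) arcin_inj[OF a(1) v01 x01] by (simp add: q'_def)
      have "x = 0" using offJ[of x] vJ vx x(1) by force
      then show False using vx c(2) d(1) by simp
    next
      \<comment> \<open>Into \<open>A\<close>: then \<open>g\<close> takes an arc of
        \<open>A\<close> to an arc of \<open>A\<close> and fixes \<iota>(S), although it sends
        \<iota>(a(e)) to \<iota>(a(1)).\<close>
      fix \<delta> :: real assume d: "\<delta> > 0" "0 \<le> 1 - \<delta>" "(\<lambda>t. if t \<le> 1 then a t else r t) ` {1-\<delta>..1} \<subseteq> Q' ` {0..1}"
      have aQ: "a t \<in> Q' ` {0..1}" if t: "t \<in> {1-\<delta>..1}" for t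
      proof -
        have "(\<lambda>t. if t \<le> 1 then a t else r t) t \<in> Q' ` {0..1}"
          by (rule subsetD[OF d(3)], rule imageI) (rule t)
        then show ?thesis using t by simp
      qed
      have ad: "arcin X (a ` {1-\<delta>..1}) (1 - \<delta>) 1 a" using arcin_sub[OF a(1), of "1 - \<delta>" 1] d by simp
      have adA: "arcin X A (1 - \<delta>) 1 a" by (rule arcin_mono[OF ad]) (use d a(2) in auto)
      have "arcin X (Q' ` {0..1}) (1 - \<delta>) 1 a" by (rule arcin_mono[OF ad]) (use aQ in blast)
      then obtain f where f: "continuous_on {1-\<delta>..1} f" "inj_on f {1-\<delta>..1}"
        "\<And>t. t \<in> {1-\<delta>..1} \<Longrightarrow> f t \<in> {0..1}" "\<And>t. t \<in> {1-\<delta>..1} \<Longrightarrow> Q' (f t) = a t"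
        using arc_factor[OF Q'] by blast
      have fi: "f ` {1-\<delta>..1} \<subseteq> {0..1}" using f(3) by blast
      have "arcin X (P' ` f ` {1-\<delta>..1}) (1 - \<delta>) 1 (P' \<circ> f)" by (rule arcin_comp[OF P' f(1,2) fi]) (use d in simp)
      moreover have "P' ` f ` {1-\<delta>..1} \<subseteq> A" using P'q fi q'A by blast
      ultimately have Pf: "arcin X A (1 - \<delta>) 1 (P' \<circ> f)" using arcin_mono by blast
      have "\<phi> g (\<iota> ((P' \<circ> f) t)) = \<iota> (a t)" if "t \<in> {1-\<delta>..1}" for t
        using PQ'[OF f(3)[OF that]] f(4)[OF that] by simp
      then have "g \<in> H" using free_arcs[OF A(1) g Pf adA] by blast
      then have "\<phi> g (\<iota> (a e)) = \<iota> (a e)" using aS[OF e01] unfolding H_iff by blast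
      then have "\<iota> (a e) = \<iota> (a 1)" using b(3)[OF e(1)] e(2) a(4) by simp
      then have "a e = a 1" using \<iota>_eq_iff aS e01 by (metis atLeastAtMost_iff order_refl zero_le_one)
      then show False using arcin_inj[OF a(1) e01, of 1] ee by simp
    qed auto
  qed
  ultimately have e0: "e = 0" using e01 by auto
  have "adjacent_translate G M \<phi> S \<iota> A B1 g a b J"
  proof (intro adjacent_translate.intro adjacent_translate_axioms.intro)
    show "acted_curve G M \<phi> S \<iota>" ..
    show "A \<in> Free" by (rule A(1))
    show "g \<in> carrier G" by (rule g)
    show "arcin X A 0 1 a" "a ` {0..1} = A" by (rule a)+
    show "is_interval J" "J \<subseteq> {0..1}" by (rule Jc, rule J01)
    show J0: "0 \<in> J" using e(1) e0 by simp
    show "continuous_map (top_of_set J) X b" "inj_on b J" "b ` J = B1" using b(1) binj bB by (auto intro: inj_onI)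
    show "\<phi> g (\<iota> (a t)) = \<iota> (b t)" if "t \<in> J" for t using b(3)[OF that] by simp
    show b01: "b 0 = a 1" using e e0 a(4) by simp
    \<comment> \<open>The second alternative does occur: on a circle made of two segments, both ends
      of \<open>A\<close> lie on \<open>B1\<close>.\<close>
    show "t = 1 \<and> u = 0 \<or> t = 0 \<and> 0 < u \<and> (\<forall>v\<in>J. v \<le> u)" if tu: "t \<in> {0..1}" "u \<in> J" "a t = b u" for t u
    proof (cases "t = 1")
      case True
      then have "b u = b 0" using tu b01 by simp
      then show ?thesis using True binj[OF tu(2) J0] by simp
    next
      case False
      then have t0: "t = 0" using inter[OF tu] by simp
      have "u \<noteq> 0" using tu t0 b01 arcin_inj[OF a(1), of 0 1] by auto
      then have u0: "0 < u" using tu(2) J01 by force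
      moreover have "v \<le> u" if "v \<in> J" for v
        using Jint[OF J0 that u0] inter[OF tu] by force
      ultimately show ?thesis using t0 by blast
    qed
    show False if h: "B \<in> Free" "s \<in> J" "0 < s" "\<And>v. v \<in> J \<Longrightarrow> v \<le> s" "B1 \<subseteq> B"
      "arcin X B 0 1 q" "q 0 = b s" "\<And>u. 0 < u \<Longrightarrow> u \<le> 1 \<Longrightarrow> q u \<notin> B1" for B q s
    proof -
      \<comment> \<open>With a last parameter \<open>s\<close> the interval \<open>J\<close> is
        closed, and \<open>B1\<close> is a compact arc ending at \<open>b s\<close>.\<close>
      have "J = {0..s}" using Jsub[OF J0 h(2)] h(4) J01 by auto
      then have Bs: "B1 = b ` {0..s}" using bB by simp
      note bs = Jarc[OF J0 h(2,3)]
      have "compactin X B1" unfolding Bs by (rule arcin_compactin[OF bs])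
      moreover have "q 0 \<in> seg_bd S B1" unfolding Bs h(7) seg_bd_arc[OF ll bs] by simp
      moreover have "q 0 \<noteq> z1" using h(3,7) e e0 binj[OF h(2) J0] by auto
      ultimately show False using at_end[OF h(1) _ h(5,6)] h(8) by blast
    qed
  qed
  then show thesis using that a(3,4) aJ by blast
qed

section \<open>The end of the adjacent segment\<close>

text \<open>The image of the complement is an interval that avoids [c, d], so one value below
  \<open>c\<close> keeps all of it below \<open>c\<close>. By the intermediate value theorem every
  arc leaving \<open>B1\<close> starts where \<open>f\<close> equals \<open>c\<close>.\<close>

lemma connected_complement_end_aux:
  assumes f: "continuous_map X euclideanreal f" "inj_on f (points S)"
    and con: "connectedin X (points S - B1)" and B1: "B1 \<subseteq> points S" "f ` B1 = {c..d}"
    and p: "arcin X C 0 1 p" "p 0 \<in> B1" "\<And>u. 0 < u \<Longrightarrow> u \<le> 1 \<Longrightarrow> p u \<notin> B1"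
    and q: "arcin X C' 0 1 q" "q 0 \<in> B1" "\<And>u. 0 < u \<Longrightarrow> u \<le> 1 \<Longrightarrow> q u \<notin> B1"
    and less: "f (p 1) < c"
  shows "p 0 = q 0"
proof -
  have "is_interval (f ` (points S - B1))"
    using connectedin_continuous_map_image[OF f(1) con] by (simp add: is_interval_connected_1)
  note int = this[unfolded is_interval_1]
  have disj: "f x \<notin> {c..d}" if x: "x \<in> points S - B1" for x
  proof
    assume "f x \<in> {c..d}"
    then obtain y where "y \<in> B1" "f x = f y" using B1(2) by (metis imageE)
    then show False using f(2) x B1(1) by (metis Diff_iff inj_on_eq_iff subsetD)
  qed
  have "f (p 0) \<in> {c..d}" using p(2) B1(2) by blast
  then have cd: "c \<le> d" by simp
  have p1: "p 1 \<in> points S - B1" using p(3)[of 1] arcin_topspace[OF p(1)] by auto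
  have below: "f x < c" if x: "x \<in> points S - B1" for x
  proof (rule ccontr)
    assume "\<not> f x < c"
    then have "c \<in> f ` (points S - B1)"
      using int p1 x less by (meson imageI less_imp_le not_less)
    then show False using disj cd by force
  qed
  have start: "f (r 0) = c" if r: "arcin X E 0 1 r" "r 0 \<in> B1" "\<And>u. 0 < u \<Longrightarrow> u \<le> 1 \<Longrightarrow> r u \<notin> B1" for r E
  proof (rule ccontr)
    assume n: "f (r 0) \<noteq> c"
    have "f (r 0) \<in> {c..d}" using r(2) B1(2) by blast
    then have 0: "c < f (r 0)" using n by simp
    have rS: "r u \<in> points S" if "u \<in> {0..1}" for u using arcin_topspace[OF r(1)] that by blast
    have "continuous_map (top_of_set {0..1}) euclideanreal (f \<circ> r)"
      using r(1) f(1) continuous_map_compose unfolding arcin_def by blast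
    then have co: "continuous_on {0..1} (\<lambda>u. f (r u))" by (simp add: comp_def)
    have 1: "f (r 1) \<le> c" using below[of "r 1"] rS[of 1] r(3)[of 1] by simp
    obtain u where u: "0 \<le> u" "u \<le> 1" "f (r u) = c"
      using IVT2'[OF 1 less_imp_le[OF 0] zero_le_one co] by blast
    then have "0 < u" using 0 by (cases "u = 0") auto
    then show False using below[of "r u"] rS[of u] r(3)[of u] u by simp
  qed
  have "f (p 0) = f (q 0)" using start[OF p] start[OF q] by simp
  then show ?thesis using f(2) p(2) q(2) B1(1) by (meson inj_on_eq_iff subsetD)
qed

text \<open>A boundary segment of an interval has a single exit. When S stops behind
  \<open>B1\<close>, this exit is taken by the preceding segment.\<close>

lemma connected_complement_end:
  assumes S: "interval_like S" and con: "connectedin X (points S - B1)"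
    and B1: "connectedin X B1" "compactin X B1"
    and p: "arcin X C 0 1 p" "p 0 \<in> B1" "\<And>u. 0 < u \<Longrightarrow> u \<le> 1 \<Longrightarrow> p u \<notin> B1"
    and q: "arcin X C' 0 1 q" "q 0 \<in> B1" "\<And>u. 0 < u \<Longrightarrow> u \<le> 1 \<Longrightarrow> q u \<notin> B1"
  shows "p 0 = q 0"
proof -
  obtain D \<upsilon> f where f: "homeomorphic_maps (top_of_set D) X \<upsilon> f" "nondegenerate_interval D"
    using S unfolding interval_like_def homeomorphic_space_def by blast
  have "continuous_map X (top_of_set D) f" using f(1) by (simp add: homeomorphic_maps_def)
  then have fc: "continuous_map X euclideanreal f" by (simp add: continuous_map_in_subtopology)
  have fi: "inj_on f (points S)"
    using f(1) unfolding homeomorphic_maps_def by (metis inj_on_inverseI)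
  have BS: "B1 \<subseteq> points S" using B1(1) connectedin_subset_topspace by blast
  have "connected (f ` B1)" "compact (f ` B1)"
    using connectedin_continuous_map_image[OF fc B1(1)] image_compactin[OF B1(2) fc] by simp_all
  then obtain c d where cd: "f ` B1 = {c..d}" using connected_compact_interval_1 by metis
  have "f (p 1) \<notin> {c..d}"
  proof
    assume "f (p 1) \<in> {c..d}"
    then obtain y where "y \<in> B1" "f (p 1) = f y" using cd by (metis imageE)
    moreover have "p 1 \<in> points S" using arcin_topspace[OF p(1)] by auto
    ultimately have "p 1 \<in> B1" using fi BS by (metis inj_on_eq_iff subsetD)
    then show False using p(3)[of 1] by simp
  qed
  then consider "f (p 1) < c" | "d < f (p 1)" by fastforce
  then show ?thesis
  proof cases
    case 1
    show ?thesis by (rule connected_complement_end_aux[OF fc fi con BS cd p q 1])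
  next
    case 2
    \<comment> \<open>Reflecting the coordinate exchanges the two sides.\<close>
    have f': "continuous_map X euclideanreal (\<lambda>x. - f x)" "inj_on (\<lambda>x. - f x) (points S)"
      using fc fi by (auto intro!: continuous_intros simp: inj_on_def)
    have img: "(\<lambda>x. - f x) ` B1 = {-d..-c}"
      using cd image_image[of uminus f B1] by simp
    have less: "- f (p 1) < - d" using 2 by simp
    show ?thesis by (rule connected_complement_end_aux[OF f' con BS img p q less])
  qed
qed

text \<open>A free \<open>B\<close> running past \<open>w\<close> contains a germ of
  \<open>B2\<close>. The product of \<open>g1\<close> with the inverse of \<open>g2\<close> carries
  this germ into \<open>B1\<close>, hence fixes \<iota>(S); but beyond its start the germ lies
  outside \<open>B1\<close>.\<close>

lemma next_translate_end:
  assumes g1: "g1 \<in> carrier G" "\<phi> g1 ` \<iota> ` A = \<iota> ` B1" and g2: "g2 \<in> carrier G" "\<phi> g2 ` \<iota> ` C2 = \<iota> ` B2" "C2 \<subseteq> A"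
    and A: "A \<subseteq> points S" "compactin X A" and B2: "B2 \<in> segments S" "B1 \<inter> B2 = {w}"
    and B1: "connectedin X B1" "compactin X B1" "B1 \<noteq> points S" "seg_bd S B1 = {z1, w}" "z1 \<noteq> w"
    and B: "B \<in> Free" "B1 \<subseteq> B" and q: "arcin X B 0 1 q" "q 0 = w" "\<And>u. 0 < u \<Longrightarrow> u \<le> 1 \<Longrightarrow> q u \<notin> B1"
  shows False
proof -
  obtain \<beta> where \<beta>: "arcin X B1 0 1 \<beta>" "\<beta> ` {0..1} = B1" "\<beta> 0 = z1" "\<beta> 1 = w"
    by (rule arc_with_ends[OF B1])
  have BS: "B1 \<subseteq> points S" using B1(1) connectedin_subset_topspace by blast
  have con2: "connectedin X B2" using B2(1) by (simp add: segments_def)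
  obtain y where y: "y \<in> B2" "y \<noteq> w" using B2(1) unfolding segments_def by blast
  have wB2: "w \<in> B2" using B2(2) by blast
  obtain r where r: "arcin X B2 0 1 r" "r 0 = w" "r 1 = y"
    using arc_between[OF con2 wB2 y(1)] y(2) by metis
  have rB2: "r u \<in> B2" if "u \<in> {0..1}" for u using r(1) that by (auto simp: arcin_def)
  have rB1: "r u \<notin> B1" if u: "0 < u" "u \<le> 1" for u
  proof
    assume "r u \<in> B1"
    then have "r u = r 0" using rB2[of u] u B2(2) r(2) by auto
    then show False using arcin_inj[OF r(1), of u 0] u by simp
  qed
  have r': "arcin X (r ` {0..1}) 1 2 (\<lambda>u. r (1 * u + - 1))" by (rule arcin_affine[OF r(1)]) auto
  \<comment> \<open>\<open>B1\<close> followed by an arc of \<open>B2\<close>; on it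
    \<open>germ\<close> forces the outgoing arc \<open>q\<close> to run along
    \<open>B2\<close>.\<close>
  have R: "arcin X (B1 \<union> r ` {0..1}) 0 2 (\<lambda>t. if t \<le> 1 then \<beta> t else r (1 * t + - 1))"
  proof (rule arcin_join[OF \<beta>(1) r'])
    show "\<beta> 1 = r (1 * 1 + - 1)" using \<beta>(4) r(2) by simp
    fix t u assume tu: "t \<in> {0..1}" "u \<in> {1..2}" "\<beta> t = r (1 * u + - 1)"
    have "r (u - 1) \<in> B1" using tu \<beta>(2) by (metis add.commute diff_conv_add_uminus imageI mult_1)
    then have "u = 1" using rB1[of "u - 1"] tu(2) by force
    then show "t = 1 \<and> u = 1" using tu r(2) \<beta>(4) arcin_inj[OF \<beta>(1) tu(1), of 1] by simp
  qed
  have qB: "q ` {0..1} \<subseteq> B" using q(1) by (simp add: arcin_def)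
  have "\<exists>\<delta>>0. \<delta> \<le> 1 \<and> r ` {0..\<delta>} \<subseteq> B"
  proof (rule germ[OF R _ _ q(1), of 1])
    show "q 0 = (if (1::real) \<le> 1 then \<beta> 1 else r (1 * 1 + - 1))" using q(2) \<beta>(4) by simp
  next
    fix \<delta> :: real
    assume d: "\<delta> > 0" "1 + \<delta> \<le> 2" "(\<lambda>t. if t \<le> 1 then \<beta> t else r (1 * t + - 1)) ` {1..1+\<delta>} \<subseteq> q ` {0..1}"
    have "r u \<in> B" if u: "u \<in> {0..\<delta>}" for u
    proof -
      have "(\<lambda>t. if t \<le> 1 then \<beta> t else r (1 * t + - 1)) (1 + u) \<in> q ` {0..1}"
        by (rule subsetD[OF d(3)], rule imageI) (use u in auto)
      moreover have "(\<lambda>t. if t \<le> 1 then \<beta> t else r (1 * t + - 1)) (1 + u) = r u"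
        using u \<beta>(4) r(2) by (cases "u = 0") auto
      ultimately show ?thesis using qB by auto
    qed
    then show ?thesis using d by auto
  next
    fix \<delta> :: real
    assume d: "\<delta> > 0" "0 \<le> 1 - \<delta>" "(\<lambda>t. if t \<le> 1 then \<beta> t else r (1 * t + - 1)) ` {1-\<delta>..1} \<subseteq> q ` {0..1}"
    have "(\<lambda>t. if t \<le> 1 then \<beta> t else r (1 * t + - 1)) (1 - \<delta>) \<in> q ` {0..1}"
      by (rule subsetD[OF d(3)], rule imageI) (use d in auto)
    then have "\<beta> (1 - \<delta>) \<in> q ` {0..1}" using d by simp
    then obtain u where u: "u \<in> {0..1}" "\<beta> (1 - \<delta>) = q u" by (metis imageE)
    have b1: "\<beta> (1 - \<delta>) \<in> B1" unfolding \<beta>(2)[symmetric] by (rule imageI) (use d in auto)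
    have "u = 0" using q(3)[of u] u b1 by force
    then have "\<beta> (1 - \<delta>) = \<beta> 1" using u q(2) \<beta>(4) by simp
    then have False using arcin_inj[OF \<beta>(1), of "1 - \<delta>" 1] d by simp
    then show ?thesis ..
  qed auto
  then obtain \<delta> where \<delta>: "\<delta> > 0" "\<delta> \<le> 1" "r ` {0..\<delta>} \<subseteq> B" by blast
  have r0: "arcin X (r ` {0..\<delta>}) 0 \<delta> r" using arcin_sub[OF r(1), of 0 \<delta>] \<delta> by simp
  have rB: "arcin X B 0 \<delta> r" by (rule arcin_mono[OF r0 \<delta>(3)])
  have rS: "r u \<in> points S" if "u \<in> {0..\<delta>}" for u using arcin_topspace[OF r0] that by blast
  have im1: "\<phi> (inv\<^bsub>G\<^esub> g2) (\<iota> (r u)) \<in> \<iota> ` A" if u: "u \<in> {0..\<delta>}" for u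
  proof -
    have "\<iota> (r u) \<in> \<phi> g2 ` \<iota> ` C2" using rB2[of u] u \<delta>(2) g2(2) by auto
    then obtain x where x: "x \<in> C2" "\<iota> (r u) = \<phi> g2 (\<iota> x)" by blast
    then have "\<phi> (inv\<^bsub>G\<^esub> g2) (\<iota> (r u)) = \<iota> x" using \<phi>_inv[OF g2(1)] \<iota>_in g2(3) A(1) by (metis subsetD)
    then show ?thesis using x(1) g2(3) by blast
  qed
  obtain p where p: "arcin X A 0 \<delta> p" "\<And>u. u \<in> {0..\<delta>} \<Longrightarrow> \<phi> (inv\<^bsub>G\<^esub> g2) (\<iota> (r u)) = \<iota> (p u)"
    using transport[OF inv_closed[OF g2(1)] r0 compact_embedded[OF A(2) order_refl] A(1) im1] by blast
  have im2: "\<phi> g1 (\<iota> (p u)) \<in> \<iota> ` B1" if u: "u \<in> {0..\<delta>}" for u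
  proof -
    have "p u \<in> A" using p(1) u by (auto simp: arcin_def)
    then show ?thesis using g1(2) by blast
  qed
  obtain p' where p': "arcin X B1 0 \<delta> p'" "\<And>u. u \<in> {0..\<delta>} \<Longrightarrow> \<phi> g1 (\<iota> (p u)) = \<iota> (p' u)"
    using transport[OF g1(1) p(1) compact_embedded[OF B1(2) order_refl] BS im2] by blast
  let ?k = "g1 \<otimes>\<^bsub>G\<^esub> inv\<^bsub>G\<^esub> g2"
  have k: "?k \<in> carrier G" using g1(1) g2(1) mult_closed inv_closed by simp
  have kr: "\<phi> ?k (\<iota> (r u)) = \<iota> (p' u)" if u: "u \<in> {0..\<delta>}" for u
    using \<phi>_mult[OF g1(1) inv_closed[OF g2(1)] \<iota>_in[OF rS[OF u]]] p(2)[OF u] p'(2)[OF u] by simp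
  have kH: "?k \<in> H" by (rule free_arcs[OF B(1) k rB arcin_mono[OF p'(1) B(2)] kr])
  have dd: "\<delta> \<in> {0..\<delta>}" using \<delta>(1) by simp
  have p'B: "p' \<delta> \<in> B1" using p'(1) dd unfolding arcin_def by blast
  have "\<iota> (r \<delta>) = \<iota> (p' \<delta>)" using kr[OF dd] kH rS[OF dd] unfolding H_iff by simp
  then have "r \<delta> = p' \<delta>" using \<iota>_eq_iff[OF rS[OF dd]] p'B BS by blast
  then show False using rB1[OF \<delta>(1,2)] p'B by simp
qed

text \<open>Common to circle and interval, which differ in the choice of \<open>D\<close> and in the
  reason behind \<open>at_end\<close>.\<close>

lemma adjacent_conclusion:
  assumes A: "A \<in> Free" "compactin X A" "A \<subset> seg_int S (points S)"
    and pos: "positive_submanifold G M \<phi> S \<iota>" and posA: "positive_segment G M \<phi> S \<iota> A"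
    and g: "g \<in> carrier G" and B1: "B1 \<in> segments S" "embedded M S \<iota> B1"
    and AB: "A \<inter> B1 = seg_bd S A \<inter> seg_bd S B1"
    and D: "D \<in> segments S" "D \<subseteq> A" "connectedin X (A - D)" "\<phi> g ` \<iota> ` D = \<iota> ` B1"
    and bd: "seg_bd S A = {z0, z1}" "z1 \<in> seg_bd S B1"
    and at_end: "\<And>B q. B \<in> Free \<Longrightarrow> compactin X B1 \<Longrightarrow> B1 \<subseteq> B \<Longrightarrow> arcin X B 0 1 q \<Longrightarrow>
      q 0 \<in> seg_bd S B1 \<Longrightarrow> q 0 \<noteq> z1 \<Longrightarrow> (\<And>u. 0 < u \<Longrightarrow> u \<le> 1 \<Longrightarrow> q u \<notin> B1) \<Longrightarrow> False"
    and K: "K \<in> segments S" "compactin X K" "K \<subseteq> B1" "seg_bd S K = {z1, z1'}"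
  shows "\<phi> g (\<iota> z0) = \<iota> z1 \<and>
    (\<exists>A' \<in> max_free_segments G M \<phi> S \<iota>. \<exists>z0' \<in> A.
       compactin X A' \<and> positive_segment G M \<phi> S \<iota> A' \<and>
       A' \<subseteq> A \<union> B1 \<and> K \<subseteq> A' \<and> seg_bd S A' = {z0', z1'} \<and>
       (z1' \<in> seg_int S B1 \<longrightarrow>
          z0' \<in> seg_int S A \<and> z1 \<in> seg_int S A' \<and> A' \<subset> seg_int S (A \<union> B1)) \<and>
       (K = B1 \<and> (\<exists>B. boundary_segment S A B \<and> \<phi> g ` \<iota> ` B = \<iota> ` B1 \<and> B \<subset> A) \<longrightarrow>
          z0' \<in> seg_int S A \<and> z1 \<in> seg_int S A' \<and> A' \<subseteq> A \<union> B1))"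
proof -
  obtain a b J where t: "adjacent_translate G M \<phi> S \<iota> A B1 g a b J" and az: "a 0 = z0" "a 1 = z1" and aJ: "a ` J = D"
    by (rule adjacent_setup[OF A posA g B1 AB D bd at_end])
  interpret adjacent_translate G M \<phi> S \<iota> A B1 g a b J by (rule t)
  have bz: "b 0 = z1" using b0 az by simp
  have AS: "A \<subseteq> points S" using arcin_topspace[OF a] aA by simp
  \<comment> \<open>Otherwise \<open>A\<close> would lie in \<open>B1\<close>, but the two share
    only boundary points.\<close>
  have Kn: "K \<noteq> points S"
  proof
    assume "K = points S"
    moreover have "a (1/2) \<in> A" using aA by force
    ultimately have "a (1/2) \<in> A \<inter> B1" using K(3) AS by blast
    then have "a (1/2) \<in> {a 0, a 1}" using AB bd(1) az by blast
    then show False using arcin_inj[OF a, of "1/2" 0] arcin_inj[OF a, of "1/2" 1] by auto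
  qed
  obtain s where s: "s \<in> J" "0 < s" "K = b ` {0..s}" "z1' = b s"
    by (rule compact_subsegment[OF K(1-3) K(4)[folded bz] Kn])
  obtain A' where A': "A' \<in> max_free_segments G M \<phi> S \<iota>" "compactin X A'" "A' \<subseteq> A \<union> B1" "b ` {0..s} \<subseteq> A'"
    "seg_bd S A' = {a s, b s}" "a s \<in> A"
    "b s \<in> seg_int S B1 \<Longrightarrow> s < 1 \<and> A' \<subset> seg_int S (A \<union> B1)"
    "s < 1 \<Longrightarrow> a s \<in> seg_int S A \<and> a 1 \<in> seg_int S A'"
    by (rule shift_segment[OF s(1,2)]) (rule that; blast)
  have "positive_segment G M \<phi> S \<iota> A'" using pos A'(1,2) unfolding positive_submanifold_def by blast
  moreover have "\<phi> g (\<iota> z0) = \<iota> z1" using eq[OF J(3)] az bz by simp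
  \<comment> \<open>If \<open>s\<close> were 1, all of \<open>A\<close> would be carried onto
    \<open>B1\<close>. A proper part of \<open>A\<close> cannot have the same image, as translation
    is injective.\<close>
  moreover have "s < 1" if BA: "B \<subset> A" "\<phi> g ` \<iota> ` B = \<iota> ` B1" for B
  proof (rule ccontr)
    assume "\<not> s < 1"
    then have "s = 1" using J_le[OF s(1)] by simp
    then have "{0..1} \<subseteq> J" using J_sub[OF s(1)] by simp
    then have "A = D" using aA aJ D(2) by blast
    then have "\<phi> g ` \<iota> ` A \<subseteq> \<phi> g ` \<iota> ` B" using D(4) BA(2) by simp
    moreover obtain x where x: "x \<in> A" "x \<notin> B" using BA(1) by blast
    ultimately obtain y where y: "y \<in> B" "\<phi> g (\<iota> x) = \<phi> g (\<iota> y)" by blast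
    then have "x = y" using translate_inj[OF g _ _ y(2)] x(1) BA(1) AS by blast
    then show False using x y by simp
  qed
  ultimately show ?thesis
    using A' s(3,4) az by (intro conjI bexI[of _ A'] bexI[of _ "a s"]) auto
qed

end

section \<open>The two types of decomposition\<close>

theorem proposition6:
  fixes G :: "'g monoid" and L :: "'g amfd" and M :: "'m amfd" and \<phi> :: "'g \<Rightarrow> 'm \<Rightarrow> 'm"
    and S :: "'s amfd" and \<iota> :: "'s \<Rightarrow> 'm"
    and A K :: "'s set" and n :: int and n\<^sub>m n\<^sub>p :: "int extended"
    and sg :: "int \<Rightarrow> 's set" and g :: "int \<Rightarrow> 'g" and z\<^sub>0 z\<^sub>1 z\<^sub>1' :: 's
  assumes "lie_group G L" and "analytic_manifold M"
    and "pointwise_continuous_action G L M \<phi>"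
    and "non_contractive G M \<phi>"
    and "analytic_1_submanifold M S \<iota>"
    and "free_submanifold G M \<phi> S \<iota>"
    and "points S \<notin> free_segments G M \<phi> S \<iota>"
    and "positive_submanifold G M \<phi> S \<iota>"
    and "A \<in> max_free_segments G M \<phi> S \<iota>" and "compactin (mtop S) A"
    and "A \<subset> seg_int S (points S)"
    and "circle_decomposition G M \<phi> S \<iota> A n sg g \<or>
         interval_decomposition G M \<phi> S \<iota> A n\<^sub>m n\<^sub>p sg g"
    and "seg_bd S (sg 0) = {z\<^sub>0, z\<^sub>1}" and "z\<^sub>1 \<in> seg_bd S (sg 1)"
    and "K \<in> segments S" and "compactin (mtop S) K" and "K \<subseteq> sg 1"
    and "seg_bd S K = {z\<^sub>1, z\<^sub>1'}"
  shows "\<phi> (g 1) (\<iota> z\<^sub>0) = \<iota> z\<^sub>1 \<and>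
    (\<exists>A' \<in> max_free_segments G M \<phi> S \<iota>. \<exists>z\<^sub>0' \<in> sg 0.
       compactin (mtop S) A' \<and> positive_segment G M \<phi> S \<iota> A' \<and>
       A' \<subseteq> sg 0 \<union> sg 1 \<and> K \<subseteq> A' \<and> seg_bd S A' = {z\<^sub>0', z\<^sub>1'} \<and>
       (z\<^sub>1' \<in> seg_int S (sg 1) \<longrightarrow>
          z\<^sub>0' \<in> seg_int S (sg 0) \<and> z\<^sub>1 \<in> seg_int S A' \<and> A' \<subset> seg_int S (sg 0 \<union> sg 1)) \<and>
       (interval_like S \<and> n\<^sub>p = Fin 1 \<and> K = sg 1 \<and>
        (\<exists>B. boundary_segment S (sg 0) B \<and> \<phi> (g 1) ` \<iota> ` B = \<iota> ` sg 1 \<and> B \<subset> sg 0) \<longrightarrow>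
          z\<^sub>0' \<in> seg_int S (sg 0) \<and> z\<^sub>1 \<in> seg_int S A' \<and> A' \<subseteq> sg 0 \<union> sg 1))"
proof -
  have ll: "line_like S" and A0: "sg 0 = A"
    using assms(12) unfolding line_like_def circle_decomposition_def interval_decomposition_def by blast+
  interpret acted_curve G M \<phi> S \<iota>
  proof (rule acted_curve.intro)
    show "group_action G (points M) \<phi>" using assms(3) by (simp add: pointwise_continuous_action_def)
    show "analytic_in G M \<phi>" using assms(4) by (simp add: non_contractive_def)
  qed (rule assms(2) assms(5) ll)+
  have AF: "A \<in> Free" using assms(9) by (simp add: max_free_segments_def)
  have posA: "positive_segment G M \<phi> S \<iota> A" using assms(8-10) unfolding positive_submanifold_def by blast
  have segA: "A \<in> segments S" using AF by (simp add: free_segments_def)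
  have AS: "A \<subseteq> points S" using segA connectedin_subset_topspace unfolding segments_def by blast
  have bdA: "seg_bd S A = {z\<^sub>0, z\<^sub>1}" using assms(13) A0 by simp
  have zA: "z\<^sub>1 \<in> A" using bdA unfolding seg_bd_def by blast
  have zB: "z\<^sub>1 \<in> sg 1" using assms(14) unfolding seg_bd_def by blast
  \<comment> \<open>For a full translate \<open>D\<close> is \<open>A\<close> itself and nothing
    remains of \<open>A\<close>.\<close>
  have empty: "connectedin X (A - A)" by simp
  note concl = adjacent_conclusion[OF AF assms(10,11,8) posA _ _ _ _ _ _ _ _ bdA assms(14) _ assms(15-18)]
  have "\<phi> (g 1) (\<iota> z\<^sub>0) = \<iota> z\<^sub>1 \<and>
    (\<exists>A' \<in> max_free_segments G M \<phi> S \<iota>. \<exists>z0' \<in> A.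
       compactin X A' \<and> positive_segment G M \<phi> S \<iota> A' \<and>
       A' \<subseteq> A \<union> sg 1 \<and> K \<subseteq> A' \<and> seg_bd S A' = {z0', z\<^sub>1'} \<and>
       (z\<^sub>1' \<in> seg_int S (sg 1) \<longrightarrow>
          z0' \<in> seg_int S A \<and> z\<^sub>1 \<in> seg_int S A' \<and> A' \<subset> seg_int S (A \<union> sg 1)) \<and>
       (K = sg 1 \<and> (\<exists>B. boundary_segment S A B \<and> \<phi> (g 1) ` \<iota> ` B = \<iota> ` sg 1 \<and> B \<subset> A) \<longrightarrow>
          z0' \<in> seg_int S A \<and> z\<^sub>1 \<in> seg_int S A' \<and> A' \<subseteq> A \<union> sg 1))"
    using assms(12)
  proof
    assume "circle_decomposition G M \<phi> S \<iota> A n sg g"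
    note dec = this[unfolded circle_decomposition_def]
    have n: "n \<ge> 1" using dec by (elim conjE)
    have all: "\<forall>k\<in>{0..n}. sg k \<in> max_free_segments G M \<phi> S \<iota> \<and> compactin (mtop S) (sg k) \<and>
        g k \<in> carrier G \<and> \<phi> (g k) ` \<iota> ` sg 0 = \<iota> ` sg k"
      using dec by (elim conjE)
    have pair: "n = 1 \<longrightarrow> sg 0 \<inter> sg 1 = seg_bd S (sg 0) \<inter> seg_bd S (sg 1) \<and>
        sg 0 \<inter> sg 1 = seg_bd S (sg 0) \<and> sg 0 \<inter> sg 1 = seg_bd S (sg 1) \<and> card (sg 0 \<inter> sg 1) = 2"
      using dec by (elim conjE)
    have chain: "n \<ge> 2 \<longrightarrow> (\<forall>p\<in>{0..n}. \<forall>q\<in>{0..n}.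
        (\<bar>p - q\<bar> \<in> {1, n} \<longrightarrow>
           sg p \<inter> sg q = seg_bd S (sg p) \<inter> seg_bd S (sg q) \<and> is_singleton (sg p \<inter> sg q)) \<and>
        (2 \<le> \<bar>p - q\<bar> \<and> \<bar>p - q\<bar> \<le> n - 1 \<longrightarrow> sg p \<inter> sg q = {}))"
      using dec by (elim conjE)
    have "1 \<in> {0..n}" using n by simp
    from bspec[OF all this] have B: "sg 1 \<in> max_free_segments G M \<phi> S \<iota>" "compactin X (sg 1)" "g 1 \<in> carrier G"
        "\<phi> (g 1) ` \<iota> ` A = \<iota> ` sg 1"
      unfolding A0 by blast+
    have segB: "sg 1 \<in> segments S" using B(1) by (simp add: max_free_segments_def free_segments_def)
    have AB: "A \<inter> sg 1 = seg_bd S A \<inter> seg_bd S (sg 1)"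
    proof (cases "n = 1")
      case True
      then show ?thesis using pair A0 by simp
    next
      case False
      then have n2: "n \<ge> 2" using n by simp
      then have "0 \<in> {0..n}" "1 \<in> {0..n}" "\<bar>0 - (1::int)\<bar> \<in> {1, n}" by auto
      then show ?thesis using bspec[OF bspec[OF mp[OF chain n2]], of 0 1] A0 by blast
    qed
    show ?thesis
    proof (rule concl[OF B(3) segB compact_embedded[OF B(2) order_refl] AB segA order_refl empty B(4)])
      \<comment> \<open>On the circle \<open>sg 1\<close> is itself maximal, so no free segment
        reaches beyond it.\<close>
      fix C q assume h: "C \<in> Free" "sg 1 \<subseteq> C" "arcin X C 0 1 q" "\<And>u. 0 < u \<Longrightarrow> u \<le> 1 \<Longrightarrow> q u \<notin> sg 1"
      have "C = sg 1" using B(1) h(1,2) unfolding max_free_segments_def by blast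
      moreover have "q 1 \<in> C" using h(3) by (auto simp: arcin_def)
      ultimately show False using h(4)[of 1] by simp
    qed
  next
    assume "interval_decomposition G M \<phi> S \<iota> A n\<^sub>m n\<^sub>p sg g"
    note dec = this[unfolded interval_decomposition_def]
    have il: "interval_like S" using dec by (elim conjE)
    have nm: "n\<^sub>m < Fin 0" using dec by (elim conjE)
    have np: "Fin 0 < n\<^sub>p" using dec by (elim conjE)
    note nn = nm np
    have idx: "n\<^sub>m \<le> Fin 0 \<and> Fin 0 \<le> n\<^sub>p" "n\<^sub>m \<le> Fin 1 \<and> Fin 1 \<le> n\<^sub>p" "n\<^sub>m < Fin 1"
      using nn by (cases n\<^sub>m; cases n\<^sub>p; simp)+
    have "\<forall>n. n\<^sub>m \<le> Fin n \<and> Fin n \<le> n\<^sub>p \<longrightarrow> g n \<in> carrier G \<and> sg n \<in> segments S \<and> embedded M S \<iota> (sg n)"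
      using dec by (elim conjE)
    then have el: "g k \<in> carrier G" "sg k \<in> segments S" "embedded M S \<iota> (sg k)" if "n\<^sub>m \<le> Fin k \<and> Fin k \<le> n\<^sub>p" for k
      using that by blast+
    have "\<forall>p q. n\<^sub>m \<le> Fin p \<and> Fin p \<le> n\<^sub>p \<and> n\<^sub>m \<le> Fin q \<and> Fin q \<le> n\<^sub>p \<longrightarrow>
        (\<bar>p - q\<bar> = 1 \<longrightarrow>
           sg p \<inter> sg q = seg_bd S (sg p) \<inter> seg_bd S (sg q) \<and> is_singleton (sg p \<inter> sg q)) \<and>
        (2 \<le> \<bar>p - q\<bar> \<longrightarrow> sg p \<inter> sg q = {})"
      using dec by (elim conjE)
    note chain = this[rule_format]
    have adj: "sg k \<inter> sg l = seg_bd S (sg k) \<inter> seg_bd S (sg l)" "is_singleton (sg k \<inter> sg l)"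
      if "n\<^sub>m \<le> Fin k \<and> Fin k \<le> n\<^sub>p" "n\<^sub>m \<le> Fin l \<and> Fin l \<le> n\<^sub>p" "\<bar>k - l\<bar> = 1" for k l
      using chain[of k l] that by blast+
    have far: "sg k \<inter> sg l = {}"
      if "n\<^sub>m \<le> Fin k \<and> Fin k \<le> n\<^sub>p" "n\<^sub>m \<le> Fin l \<and> Fin l \<le> n\<^sub>p" "2 \<le> \<bar>k - l\<bar>" for k l
      using chain[of k l] that by blast
    have "\<forall>n. n\<^sub>m < Fin n \<and> Fin n < n\<^sub>p \<longrightarrow> \<phi> (g n) ` \<iota> ` sg 0 = \<iota> ` sg n" using dec by (elim conjE)
    then have mid: "\<phi> (g k) ` \<iota> ` A = \<iota> ` sg k" if "n\<^sub>m < Fin k \<and> Fin k < n\<^sub>p" for k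
      unfolding A0 using that by blast
    have "\<forall>n. Fin n = n\<^sub>m \<or> Fin n = n\<^sub>p \<longrightarrow>
        boundary_segment S (points S) (sg n) \<and>
        (\<exists>B. boundary_segment S (sg 0) B \<and> \<phi> (g n) ` \<iota> ` B = \<iota> ` sg n)"
      using dec by (elim conjE)
    then have last: "boundary_segment S (points S) (sg k)" "\<exists>B. boundary_segment S A B \<and> \<phi> (g k) ` \<iota> ` B = \<iota> ` sg k"
      if "Fin k = n\<^sub>p" for k
      unfolding A0 using that by blast+
    have AB: "A \<inter> sg 1 = seg_bd S A \<inter> seg_bd S (sg 1)" "A \<inter> sg 1 = {z\<^sub>1}"
    proof -
      show "A \<inter> sg 1 = seg_bd S A \<inter> seg_bd S (sg 1)" using adj(1)[OF idx(1,2)] A0 by simp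
      have "is_singleton (A \<inter> sg 1)" using adj(2)[OF idx(1,2)] A0 by simp
      then show "A \<inter> sg 1 = {z\<^sub>1}" using zA zB by (metis IntI is_singletonE singletonD)
    qed
    have con1: "connectedin X (sg 1)" using el(2)[OF idx(2)] by (simp add: segments_def)
    \<comment> \<open>\<open>A\<close> meets \<open>sg 1\<close> in one point only and has
      others.\<close>
    have Bn: "sg 1 \<noteq> points S"
    proof
      assume "sg 1 = points S"
      then have "A = {z\<^sub>1}" using AB(2) AS by blast
      then show False using segA unfolding segments_def by auto
    qed
    consider "Fin 1 < n\<^sub>p" | "Fin 1 = n\<^sub>p" using idx(2) by fastforce
    then show ?thesis
    proof cases
      case 1
      have g1: "\<phi> (g 1) ` \<iota> ` A = \<iota> ` sg 1" using mid idx(3) 1 by blast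
      have idx2: "n\<^sub>m \<le> Fin 2 \<and> Fin 2 \<le> n\<^sub>p" "n\<^sub>m < Fin 2" using nn 1 by (cases n\<^sub>m; cases n\<^sub>p; simp)+
      \<comment> \<open>The next segment may be the last one, and then it is the image of a boundary
        segment of \<open>A\<close> only.\<close>
      have "\<exists>C2. C2 \<subseteq> A \<and> \<phi> (g 2) ` \<iota> ` C2 = \<iota> ` sg 2"
      proof (cases "Fin 2 = n\<^sub>p")
        case True
        then show ?thesis using last(2)[OF True] unfolding boundary_segment_def by blast
      next
        case False
        then have "Fin 2 < n\<^sub>p" using idx2(1) by fastforce
        then have "\<phi> (g 2) ` \<iota> ` A = \<iota> ` sg 2" using mid idx2(2) by simp
        then show ?thesis by (intro exI[of _ A] conjI order_refl)
      qed
      then obtain C2 where C2: "C2 \<subseteq> A" "\<phi> (g 2) ` \<iota> ` C2 = \<iota> ` sg 2" by blast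
      show ?thesis
      proof (rule concl[OF el[OF idx(2)] AB(1) segA order_refl empty g1])
        fix C q assume h: "C \<in> Free" "compactin X (sg 1)" "sg 1 \<subseteq> C" "arcin X C 0 1 q" "q 0 \<in> seg_bd S (sg 1)"
          "q 0 \<noteq> z\<^sub>1" "\<And>u. 0 < u \<Longrightarrow> u \<le> 1 \<Longrightarrow> q u \<notin> sg 1"
        have qB: "q 0 \<in> sg 1" using h(5) unfolding seg_bd_def by blast
        obtain p c d where p: "arcin X (sg 1) c d p" "p ` {c..d} = sg 1"
          by (rule compact_arc[OF con1 h(2) Bn qB zB h(6)])
        have bdB: "seg_bd S (sg 1) = {z\<^sub>1, q 0}"
          using seg_bd_arc[OF ll p(1)] p(2) h(5,6) assms(14) by auto
        \<comment> \<open>\<open>sg 2\<close> is disjoint from \<open>A\<close>, so it is attached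
          at the end of \<open>sg 1\<close> other than \<open>z\<^sub>1\<close>.\<close>
        have 12: "sg 1 \<inter> sg 2 = {q 0}"
        proof -
          have "sg 0 \<inter> sg 2 = {}" using far[OF idx(1) idx2(1)] by simp
          then have "z\<^sub>1 \<notin> sg 2" using zA A0 by blast
          moreover have "sg 1 \<inter> sg 2 \<subseteq> {z\<^sub>1, q 0}" using adj(1)[OF idx(2) idx2(1)] bdB by auto
          moreover have "sg 1 \<inter> sg 2 \<noteq> {}" using adj(2)[OF idx(2) idx2(1)] by (auto simp: is_singleton_def)
          ultimately show ?thesis by blast
        qed
        show False
          by (rule next_translate_end[OF el(1)[OF idx(2)] g1 el(1)[OF idx2(1)] C2(2,1) AS assms(10)
                el(2)[OF idx2(1)] 12 con1 h(2) Bn bdB h(6)[symmetric] h(1,3,4) refl h(7)])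
      qed
    next
      case 2
      obtain D where D: "boundary_segment S A D" "\<phi> (g 1) ` \<iota> ` D = \<iota> ` sg 1" using last(2)[OF 2] by blast
      have D': "D \<in> segments S" "D \<subseteq> A" "connectedin X (A - D)" using D(1) by (auto simp: boundary_segment_def)
      show ?thesis
      proof (rule concl[OF el[OF idx(2)] AB(1) D' D(2)])
        fix C q assume h: "C \<in> Free" "compactin X (sg 1)" "sg 1 \<subseteq> C" "arcin X C 0 1 q" "q 0 \<in> seg_bd S (sg 1)"
          "q 0 \<noteq> z\<^sub>1" "\<And>u. 0 < u \<Longrightarrow> u \<le> 1 \<Longrightarrow> q u \<notin> sg 1"
        have qB: "q 0 \<in> sg 1" using h(5) unfolding seg_bd_def by blast
        have conS: "connectedin X (points S - sg 1)" using last(1)[OF 2] by (simp add: boundary_segment_def)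
        \<comment> \<open>An arc of \<open>A\<close> leaves \<open>sg 1\<close> at
          \<open>z\<^sub>1\<close>. The complement of the last segment is connected, so
          \<open>q\<close> would have to leave there too.\<close>
        obtain y where y: "y \<in> A" "z\<^sub>1 \<noteq> y" using segA unfolding segments_def by blast
        have conA: "connectedin X A" using segA by (simp add: segments_def)
        obtain r where r: "arcin X A 0 1 r" "r 0 = z\<^sub>1" "r 1 = y" by (rule arc_between[OF conA zA y])
        have rB: "r u \<notin> sg 1" if u: "0 < u" "u \<le> 1" for u
        proof
          assume "r u \<in> sg 1"
          moreover have "r u \<in> A" using r(1) u by (auto simp: arcin_def)
          ultimately have "r u = r 0" using AB(2) r(2) by blast
          then show False using arcin_inj[OF r(1), of u 0] u by simp
        qed
        have "r 0 = q 0"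
          by (rule connected_complement_end[OF il conS con1 h(2) r(1) _ rB h(4) qB h(7)]) (use r(2) zB in auto)
        then show False using r(2) h(6) by simp
      qed
    qed
  qed
  then show ?thesis
    unfolding A0
  proof (elim conjE bexE, goal_cases)
    case (1 A' z0')
    then show ?case by (intro conjI bexI[of _ A'] bexI[of _ z0'] impI; simp)
  qed
qed



end
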